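(* Let $\mathbb{K}=\mathbb{Z}$, $\mathbb{Q}$ or $\mathbb{F}_p$ ($p$ prime) and let $r\geq 1$. Let $\bar{K}(r)$ be the pointed simplicial set of chains of partitions of $\{1,\dots,r\}$ running from the one-block partition to the partition into singletons. Then there is an isomorphism of graded $\Sigma_r$-modules $$\tilde{H}_*(\bar{K}(r),\mathbb{K})=\begin{cases}\mathcal{L}(r)^{\vee}\otimes\mathrm{sgn}_r, & \text{if } *=r-1,\\ 0,&\text{otherwise,}\end{cases}$$ where $\mathcal{L}(r)$ is the $r$-th component of the Lie operad over $\mathbb{K}$, $\mathcal{L}(r)^{\vee}$ is its dual representation and $\mathrm{sgn}_r$ is the signature representation of $\Sigma_r$.
   Context: Partitions of $\{1,\dots,r\}$ (into non-empty unordered blocks) are ordered by refinement: $\lambda\leq\mu$ if $\mu$ refines $\lambda$. The smallest partition is the single block $\{1,\dots,r\}$ and the largest is $\{1\},\dots,\{r\}$. The symmetric group $\Sigma_r$ acts on partitions by permuting elements. $\bar{K}(r)$ is the pointed simplicial set whose non-base-point $n$-simplices are the sequences $\lambda_0\leq\lambda_1\leq\dots\leq\lambda_n$ of partitions with $\lambda_0=\{1,\dots,r\}$ (one block) and $\lambda_n=\{1\},\dots,\{r\}$ (all singletons). The face $d_i$ omits $\lambda_i$; the result is the base point if it no longer starts at the smallest partition or no longer ends at the largest one. The degeneracy $s_j$ repeats $\lambda_j$. $\tilde{H}_*$ is reduced homology (relative to the base point), on which $\Sigma_r$ acts. $\mathcal{L}(r)$ is the $\mathbb{K}$-submodule of the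 free Lie algebra over $\mathbb{K}$ on $x_1,\dots,x_r$ spanned by the Lie monomials of degree exactly $1$ in each variable, with $\Sigma_r$ acting by permutation of the variables. For a $\Sigma_r$-module $M$, $M^{\vee}=\mathrm{Hom}_{\mathbb{K}}(M,\mathbb{K})$ with $(w\cdot f)(x)=f(w^{-1}\cdot x)$. *)

theory Defs
  imports
    "Berlekamp_Zassenhaus.Finite_Field"
    "HOL-Library.Disjoint_Sets"
    "HOL-Library.Poly_Mapping"
    "HOL-Combinatorics.Permutations"
    "HOL-Algebra.QuotRing"
    "HOL-Algebra.Module"
    "HOL-Algebra.Sym_Groups"
begin

hide_const (open) Multiset.mult Polynomial.smult

section \<open>Modules with a group action\<close>

definition type_ring :: "'k::comm_ring_1 ring" where
  "type_ring = \<lparr>carrier = UNIV, mult = (*), one = 1, zero = 0, add = (+)\<rparr>"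

record ('k, 'm, 'g) gmodule = "('k, 'm) module" +
  act :: "'g \<Rightarrow> 'm \<Rightarrow> 'm"

definition is_gmodule ::
  "('k, 'r) ring_scheme \<Rightarrow> ('g, 'h) monoid_scheme \<Rightarrow> ('k, 'm, 'g) gmodule \<Rightarrow> bool" where
  "is_gmodule R G M \<longleftrightarrow> module R M \<and> group G \<and>
     (\<forall>g\<in>carrier G. \<forall>x\<in>carrier M. act M g x \<in> carrier M) \<and>
     (\<forall>g\<in>carrier G. \<forall>x\<in>carrier M. \<forall>y\<in>carrier M.
        act M g (x \<oplus>\<^bsub>M\<^esub> y) = act M g x \<oplus>\<^bsub>M\<^esub> act M g y) \<and>
     (\<forall>g\<in>carrier G. \<forall>c\<in>carrier R. \<forall>x\<in>carrier M.
        act M g (c \<odot>\<^bsub>M\<^esub> x) = c \<odot>\<^bsub>M\<^esub> act M g x) \<and>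
     (\<forall>x\<in>carrier M. act M \<one>\<^bsub>G\<^esub> x = x) \<and>
     (\<forall>g\<in>carrier G. \<forall>h\<in>carrier G. \<forall>x\<in>carrier M.
        act M (g \<otimes>\<^bsub>G\<^esub> h) x = act M g (act M h x))"

definition gmodule_hom ::
  "('k, 'r) ring_scheme \<Rightarrow> ('g, 'h) monoid_scheme \<Rightarrow> ('k, 'm, 'g) gmodule \<Rightarrow> ('k, 'n, 'g) gmodule
     \<Rightarrow> ('m \<Rightarrow> 'n) set" where
  "gmodule_hom R G M N = {\<phi>. \<phi> \<in> carrier M \<rightarrow> carrier N \<and>
     (\<forall>x\<in>carrier M. \<forall>y\<in>carrier M. \<phi> (x \<oplus>\<^bsub>M\<^esub> y) = \<phi> x \<oplus>\<^bsub>N\<^esub> \<phi> y) \<and>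
     (\<forall>c\<in>carrier R. \<forall>x\<in>carrier M. \<phi> (c \<odot>\<^bsub>M\<^esub> x) = c \<odot>\<^bsub>N\<^esub> \<phi> x) \<and>
     (\<forall>g\<in>carrier G. \<forall>x\<in>carrier M. \<phi> (act M g x) = act N g (\<phi> x))}"

definition gmodule_iso ::
  "('k, 'r) ring_scheme \<Rightarrow> ('g, 'h) monoid_scheme \<Rightarrow> ('k, 'm, 'g) gmodule \<Rightarrow> ('k, 'n, 'g) gmodule
     \<Rightarrow> bool" where
  "gmodule_iso R G M N \<longleftrightarrow> is_gmodule R G M \<and> is_gmodule R G N \<and>
     (\<exists>\<phi>\<in>gmodule_hom R G M N. bij_betw \<phi> (carrier M) (carrier N))"

definition graded_gmodule_iso ::
  "('k, 'r) ring_scheme \<Rightarrow> ('g, 'h) monoid_scheme \<Rightarrow> (nat \<Rightarrow> ('k, 'm, 'g) gmodule)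
     \<Rightarrow> (nat \<Rightarrow> ('k, 'n, 'g) gmodule) \<Rightarrow> bool" where
  "graded_gmodule_iso R G M N \<longleftrightarrow> (\<forall>n. gmodule_iso R G (M n) (N n))"

definition zero_gmodule :: "('k, 'm, 'g) gmodule" where
  "zero_gmodule =
     \<lparr>carrier = {undefined}, mult = \<lambda>_ _. undefined, one = undefined, zero = undefined,
      add = \<lambda>_ _. undefined, smult = \<lambda>_ _. undefined, act = \<lambda>_ _. undefined\<rparr>"

definition submodule_span :: "('k::comm_ring_1, 'm, 'g) gmodule \<Rightarrow> 'm set \<Rightarrow> 'm set" where
  "submodule_span M S = (\<lambda>N. submodule N type_ring M) hull S"

text \<open>
  The quotient consists of the additive cosets of \<open>N\<close>.  As in \<^const>\<open>FactRing\<close>, the multiplication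
  of cosets is the induced one; it is meaningful only if \<open>M\<close> is an algebra and \<open>N\<close> a two-sided ideal.
\<close>

definition quotient_gmodule ::
  "('k, 'm, 'g) gmodule \<Rightarrow> 'm set \<Rightarrow> ('k, 'm set, 'g) gmodule" where
  "quotient_gmodule M N =
     \<lparr>carrier = a_rcosets\<^bsub>M\<^esub> N, mult = rcoset_mult M N, one = N +>\<^bsub>M\<^esub> \<one>\<^bsub>M\<^esub>,
      zero = N, add = set_add M,
      smult = \<lambda>c A. \<Union>a\<in>A. N +>\<^bsub>M\<^esub> (c \<odot>\<^bsub>M\<^esub> a),
      act = \<lambda>g A. act M g ` A\<rparr>"

definition pm_scale :: "'k::comm_ring_1 \<Rightarrow> ('x \<Rightarrow>\<^sub>0 'k) \<Rightarrow> ('x \<Rightarrow>\<^sub>0 'k)" where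
  "pm_scale c f = Poly_Mapping.map ((*) c) f"

definition lin_ext :: "('x \<Rightarrow> ('y \<Rightarrow>\<^sub>0 'k)) \<Rightarrow> ('x \<Rightarrow>\<^sub>0 'k::comm_ring_1) \<Rightarrow> ('y \<Rightarrow>\<^sub>0 'k)" where
  "lin_ext \<phi> f = (\<Sum>x\<in>Poly_Mapping.keys f. pm_scale (Poly_Mapping.lookup f x) (\<phi> x))"

definition free_gmodule ::
  "'x set \<Rightarrow> ('g \<Rightarrow> 'x \<Rightarrow> 'x) \<Rightarrow> ('k::comm_ring_1, 'x \<Rightarrow>\<^sub>0 'k, 'g) gmodule" where
  "free_gmodule S \<alpha> =
     \<lparr>carrier = {f. Poly_Mapping.keys f \<subseteq> S}, mult = undefined, one = undefined,
      zero = 0, add = (+), smult = pm_scale,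
      act = \<lambda>g. lin_ext (\<lambda>x. Poly_Mapping.single (\<alpha> g x) 1)\<rparr>"

definition dual_gmodule ::
  "('g, 'h) monoid_scheme \<Rightarrow> ('k::comm_ring_1, 'm, 'g) gmodule \<Rightarrow> ('k, 'm \<Rightarrow> 'k, 'g) gmodule" where
  "dual_gmodule G M =
     \<lparr>carrier = {f \<in> carrier M \<rightarrow>\<^sub>E UNIV.
        (\<forall>x\<in>carrier M. \<forall>y\<in>carrier M. f (x \<oplus>\<^bsub>M\<^esub> y) = f x + f y) \<and>
        (\<forall>c. \<forall>x\<in>carrier M. f (c \<odot>\<^bsub>M\<^esub> x) = c * f x)},
      mult = undefined, one = undefined,
      zero = \<lambda>x\<in>carrier M. 0,
      add = \<lambda>f g. \<lambda>x\<in>carrier M. f x + g x,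
      smult = \<lambda>c f. \<lambda>x\<in>carrier M. c * f x,
      act = \<lambda>w f. \<lambda>x\<in>carrier M. f (act M (inv\<^bsub>G\<^esub> w) x)\<rparr>"

definition tensor_relations ::
  "('k::comm_ring_1, 'm, 'g) gmodule \<Rightarrow> ('k, 'n, 'g) gmodule \<Rightarrow> ('m \<times> 'n \<Rightarrow>\<^sub>0 'k) set" where
  "tensor_relations M N =
     {Poly_Mapping.single (x \<oplus>\<^bsub>M\<^esub> x', y) 1 - Poly_Mapping.single (x, y) 1
        - Poly_Mapping.single (x', y) 1 | x x' y.
        x \<in> carrier M \<and> x' \<in> carrier M \<and> y \<in> carrier N} \<union>
     {Poly_Mapping.single (x, y \<oplus>\<^bsub>N\<^esub> y') 1 - Poly_Mapping.single (x, y) 1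
        - Poly_Mapping.single (x, y') 1 | x y y'.
        x \<in> carrier M \<and> y \<in> carrier N \<and> y' \<in> carrier N} \<union>
     {Poly_Mapping.single (c \<odot>\<^bsub>M\<^esub> x, y) 1 - Poly_Mapping.single (x, y) c | c x y.
        x \<in> carrier M \<and> y \<in> carrier N} \<union>
     {Poly_Mapping.single (x, c \<odot>\<^bsub>N\<^esub> y) 1 - Poly_Mapping.single (x, y) c | c x y.
        x \<in> carrier M \<and> y \<in> carrier N}"

definition tensor_gmodule ::
  "('k::comm_ring_1, 'm, 'g) gmodule \<Rightarrow> ('k, 'n, 'g) gmodule
     \<Rightarrow> ('k, ('m \<times> 'n \<Rightarrow>\<^sub>0 'k) set, 'g) gmodule" where
  "tensor_gmodule M N =
     (let F = free_gmodule (carrier M \<times> carrier N) (\<lambda>g (x, y). (act M g x, act N g y))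
      in quotient_gmodule F (submodule_span F (tensor_relations M N)))"

definition sgn_gmodule :: "('k::comm_ring_1, 'k, nat \<Rightarrow> nat) gmodule" where
  "sgn_gmodule =
     \<lparr>carrier = UNIV, mult = (*), one = 1, zero = 0, add = (+), smult = (*),
      act = \<lambda>w c. of_int (sign w) * c\<rparr>"


section \<open>Pointed simplicial sets and reduced homology\<close>

record 'a pointed_sset =
  simplices :: "nat \<Rightarrow> 'a set"
  basept :: "nat \<Rightarrow> 'a"
  face :: "nat \<Rightarrow> nat \<Rightarrow> 'a \<Rightarrow> 'a"
  degen :: "nat \<Rightarrow> nat \<Rightarrow> 'a \<Rightarrow> 'a"

text \<open>
  \<open>face X n i\<close> is the face \<open>d\<^sub>i\<close> from dimension \<open>n\<close> to dimension \<open>n - 1\<close> (for \<open>n > 0\<close>), and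
  \<open>degen X n j\<close> is the degeneracy \<open>s\<^sub>j\<close> from dimension \<open>n\<close> to dimension \<open>n + 1\<close>.
\<close>

locale pointed_simplicial_set =
  fixes X :: "'a pointed_sset"
  assumes basept_in: "basept X n \<in> simplices X n"
    and face_in: "x \<in> simplices X (Suc n) \<Longrightarrow> i \<le> Suc n \<Longrightarrow> face X (Suc n) i x \<in> simplices X n"
    and degen_in: "x \<in> simplices X n \<Longrightarrow> j \<le> n \<Longrightarrow> degen X n j x \<in> simplices X (Suc n)"
    and face_basept: "i \<le> Suc n \<Longrightarrow> face X (Suc n) i (basept X (Suc n)) = basept X n"
    and degen_basept: "j \<le> n \<Longrightarrow> degen X n j (basept X n) = basept X (Suc n)"
    and face_face: "x \<in> simplices X (Suc (Suc n)) \<Longrightarrow> i < j \<Longrightarrow> j \<le> Suc (Suc n) \<Longrightarrow>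
      face X (Suc n) i (face X (Suc (Suc n)) j x)
        = face X (Suc n) (j - 1) (face X (Suc (Suc n)) i x)"
    and degen_degen: "x \<in> simplices X n \<Longrightarrow> i \<le> j \<Longrightarrow> j \<le> n \<Longrightarrow>
      degen X (Suc n) i (degen X n j x) = degen X (Suc n) (Suc j) (degen X n i x)"
    and face_degen_less: "x \<in> simplices X (Suc n) \<Longrightarrow> i < j \<Longrightarrow> j \<le> Suc n \<Longrightarrow>
      face X (Suc (Suc n)) i (degen X (Suc n) j x) = degen X n (j - 1) (face X (Suc n) i x)"
    and face_degen_same: "x \<in> simplices X n \<Longrightarrow> j \<le> n \<Longrightarrow> i = j \<or> i = Suc j \<Longrightarrow>
      face X (Suc n) i (degen X n j x) = x"
    and face_degen_greater: "x \<in> simplices X (Suc n) \<Longrightarrow> Suc j < i \<Longrightarrow> i \<le> Suc (Suc n) \<Longrightarrow>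
      face X (Suc (Suc n)) i (degen X (Suc n) j x) = degen X n j (face X (Suc n) (i - 1) x)"

text \<open>
  The chains relative to the base point: the quotient of the chains of \<open>X\<close> by those of the base
  point is free on the simplices other than the base point, and in the boundary the faces that are
  equal to the base point are dropped.  The argument \<open>\<alpha>\<close> is a group action by automorphisms of \<open>X\<close>.
\<close>

definition reduced_chains ::
  "'a pointed_sset \<Rightarrow> ('g \<Rightarrow> 'a \<Rightarrow> 'a) \<Rightarrow> nat \<Rightarrow> ('k::comm_ring_1, 'a \<Rightarrow>\<^sub>0 'k, 'g) gmodule" where
  "reduced_chains X \<alpha> n = free_gmodule (simplices X n - {basept X n}) \<alpha>"

definition reduced_boundary ::
  "'a pointed_sset \<Rightarrow> nat \<Rightarrow> ('a \<Rightarrow>\<^sub>0 'k::comm_ring_1) \<Rightarrow> ('a \<Rightarrow>\<^sub>0 'k)" where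
  "reduced_boundary X n =
     (if n = 0 then (\<lambda>_. 0)
      else lin_ext (\<lambda>x. \<Sum>i\<le>n. if face X n i x = basept X (n - 1) then 0
                                 else Poly_Mapping.single (face X n i x) ((- 1) ^ i)))"

definition reduced_homology ::
  "'a pointed_sset \<Rightarrow> ('g \<Rightarrow> 'a \<Rightarrow> 'a) \<Rightarrow> nat
     \<Rightarrow> ('k::comm_ring_1, ('a \<Rightarrow>\<^sub>0 'k) set, 'g) gmodule" where
  "reduced_homology X \<alpha> n =
     (let C = reduced_chains X \<alpha> n;
          Z = {z \<in> carrier C. reduced_boundary X n z = 0};
          B = reduced_boundary X (Suc n)
                ` carrier (reduced_chains X \<alpha> (Suc n) :: ('k, 'a \<Rightarrow>\<^sub>0 'k, 'g) gmodule)
      in quotient_gmodule (C\<lparr>carrier := Z\<rparr>) B)"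


section \<open>The simplicial set of chains of partitions\<close>

definition partition_le :: "nat \<Rightarrow> nat set set \<Rightarrow> nat set set \<Rightarrow> bool" where
  "partition_le r \<kappa> \<mu> \<longleftrightarrow> refines {1..r} \<mu> \<kappa>"

definition one_block :: "nat \<Rightarrow> nat set set" where
  "one_block r = {{1..r}}"

definition all_singletons :: "nat \<Rightarrow> nat set set" where
  "all_singletons r = (\<lambda>i. {i}) ` {1..r}"

definition full_chain :: "nat \<Rightarrow> nat set set list \<Rightarrow> bool" where
  "full_chain r xs \<longleftrightarrow> xs \<noteq> [] \<and> hd xs = one_block r \<and> last xs = all_singletons r"

definition omit :: "nat \<Rightarrow> 'a list \<Rightarrow> 'a list" where
  "omit i xs = take i xs @ drop (Suc i) xs"

definition repeat_at :: "nat \<Rightarrow> 'a list \<Rightarrow> 'a list" where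
  "repeat_at j xs = take (Suc j) xs @ drop j xs"

text \<open>\<^const>\<open>None\<close> is the base point in every dimension.\<close>

definition Kbar :: "nat \<Rightarrow> nat set set list option pointed_sset" where
  "Kbar r =
     \<lparr>simplices = \<lambda>n. insert None (Some ` {xs. length xs = Suc n \<and>
        (\<forall>\<kappa>\<in>set xs. partition_on {1..r} \<kappa>) \<and> sorted_wrt (partition_le r) xs \<and> full_chain r xs}),
      basept = \<lambda>n. None,
      face = \<lambda>n i x. (case x of None \<Rightarrow> None | Some xs \<Rightarrow>
        if full_chain r (omit i xs) then Some (omit i xs) else None),
      degen = \<lambda>n j x. map_option (repeat_at j) x\<rparr>"

lemma partition_le_antisym: "partition_le r \<kappa> \<mu> \<Longrightarrow> partition_le r \<mu> \<kappa> \<Longrightarrow> \<kappa> = \<mu>"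
  unfolding partition_le_def by (rule refines_asym)

lemma hd_le:
  assumes "sorted_wrt (partition_le r) xs" "\<forall>\<kappa>\<in>set xs. partition_on {1..r} \<kappa>" "x \<in> set xs"
  shows "partition_le r (hd xs) x"
  using assms by (cases xs) (auto simp: partition_le_def refines_refl)

lemma le_last:
  assumes "sorted_wrt (partition_le r) xs" "\<forall>\<kappa>\<in>set xs. partition_on {1..r} \<kappa>" "x \<in> set xs"
  shows "partition_le r x (last xs)"
  using assms by (cases xs rule: rev_cases) (auto simp: partition_le_def refines_refl sorted_wrt_append)

lemma full_chain_intermediate:
  assumes "sorted_wrt (partition_le r) xs" "\<forall>\<kappa>\<in>set xs. partition_on {1..r} \<kappa>" "full_chain r xs"
    and "sorted_wrt (partition_le r) ys" "set ys \<subseteq> set xs" "set zs \<subseteq> set ys" "full_chain r zs"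
  shows "full_chain r ys"
proof -
  have zs: "zs \<noteq> []" "hd zs = one_block r" "last zs = all_singletons r"
    using assms(7) by (auto simp: full_chain_def)
  have in_ys: "one_block r \<in> set ys" "all_singletons r \<in> set ys"
    using zs assms(6) by (metis hd_in_set subsetD, metis last_in_set subsetD)
  then have ne: "ys \<noteq> []" by auto
  have p: "\<forall>\<kappa>\<in>set ys. partition_on {1..r} \<kappa>" using assms(2,5) by auto
  have mem: "hd ys \<in> set xs" "last ys \<in> set xs" using ne assms(5) by auto
  have "partition_le r (hd ys) (one_block r)" using hd_le[OF assms(4) p in_ys(1)] .
  moreover have "partition_le r (one_block r) (hd ys)"
    using hd_le[OF assms(1,2) mem(1)] assms(3) by (simp add: full_chain_def)
  moreover have "partition_le r (all_singletons r) (last ys)" using le_last[OF assms(4) p in_ys(2)] .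
  moreover have "partition_le r (last ys) (all_singletons r)"
    using le_last[OF assms(1,2) mem(2)] assms(3) by (simp add: full_chain_def)
  ultimately show ?thesis using ne partition_le_antisym by (auto simp: full_chain_def)
qed

lemma length_omit: "i < length xs \<Longrightarrow> length (omit i xs) = length xs - 1"
  by (simp add: omit_def)

lemma length_repeat_at: "j < length xs \<Longrightarrow> length (repeat_at j xs) = Suc (length xs)"
  by (simp add: repeat_at_def)

lemma nth_omit: "i < length xs \<Longrightarrow> k < length xs - 1 \<Longrightarrow>
    omit i xs ! k = (if k < i then xs ! k else xs ! Suc k)"
  by (auto simp: omit_def nth_append min_def)

lemma nth_repeat_at: "j < length xs \<Longrightarrow> k \<le> length xs \<Longrightarrow>
    repeat_at j xs ! k = (if k \<le> j then xs ! k else xs ! (k - 1))"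
  by (cases "k = Suc j") (auto simp: repeat_at_def nth_append min_def)

lemma set_omit: "set (omit i xs) \<subseteq> set xs"
  by (auto simp: omit_def dest: in_set_takeD in_set_dropD)

lemma set_repeat_at: "set (repeat_at i xs) \<subseteq> set xs"
  by (auto simp: repeat_at_def dest: in_set_takeD in_set_dropD)

lemma sorted_omit: "sorted_wrt P xs \<Longrightarrow> i < length xs \<Longrightarrow> sorted_wrt P (omit i xs)"
  by (auto simp: sorted_wrt_iff_nth_less length_omit nth_omit)

lemma sorted_repeat_at:
  assumes "sorted_wrt P xs" "\<forall>x\<in>set xs. P x x" "i < length xs"
  shows "sorted_wrt P (repeat_at i xs)"
  unfolding sorted_wrt_iff_nth_less
proof (intro allI impI)
  fix a b assume ab: "a < b" "b < length (repeat_at i xs)"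
  show "P (repeat_at i xs ! a) (repeat_at i xs ! b)"
  proof (cases "a = i \<and> b = Suc i")
    case True
    then show ?thesis using assms by (simp add: nth_repeat_at)
  next
    case False
    then show ?thesis using assms(1,3) ab
      by (auto simp: sorted_wrt_iff_nth_less nth_repeat_at length_repeat_at)
  qed
qed

lemma full_repeat_at: "j < length xs \<Longrightarrow> full_chain r (repeat_at j xs) = full_chain r xs"
  by (cases xs) (auto simp: full_chain_def repeat_at_def)

lemma omit_omit:
  assumes "i < j" "j < length xs"
  shows "omit i (omit j xs) = omit (j - 1) (omit i xs)"
  using assms by (intro nth_equalityI) (auto simp: length_omit nth_omit)

lemma repeat_repeat:
  assumes "i \<le> j" "j < length xs"
  shows "repeat_at i (repeat_at j xs) = repeat_at (Suc j) (repeat_at i xs)"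
  using assms by (intro nth_equalityI) (auto simp: length_repeat_at nth_repeat_at)

lemma omit_repeat_less:
  assumes "i < j" "j < length xs"
  shows "omit i (repeat_at j xs) = repeat_at (j - 1) (omit i xs)"
  using assms
  by (intro nth_equalityI) (auto simp: length_repeat_at nth_repeat_at length_omit nth_omit)

lemma omit_repeat_same:
  assumes "i = j \<or> i = Suc j" "j < length xs"
  shows "omit i (repeat_at j xs) = xs"
  using assms
  by (intro nth_equalityI) (auto simp: length_repeat_at nth_repeat_at length_omit nth_omit)

lemma omit_repeat_greater:
  assumes "Suc j < i" "i \<le> length xs"
  shows "omit i (repeat_at j xs) = repeat_at j (omit (i - 1) xs)"
  using assms
  by (intro nth_equalityI) (auto simp: length_repeat_at nth_repeat_at length_omit nth_omit)

lemma face_Kbar: "face (Kbar r) n i x = (case x of None \<Rightarrow> None | Some xs \<Rightarrow>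
    if full_chain r (omit i xs) then Some (omit i xs) else None)"
  by (simp add: Kbar_def)

lemma degen_Kbar: "degen (Kbar r) n j x = map_option (repeat_at j) x"
  by (simp add: Kbar_def)

lemma simplices_Kbar: "x \<in> simplices (Kbar r) n \<longleftrightarrow> x = None \<or> (\<exists>xs. x = Some xs \<and>
    length xs = Suc n \<and> (\<forall>\<kappa>\<in>set xs. partition_on {1..r} \<kappa>) \<and>
    sorted_wrt (partition_le r) xs \<and> full_chain r xs)"
  by (auto simp: Kbar_def)

lemma basept_Kbar: "basept (Kbar r) n = None"
  by (simp add: Kbar_def)

lemma pointed_simplicial_set_Kbar: "pointed_simplicial_set (Kbar r)"
proof
  fix n
  show "basept (Kbar r) n \<in> simplices (Kbar r) n"
    by (simp add: simplices_Kbar basept_Kbar)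
next
  fix n x i assume "x \<in> simplices (Kbar r) (Suc n)" "i \<le> Suc n"
  then show "face (Kbar r) (Suc n) i x \<in> simplices (Kbar r) n"
    by (auto simp: simplices_Kbar face_Kbar length_omit sorted_omit dest!: subsetD[OF set_omit])
next
  fix n x j assume "x \<in> simplices (Kbar r) n" "j \<le> n"
  then show "degen (Kbar r) n j x \<in> simplices (Kbar r) (Suc n)"
    by (auto simp: simplices_Kbar degen_Kbar length_repeat_at full_repeat_at partition_le_def
        refines_refl intro!: sorted_repeat_at dest!: subsetD[OF set_repeat_at])
next
  fix n x i j assume x: "x \<in> simplices (Kbar r) (Suc (Suc n))" and ij: "i < j" "j \<le> Suc (Suc n)"
  show "face (Kbar r) (Suc n) i (face (Kbar r) (Suc (Suc n)) j x)
      = face (Kbar r) (Suc n) (j - 1) (face (Kbar r) (Suc (Suc n)) i x)"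
  proof (cases x)
    case (Some xs)
    have xs: "length xs = Suc (Suc (Suc n))" "\<forall>\<kappa>\<in>set xs. partition_on {1..r} \<kappa>"
      "sorted_wrt (partition_le r) xs" "full_chain r xs"
      using x Some by (auto simp: simplices_Kbar)
    have eq: "omit i (omit j xs) = omit (j - 1) (omit i xs)"
      using ij xs(1) by (intro omit_omit) auto
    have "full_chain r (omit j xs)" if "full_chain r (omit i (omit j xs))"
      using full_chain_intermediate[OF xs(3,2,4) sorted_omit set_omit set_omit that] xs(3,1) ij by simp
    moreover have "full_chain r (omit i xs)" if "full_chain r (omit (j - 1) (omit i xs))"
      using full_chain_intermediate[OF xs(3,2,4) sorted_omit set_omit set_omit that] xs(3,1) ij by simp
    ultimately show ?thesis using Some eq by (auto simp: face_Kbar)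
  qed (simp add: face_Kbar)
qed (auto simp: simplices_Kbar face_Kbar basept_Kbar degen_Kbar repeat_repeat omit_repeat_less
    omit_repeat_same omit_repeat_greater full_repeat_at length_omit)

definition perm_simplex ::
  "(nat \<Rightarrow> nat) \<Rightarrow> nat set set list option \<Rightarrow> nat set set list option" where
  "perm_simplex w = map_option (map (\<lambda>\<kappa>. (`) w ` \<kappa>))"


section \<open>Free Lie algebras and the Lie operad\<close>

text \<open>
  Nonassociative monomials.  The free Lie algebra is the quotient of the free nonassociative
  algebra by the two-sided ideal generated by the squares and the Jacobi expressions.
\<close>

datatype 'x monomial = Gen 'x | Br "'x monomial" "'x monomial"

primrec degree_in :: "'x \<Rightarrow> 'x monomial \<Rightarrow> nat" where
  "degree_in x (Gen y) = (if x = y then 1 else 0)"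
| "degree_in x (Br s t) = degree_in x s + degree_in x t"

definition monomial_mult ::
  "('x monomial \<Rightarrow>\<^sub>0 'k::comm_ring_1) \<Rightarrow> ('x monomial \<Rightarrow>\<^sub>0 'k) \<Rightarrow> ('x monomial \<Rightarrow>\<^sub>0 'k)" where
  "monomial_mult f g = (\<Sum>s\<in>Poly_Mapping.keys f. \<Sum>t\<in>Poly_Mapping.keys g.
     Poly_Mapping.single (Br s t) (Poly_Mapping.lookup f s * Poly_Mapping.lookup g t))"

definition free_nonassoc_algebra ::
  "'x set \<Rightarrow> ('k::comm_ring_1, 'x monomial \<Rightarrow>\<^sub>0 'k, 'x \<Rightarrow> 'x) gmodule" where
  "free_nonassoc_algebra X =
     (free_gmodule {t. set_monomial t \<subseteq> X} map_monomial)\<lparr>mult := monomial_mult\<rparr>"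

definition two_sided_ideal :: "('k::comm_ring_1, 'm, 'g) gmodule \<Rightarrow> 'm set \<Rightarrow> bool" where
  "two_sided_ideal A J \<longleftrightarrow> submodule J type_ring A \<and>
     (\<forall>a\<in>carrier A. \<forall>j\<in>J. a \<otimes>\<^bsub>A\<^esub> j \<in> J \<and> j \<otimes>\<^bsub>A\<^esub> a \<in> J)"

definition lie_ideal :: "'x set \<Rightarrow> ('x monomial \<Rightarrow>\<^sub>0 'k::comm_ring_1) set" where
  "lie_ideal X =
     (let A = free_nonassoc_algebra X
      in two_sided_ideal A hull
           ({a \<otimes>\<^bsub>A\<^esub> a | a. a \<in> carrier A} \<union>
            {a \<otimes>\<^bsub>A\<^esub> (b \<otimes>\<^bsub>A\<^esub> c) \<oplus>\<^bsub>A\<^esub> b \<otimes>\<^bsub>A\<^esub> (c \<otimes>\<^bsub>A\<^esub> a) \<oplus>\<^bsub>A\<^esub> c \<otimes>\<^bsub>A\<^esub> (a \<otimes>\<^bsub>A\<^esub> b)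
               | a b c. a \<in> carrier A \<and> b \<in> carrier A \<and> c \<in> carrier A}))"

definition free_lie_algebra ::
  "'x set \<Rightarrow> ('k::comm_ring_1, ('x monomial \<Rightarrow>\<^sub>0 'k) set, 'x \<Rightarrow> 'x) gmodule" where
  "free_lie_algebra X = quotient_gmodule (free_nonassoc_algebra X) (lie_ideal X)"

definition lie_monomial :: "'x set \<Rightarrow> 'x monomial \<Rightarrow> ('x monomial \<Rightarrow>\<^sub>0 'k::comm_ring_1) set" where
  "lie_monomial X t =
     lie_ideal X +>\<^bsub>free_nonassoc_algebra X :: ('k, _, 'x \<Rightarrow> 'x) gmodule\<^esub> Poly_Mapping.single t 1"

definition Lie_operad ::
  "nat \<Rightarrow> ('k::comm_ring_1, (nat monomial \<Rightarrow>\<^sub>0 'k) set, nat \<Rightarrow> nat) gmodule" where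
  "Lie_operad r =
     (let L = free_lie_algebra {1..r}
      in L\<lparr>carrier := submodule_span L
             {lie_monomial {1..r} t | t.
                set_monomial t \<subseteq> {1..r} \<and> (\<forall>i\<in>{1..r}. degree_in i t = 1)}\<rparr>)"

end

theory Submission
  imports Defs
begin

text \<open>
  Words that contain each of \<open>1, \<dots>, r\<close> once are mapped to both sides.  A word goes to the class of its
  bar construction, the signed sum over all ways to merge neighbouring letters successively; this is a cycle
  because the bar differential squares to zero.  It also goes to the functional on the Lie operad that reads
  off its coefficient in the associative expansion of a Lie element, multiplied by the sign of the word.

  The multilinear Lie elements are spanned by the combs \<open>[\<dots>[[1, c\<^sub>1], c\<^sub>2], \<dots>]\<close>, and up to a sign the value of
  the functional on a comb is the coefficient of the bar cycle at the chain of partitions in which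
  \<open>c\<^sub>1, c\<^sub>2, \<dots>\<close> are successively merged into the block of \<open>1\<close>.  The combs that begin with \<open>1\<close> are dual to the
  words that begin with \<open>1\<close>, so both maps are surjective with the same kernel as soon as a cycle that vanishes
  at all these chains is a boundary (and every cycle of another degree is one).

  This is shown for chains up to an arbitrary partition, by induction on its number of blocks.  Fix a block
  \<open>B\<close>.  Chains whose last proper member arises by merging \<open>B\<close> with another block are covered by the induction
  hypothesis, and the other chains are contracted by the closure operator that cuts \<open>B\<close> off.
\<close>

section \<open>Linear extension\<close>

text \<open>The words that begin with \<open>1\<close> give bases of both sides, but permutations do
  not preserve this set of words. The free module on all words is stable, so equivariance is checked
  there and the bases only serve to compare kernels. All dualities have matrices that are the
  identity up to signs, so no field and no torsion argument is involved.

  The complex is not normalized: chains may repeat a partition. A repetition of the last partition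
  is removed by appending that partition once more; the rest of a cycle consists of chains strictly
  below it, and the induction repeats this at every level.

  The contraction works because \<open>cut_off B\<close> is monotone, passes to finer partitions and
  moves the one-block partition. Among the partitions strictly coarser than \<open>P\<close> it
  reaches \<open>P\<close> only at the mergers of \<open>B\<close> with one other block, which are
  set aside as coatoms. Following them downwards produces the comb chains, hence these carry the
  only obstruction. The signature appears because the alternating signs of the merges, compared with
  the signs of the brackets, multiply up to the sign of the word.\<close>

lemma lookup_pm_scale [simp]: "Poly_Mapping.lookup (pm_scale c f) x = c * Poly_Mapping.lookup f x"
  unfolding pm_scale_def by (transfer) (auto simp: when_def)

lemma pm_scale_simps [simp]:
  "pm_scale 0 f = 0" "pm_scale 1 f = f" "pm_scale c 0 = 0"
  "pm_scale c (Poly_Mapping.single x a) = Poly_Mapping.single x (c * a)"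
  "pm_scale a (pm_scale b f) = pm_scale (a * b) f"
  by (rule poly_mapping_eqI; simp add: lookup_single when_def algebra_simps)+

lemma pm_scale_add: "pm_scale c (f + g) = pm_scale c f + pm_scale c g"
  by (rule poly_mapping_eqI) (simp add: lookup_add algebra_simps)

lemma pm_scale_diff: "pm_scale c (f - g) = pm_scale c f - pm_scale c g"
  by (rule poly_mapping_eqI) (simp add: lookup_minus algebra_simps)

lemma pm_scale_uminus: "pm_scale c (- f) = - pm_scale c f" "pm_scale (- c) f = - pm_scale c f"
  by (rule poly_mapping_eqI; simp)+

lemma pm_scale_left_add: "pm_scale (c + d) f = pm_scale c f + pm_scale d f"
  by (rule poly_mapping_eqI) (simp add: lookup_add algebra_simps)

lemma pm_scale_sum: "pm_scale c (\<Sum>i\<in>I. f i) = (\<Sum>i\<in>I. pm_scale c (f i))"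
  by (induction I rule: infinite_finite_induct) (auto simp: pm_scale_add)

lemma keys_pm_scale: "Poly_Mapping.keys (pm_scale c f) \<subseteq> Poly_Mapping.keys f"
  by (auto simp: in_keys_iff)

lemma lin_ext_superset:
  assumes "finite A" "Poly_Mapping.keys f \<subseteq> A"
  shows "lin_ext \<phi> f = (\<Sum>x\<in>A. pm_scale (Poly_Mapping.lookup f x) (\<phi> x))"
  unfolding lin_ext_def using assms
  by (intro sum.mono_neutral_left) (auto simp: in_keys_iff)

lemma lin_ext_zero [simp]: "lin_ext \<phi> 0 = 0"
  by (simp add: lin_ext_def)

lemma lin_ext_single [simp]: "lin_ext \<phi> (Poly_Mapping.single x c) = pm_scale c (\<phi> x)"
  using lin_ext_superset[of "{x}" "Poly_Mapping.single x c" \<phi>] by (auto split: if_splits)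

lemma lin_ext_add: "lin_ext \<phi> (f + g) = lin_ext \<phi> f + lin_ext \<phi> g"
proof -
  let ?A = "Poly_Mapping.keys f \<union> Poly_Mapping.keys g"
  have "Poly_Mapping.keys (f + g) \<subseteq> ?A" by (rule keys_add)
  then show ?thesis
    by (subst (1 2 3) lin_ext_superset[of ?A])
      (auto simp: lookup_add pm_scale_left_add sum.distrib)
qed

lemma lin_ext_scale: "lin_ext \<phi> (pm_scale c f) = pm_scale c (lin_ext \<phi> f)"
  by (subst (1 2) lin_ext_superset[of "Poly_Mapping.keys f"])
    (simp_all add: keys_pm_scale pm_scale_sum)

definition pm_linear :: "(('x \<Rightarrow>\<^sub>0 'k::comm_ring_1) \<Rightarrow> ('y \<Rightarrow>\<^sub>0 'k)) \<Rightarrow> bool" where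
  "pm_linear L \<longleftrightarrow> (\<forall>f g. L (f + g) = L f + L g) \<and> (\<forall>c f. L (pm_scale c f) = pm_scale c (L f))"

lemma pm_linear_lin_ext [simp]: "pm_linear (lin_ext \<phi>)"
  by (simp add: pm_linear_def lin_ext_add lin_ext_scale)

lemma pm_linear_add: "pm_linear L \<Longrightarrow> L (f + g) = L f + L g"
  and pm_linear_scale: "pm_linear L \<Longrightarrow> L (pm_scale c f) = pm_scale c (L f)"
  by (simp_all add: pm_linear_def)

lemma pm_linear_zero: "pm_linear L \<Longrightarrow> L 0 = 0"
  using pm_linear_add[of L 0 0] by simp

lemma pm_linear_uminus: "pm_linear L \<Longrightarrow> L (- f) = - L f"
  using pm_linear_scale[of L "-1" f] by (simp add: pm_scale_uminus)

lemma pm_linear_diff: "pm_linear L \<Longrightarrow> L (f - g) = L f - L g"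
  using pm_linear_add[of L f "- g"] by (simp add: pm_linear_uminus)

lemma pm_linear_sum: "pm_linear L \<Longrightarrow> L (\<Sum>i\<in>I. f i) = (\<Sum>i\<in>I. L (f i))"
  by (induction I rule: infinite_finite_induct) (auto simp: pm_linear_add pm_linear_zero)

lemma pm_linear_apply_lin_ext: "pm_linear L \<Longrightarrow> L (lin_ext \<phi> f) = lin_ext (\<lambda>x. L (\<phi> x)) f"
  by (simp add: lin_ext_def pm_linear_sum pm_linear_scale)

lemma lin_ext_diff: "lin_ext \<phi> (f - g) = lin_ext \<phi> f - lin_ext \<phi> g"
  and lin_ext_uminus: "lin_ext \<phi> (- f) = - lin_ext \<phi> f"
  and lin_ext_sum: "lin_ext \<phi> (\<Sum>i\<in>I. F i) = (\<Sum>i\<in>I. lin_ext \<phi> (F i))"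
  by (simp_all add: pm_linear_diff pm_linear_uminus pm_linear_sum)

lemmas lin_ext_simps = lin_ext_add lin_ext_scale lin_ext_diff lin_ext_uminus lin_ext_sum

lemma lin_ext_lin_ext: "lin_ext \<phi> (lin_ext \<psi> f) = lin_ext (\<lambda>x. lin_ext \<phi> (\<psi> x)) f"
  by (simp add: pm_linear_apply_lin_ext)

lemma lin_ext_cong:
  "f = g \<Longrightarrow> (\<And>x. x \<in> Poly_Mapping.keys g \<Longrightarrow> \<phi> x = \<psi> x) \<Longrightarrow> lin_ext \<phi> f = lin_ext \<psi> g"
  by (simp add: lin_ext_def)

lemma lin_ext_zero_fun [simp]: "lin_ext (\<lambda>_. 0) f = 0"
  by (simp add: lin_ext_def)

lemma lin_ext_add_fun: "lin_ext (\<lambda>x. \<phi> x + \<psi> x) f = lin_ext \<phi> f + lin_ext \<psi> f"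
  by (simp add: lin_ext_def pm_scale_add sum.distrib)

lemma lin_ext_diff_fun: "lin_ext (\<lambda>x. \<phi> x - \<psi> x) f = lin_ext \<phi> f - lin_ext \<psi> f"
  by (simp add: lin_ext_def pm_scale_diff sum_subtractf)

lemma lin_ext_uminus_fun: "lin_ext (\<lambda>x. - \<phi> x) f = - lin_ext \<phi> f"
  by (simp add: lin_ext_def pm_scale_uminus sum_negf)

lemma lin_ext_scale_fun: "lin_ext (\<lambda>x. pm_scale c (\<phi> x)) f = pm_scale c (lin_ext \<phi> f)"
  by (simp add: lin_ext_def pm_scale_sum mult.commute)

lemma lookup_lin_ext:
  "Poly_Mapping.lookup (lin_ext \<phi> f) y
     = (\<Sum>x\<in>Poly_Mapping.keys f. Poly_Mapping.lookup f x * Poly_Mapping.lookup (\<phi> x) y)"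
  by (simp add: lin_ext_def lookup_sum)

lemma lin_ext_ident [simp]: "lin_ext (\<lambda>x. Poly_Mapping.single x 1) f = f"
  by (rule poly_mapping_eqI)
    (auto simp: lookup_lin_ext lookup_single when_def in_keys_iff if_distrib cong: if_cong)

lemma keys_lin_ext:
  "Poly_Mapping.keys (lin_ext \<phi> f) \<subseteq> (\<Union>x\<in>Poly_Mapping.keys f. Poly_Mapping.keys (\<phi> x))"
proof
  fix y assume "y \<in> Poly_Mapping.keys (lin_ext \<phi> f)"
  then obtain x where "x \<in> Poly_Mapping.keys f"
      "Poly_Mapping.lookup f x * Poly_Mapping.lookup (\<phi> x) y \<noteq> 0"
    unfolding in_keys_iff[of y] lookup_lin_ext by (meson sum.not_neutral_contains_not_neutral)
  then show "y \<in> (\<Union>x\<in>Poly_Mapping.keys f. Poly_Mapping.keys (\<phi> x))"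
    by (metis UN_iff in_keys_iff mult_zero_right)
qed

lemma keys_lin_extE:
  assumes "y \<in> Poly_Mapping.keys (lin_ext \<phi> f)"
  obtains x where "x \<in> Poly_Mapping.keys f" "y \<in> Poly_Mapping.keys (\<phi> x)"
  using assms keys_lin_ext[of \<phi> f] by blast

lemma keys_lin_ext_subset:
  "Poly_Mapping.keys f \<subseteq> A \<Longrightarrow> (\<And>x. x \<in> A \<Longrightarrow> Poly_Mapping.keys (\<phi> x) \<subseteq> B)
     \<Longrightarrow> Poly_Mapping.keys (lin_ext \<phi> f) \<subseteq> B"
  using keys_lin_ext[of \<phi> f] by blast

lemma pm_linear_intros:
  "pm_linear (\<lambda>f. f)"
  "pm_linear L \<Longrightarrow> pm_linear (\<lambda>f. lin_ext \<phi> (L f))"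
  "pm_linear L \<Longrightarrow> pm_linear L' \<Longrightarrow> pm_linear (\<lambda>f. L f + L' f)"
  "pm_linear L \<Longrightarrow> pm_linear (\<lambda>f. pm_scale c (L f))"
  by (auto simp: pm_linear_def lin_ext_simps pm_scale_add mult.commute)

text \<open>The maps are compared only on the support of the given argument. Identities that hold
  just for chains with a prescribed length or end point can thus be checked on single basis
  elements.\<close>

lemma pm_linear_eqI:
  assumes "pm_linear L" "pm_linear L'"
    and "\<And>x. x \<in> Poly_Mapping.keys f \<Longrightarrow> L (Poly_Mapping.single x 1) = L' (Poly_Mapping.single x 1)"
  shows "L f = L' f"
proof -
  have "L (lin_ext (\<lambda>x. Poly_Mapping.single x 1) f) = L' (lin_ext (\<lambda>x. Poly_Mapping.single x 1) f)"
    unfolding assms(1,2)[THEN pm_linear_apply_lin_ext]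
    by (intro lin_ext_cong refl assms(3))
  then show ?thesis by simp
qed

section \<open>Relabelling, restriction and evaluation of formal sums\<close>

abbreviation pm_map :: "('x \<Rightarrow> 'y) \<Rightarrow> ('x \<Rightarrow>\<^sub>0 'k::comm_ring_1) \<Rightarrow> ('y \<Rightarrow>\<^sub>0 'k)" where
  "pm_map h \<equiv> lin_ext (\<lambda>x. Poly_Mapping.single (h x) 1)"

lemma keys_pm_map: "Poly_Mapping.keys (pm_map h f) \<subseteq> h ` Poly_Mapping.keys f"
  using keys_lin_ext[of "\<lambda>x. Poly_Mapping.single (h x) 1" f] by fastforce

lemma lookup_pm_map_inj:
  assumes "inj_on h (insert x (Poly_Mapping.keys f))"
  shows "Poly_Mapping.lookup (pm_map h f) (h x) = Poly_Mapping.lookup f x"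
proof -
  have "Poly_Mapping.lookup (pm_map h f) (h x)
      = (\<Sum>y\<in>Poly_Mapping.keys f. if y = x then Poly_Mapping.lookup f x else 0)"
    unfolding lookup_lin_ext using assms
    by (intro sum.cong) (auto simp: lookup_single when_def inj_on_def)
  then show ?thesis by (simp add: in_keys_iff)
qed

text \<open>Restriction stands in for passing to a quotient complex: the ordinary boundary is taken
  first, and then the basis elements outside the complex are dropped.\<close>

definition pm_filter :: "('x \<Rightarrow> bool) \<Rightarrow> ('x \<Rightarrow>\<^sub>0 'k::comm_ring_1) \<Rightarrow> ('x \<Rightarrow>\<^sub>0 'k)" where
  "pm_filter P = lin_ext (\<lambda>x. if P x then Poly_Mapping.single x 1 else 0)"

lemma pm_linear_pm_filter [simp]: "pm_linear (pm_filter P)"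
  by (simp add: pm_filter_def)

lemma pm_linear_pm_filter_comp: "pm_linear L \<Longrightarrow> pm_linear (\<lambda>f. pm_filter P (L f))"
  unfolding pm_filter_def by (rule pm_linear_intros)

lemmas pm_filter_simps =
  pm_linear_add[OF pm_linear_pm_filter] pm_linear_diff[OF pm_linear_pm_filter]
  pm_linear_uminus[OF pm_linear_pm_filter] pm_linear_scale[OF pm_linear_pm_filter]
  pm_linear_sum[OF pm_linear_pm_filter]

lemma lookup_pm_filter [simp]:
  "Poly_Mapping.lookup (pm_filter P f) x = (if P x then Poly_Mapping.lookup f x else 0)"
proof -
  have "Poly_Mapping.lookup (pm_filter P f) x
      = (\<Sum>y\<in>Poly_Mapping.keys f. if y = x then if P x then Poly_Mapping.lookup f x else 0 else 0)"
    unfolding pm_filter_def lookup_lin_ext by (intro sum.cong) (auto simp: lookup_single when_def)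
  then show ?thesis by (simp add: in_keys_iff)
qed

lemma pm_filter_single: "pm_filter P (Poly_Mapping.single x c) = (if P x then Poly_Mapping.single x c else 0)"
  by (simp add: pm_filter_def)

lemma pm_filter_zero [simp]: "pm_filter P 0 = 0"
  by (simp add: pm_filter_def)

lemma keys_pm_filter: "Poly_Mapping.keys (pm_filter P f) = {x \<in> Poly_Mapping.keys f. P x}"
  by (auto simp: in_keys_iff split: if_splits)

lemma pm_filter_id: "(\<And>x. x \<in> Poly_Mapping.keys f \<Longrightarrow> P x) \<Longrightarrow> pm_filter P f = f"
  by (rule poly_mapping_eqI) (auto simp: in_keys_iff)

lemma pm_filter_none: "(\<And>x. x \<in> Poly_Mapping.keys f \<Longrightarrow> \<not> P x) \<Longrightarrow> pm_filter P f = 0"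
  by (rule poly_mapping_eqI) (auto simp: in_keys_iff)

lemma pm_filter_split: "f = pm_filter P f + pm_filter (\<lambda>x. \<not> P x) f"
  by (rule poly_mapping_eqI) (auto simp: lookup_add)

lemma pm_filter_cong: "f = g \<Longrightarrow> (\<And>x. x \<in> Poly_Mapping.keys g \<Longrightarrow> P x = Q x) \<Longrightarrow> pm_filter P f = pm_filter Q g"
  by (rule poly_mapping_eqI) (auto simp: in_keys_iff)

lemma pm_filter_pm_map: "pm_filter P (pm_map h f) = pm_map h (pm_filter (\<lambda>x. P (h x)) f)"
  unfolding pm_filter_def lin_ext_lin_ext by (rule lin_ext_cong) auto

lemma pm_filter_filter: "pm_filter P (pm_filter Q f) = pm_filter (\<lambda>x. P x \<and> Q x) f"
  by (rule poly_mapping_eqI) auto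

definition pm_eval :: "('x \<Rightarrow> 'k::comm_ring_1) \<Rightarrow> ('x \<Rightarrow>\<^sub>0 'k) \<Rightarrow> 'k" where
  "pm_eval g f = (\<Sum>x\<in>Poly_Mapping.keys f. Poly_Mapping.lookup f x * g x)"

lemma pm_eval_superset:
  assumes "finite A" "Poly_Mapping.keys f \<subseteq> A"
  shows "pm_eval g f = (\<Sum>x\<in>A. Poly_Mapping.lookup f x * g x)"
  unfolding pm_eval_def using assms by (intro sum.mono_neutral_left) (auto simp: in_keys_iff)

lemma pm_eval_zero [simp]: "pm_eval g 0 = 0"
  by (simp add: pm_eval_def)

lemma pm_eval_single [simp]: "pm_eval g (Poly_Mapping.single x c) = c * g x"
  using pm_eval_superset[of "{x}" "Poly_Mapping.single x c" g] by (auto split: if_splits)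

lemma pm_eval_add: "pm_eval g (f + f') = pm_eval g f + pm_eval g f'"
proof -
  let ?A = "Poly_Mapping.keys f \<union> Poly_Mapping.keys f'"
  have "Poly_Mapping.keys (f + f') \<subseteq> ?A" by (rule keys_add)
  then show ?thesis
    by (subst (1 2 3) pm_eval_superset[of ?A]) (auto simp: lookup_add algebra_simps sum.distrib)
qed

lemma pm_eval_scale: "pm_eval g (pm_scale c f) = c * pm_eval g f"
  by (subst (1 2) pm_eval_superset[of "Poly_Mapping.keys f"])
    (simp_all add: keys_pm_scale sum_distrib_left mult.assoc)

lemma pm_eval_diff: "pm_eval g (f - f') = pm_eval g f - pm_eval g f'"
  using pm_eval_add[of g "f - f'" f'] by simp

lemma pm_eval_sum: "pm_eval g (\<Sum>i\<in>I. F i) = (\<Sum>i\<in>I. pm_eval g (F i))"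
  by (induction I rule: infinite_finite_induct) (auto simp: pm_eval_add)

lemma pm_eval_lin_ext: "pm_eval g (lin_ext \<phi> f) = pm_eval (\<lambda>x. pm_eval g (\<phi> x)) f"
  by (simp add: lin_ext_def pm_eval_sum pm_eval_scale) (simp add: pm_eval_def)

lemma pm_eval_cong: "f = f' \<Longrightarrow> (\<And>x. x \<in> Poly_Mapping.keys f' \<Longrightarrow> g x = g' x) \<Longrightarrow> pm_eval g f = pm_eval g' f'"
  by (simp add: pm_eval_def)

lemma lookup_lin_ext_eval: "Poly_Mapping.lookup (lin_ext \<phi> f) y = pm_eval (\<lambda>x. Poly_Mapping.lookup (\<phi> x) y) f"
  by (simp add: lookup_lin_ext pm_eval_def)

lemma pm_linear_induct [consumes 1, case_names zero single add]:
  fixes f :: "'x \<Rightarrow>\<^sub>0 'k::comm_ring_1"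
  assumes "Poly_Mapping.keys f \<subseteq> S" "P 0"
    "\<And>c x. x \<in> S \<Longrightarrow> P (Poly_Mapping.single x c)"
    "\<And>f g. P f \<Longrightarrow> P g \<Longrightarrow> P (f + g)"
  shows "P f"
proof -
  have "P (\<Sum>x\<in>A. pm_scale (Poly_Mapping.lookup f x) (Poly_Mapping.single x 1))"
    if "A \<subseteq> Poly_Mapping.keys f" for A
    using finite_subset[OF that finite_keys] that assms by (induction A) auto
  from this[OF order_refl] show ?thesis using lin_ext_ident[of f] unfolding lin_ext_def by simp
qed

section \<open>The boundary of a list\<close>

text \<open>In \<open>list_boundary\<close> the face that omits the only entry of a one-element list is the empty list.\<close>

primrec list_boundary :: "'a list \<Rightarrow> ('a list \<Rightarrow>\<^sub>0 'k::comm_ring_1)" where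
  "list_boundary [] = 0"
| "list_boundary (x # xs) = Poly_Mapping.single xs 1 - pm_map ((#) x) (list_boundary xs)"

lemma pm_map_pm_map: "pm_map g (pm_map h f) = pm_map (\<lambda>x. g (h x)) f"
  by (simp add: lin_ext_lin_ext)

lemma omit_0 [simp]: "omit 0 (x # xs) = xs"
  and omit_Suc [simp]: "omit (Suc i) (x # xs) = x # omit i xs"
  by (simp_all add: omit_def)

text \<open>The recursion suits induction on the list; this closed form is the one that matches the
  face maps of \<open>Kbar\<close> and controls the support.\<close>

lemma list_boundary_omit:
  "list_boundary xs = (\<Sum>i<length xs. Poly_Mapping.single (omit i xs) ((- 1) ^ i))"
proof (induction xs)
  case (Cons x xs)
  then show ?case
    by (simp add: sum.lessThan_Suc_shift lin_ext_sum del: sum.lessThan_Suc)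
      (simp add: single_uminus sum_negf)
qed simp

lemma keys_list_boundary: "Poly_Mapping.keys (list_boundary xs) \<subseteq> (\<lambda>i. omit i xs) ` {..<length xs}"
  unfolding list_boundary_omit
  by (rule order_trans[OF keys_sum]) (auto split: if_splits)

text \<open>An entry of the second list sits at a position shifted by \<open>length xs\<close>,
  which gives the sign.\<close>

lemma list_boundary_append:
  "list_boundary (xs @ ys) = pm_map (\<lambda>u. u @ ys) (list_boundary xs)
     + pm_scale ((- 1) ^ length xs) (pm_map ((@) xs) (list_boundary ys))"
proof (induction xs)
  case (Cons x xs)
  show ?case
    by (simp add: Cons lin_ext_simps lin_ext_lin_ext pm_scale_uminus)
qed (simp add: lin_ext_lin_ext)

lemma list_boundary_map: "list_boundary (map p xs) = pm_map (map p) (list_boundary xs)"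
proof (induction xs)
  case (Cons x xs)
  show ?case
    by (simp add: Cons lin_ext_simps lin_ext_lin_ext)
qed simp

lemma list_boundary_Cons_lin:
  "lin_ext list_boundary (pm_map ((#) x) f) = f - pm_map ((#) x) (lin_ext list_boundary f)"
  by (simp add: lin_ext_lin_ext lin_ext_diff_fun)

section \<open>The prism homotopy of a map applied to the entries\<close>

primrec prism :: "('a \<Rightarrow> 'a) \<Rightarrow> 'a list \<Rightarrow> ('a list \<Rightarrow>\<^sub>0 'k::comm_ring_1)" where
  "prism p [] = 0"
| "prism p (x # xs) = Poly_Mapping.single (x # p x # map p xs) 1 - pm_map ((#) x) (prism p xs)"

lemma prism_Cons_lin:
  "lin_ext (prism p) (pm_map ((#) x) f)
      = pm_map ((#) x) (pm_map ((#) (p x)) (pm_map (map p) f)) - pm_map ((#) x) (lin_ext (prism p) f)"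
  by (simp add: lin_ext_lin_ext lin_ext_diff_fun)

text \<open>Unrolled, \<open>prism p\<close> is the alternating sum of the lists that keep the
  entries up to some \<open>x\<close>, continue with \<open>p x\<close> and apply \<open>p\<close>
  to all later entries. Neighbouring terms cancel in the boundary and leave the two extremes. The
  empty list, although it is a face here, causes no correction because
  \<open>prism p [] = 0\<close>.\<close>

lemma prism_homotopy:
  "lin_ext list_boundary (prism p xs) + lin_ext (prism p) (list_boundary xs)
     = Poly_Mapping.single (map p xs) 1 - Poly_Mapping.single xs 1"
proof (induction xs)
  case (Cons x xs)
  have eq: "lin_ext list_boundary (prism p (x # xs)) + lin_ext (prism p) (list_boundary (x # xs))
     = Poly_Mapping.single (map p (x # xs)) 1 - pm_map ((#) x) (Poly_Mapping.single (map p xs) 1)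
       + pm_map ((#) x) (lin_ext list_boundary (prism p xs) + lin_ext (prism p) (list_boundary xs))"
    by (simp add: lin_ext_simps list_boundary_Cons_lin prism_Cons_lin list_boundary_map pm_scale_diff)
  show ?case unfolding eq Cons by (simp add: lin_ext_simps)
qed simp

lemma prism_homotopy_lin:
  "lin_ext list_boundary (lin_ext (prism p) f) + lin_ext (prism p) (lin_ext list_boundary f)
     = pm_map (map p) f - f"
proof -
  have "lin_ext list_boundary (lin_ext (prism p) f) + lin_ext (prism p) (lin_ext list_boundary f)
     = lin_ext (\<lambda>xs. Poly_Mapping.single (map p xs) 1 - Poly_Mapping.single xs 1) f"
    by (simp add: lin_ext_lin_ext lin_ext_add_fun[symmetric] prism_homotopy)
  then show ?thesis by (simp add: lin_ext_diff_fun)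
qed

lemma list_boundary_snoc:
  "list_boundary (xs @ [x])
     = pm_map (\<lambda>u. u @ [x]) (list_boundary xs) + Poly_Mapping.single xs ((- 1) ^ length xs)"
  by (simp add: list_boundary_append)

lemma list_boundary_boundary: "lin_ext list_boundary (list_boundary xs) = 0"
proof (induction xs)
  case (Cons x xs)
  show ?case by (simp add: lin_ext_simps list_boundary_Cons_lin Cons)
qed simp

section \<open>Acyclicity of chains below a fixed element\<close>

text \<open>Faces that lose a prescribed end point are dropped, as the base point is in
  \<open>Kbar\<close>. Fixing only the lower end serves the chains that remain once the top entry is
  split off.\<close>

definition based :: "'a \<Rightarrow> 'a list \<Rightarrow> bool" where
  "based e xs \<longleftrightarrow> xs \<noteq> [] \<and> hd xs = e"

definition spans :: "'a \<Rightarrow> 'a \<Rightarrow> 'a list \<Rightarrow> bool" where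
  "spans e m xs \<longleftrightarrow> xs \<noteq> [] \<and> hd xs = e \<and> last xs = m"

text \<open>Equal neighbours are allowed for reflexive \<open>leq\<close>, so degenerate chains
  belong to the complex. The index counts entries and exceeds the dimension by one.\<close>

definition chain_lists :: "('a \<Rightarrow> 'a \<Rightarrow> bool) \<Rightarrow> 'a set \<Rightarrow> nat \<Rightarrow> 'a list set" where
  "chain_lists leq S n = {xs. length xs = n \<and> sorted_wrt leq xs \<and> set xs \<subseteq> S}"

lemma omit_in_chain_lists: "xs \<in> chain_lists leq S (Suc n) \<Longrightarrow> i < length xs \<Longrightarrow> omit i xs \<in> chain_lists leq S n"
  using set_omit[of i xs] by (auto simp: chain_lists_def length_omit sorted_omit)

lemma list_boundary_chain_lists:
  "xs \<in> chain_lists leq S (Suc n) \<Longrightarrow> Poly_Mapping.keys (list_boundary xs) \<subseteq> chain_lists leq S n"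
  by (rule order_trans[OF keys_list_boundary]) (auto intro: omit_in_chain_lists)

lemma lin_ext_list_boundary_chain_lists:
  "Poly_Mapping.keys f \<subseteq> chain_lists leq S (Suc n)
     \<Longrightarrow> Poly_Mapping.keys (lin_ext list_boundary f) \<subseteq> chain_lists leq S n"
  by (erule keys_lin_ext_subset) (rule list_boundary_chain_lists)

text \<open>Write a list as \<open>u @ [m]\<close>. In the boundary of \<open>u @ [m, m]\<close> the
  deletions of the two copies of \<open>m\<close> cancel, whereas the boundary of
  \<open>u @ [m]\<close> contains \<open>u\<close> with the sign \<open>(- 1) ^ length u\<close>.
  That face survives the restriction exactly if \<open>u\<close> still runs from \<open>e\<close> to
  \<open>m\<close>; the last summand compensates for it.\<close>

lemma spans_boundary_snoc:
  fixes z :: "'a list \<Rightarrow>\<^sub>0 'k::comm_ring_1"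
  assumes "\<And>xs. xs \<in> Poly_Mapping.keys z \<Longrightarrow> length xs = n \<and> spans e m xs"
  shows "pm_filter (spans e m) (lin_ext list_boundary (pm_map (\<lambda>xs. xs @ [m]) z))
     = pm_map (\<lambda>xs. xs @ [m]) (pm_filter (spans e m) (lin_ext list_boundary z))
       + pm_scale ((- 1) ^ n) (pm_filter (\<lambda>xs. spans e m (butlast xs)) z)"
proof (rule pm_linear_eqI[where f = z])
  fix xs assume "xs \<in> Poly_Mapping.keys z"
  then have xs: "length xs = n" "spans e m xs" using assms by auto
  define u where "u = butlast xs"
  have u: "xs = u @ [m]" using xs(2) unfolding u_def spans_def by (metis append_butlast_last_id)
  have comm: "pm_filter (spans e m) (pm_map (\<lambda>xs. xs @ [m, m]) f)
      = pm_map (\<lambda>xs. xs @ [m]) (pm_filter (spans e m) (pm_map (\<lambda>xs. xs @ [m]) f))"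
    for f :: "'a list \<Rightarrow>\<^sub>0 'k"
  proof -
    have "spans e m (v @ [m, m]) = spans e m (v @ [m])" for v by (auto simp: spans_def hd_append)
    then show ?thesis by (simp add: pm_filter_pm_map pm_map_pm_map)
  qed
  have hd: "u \<noteq> [] \<Longrightarrow> hd u = e" using xs(2) u by (auto simp: spans_def hd_append)
  have n: "n = Suc (length u)" using xs(1) u by simp
  show "pm_filter (spans e m) (lin_ext list_boundary (pm_map (\<lambda>xs. xs @ [m]) (Poly_Mapping.single xs (1::'k))))
     = pm_map (\<lambda>xs. xs @ [m]) (pm_filter (spans e m) (lin_ext list_boundary (Poly_Mapping.single xs (1::'k))))
       + pm_scale ((- 1) ^ n) (pm_filter (\<lambda>xs. spans e m (butlast xs)) (Poly_Mapping.single xs (1::'k)))"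
    using xs hd
    by (auto simp: u list_boundary_append lin_ext_simps lin_ext_lin_ext pm_filter_simps pm_filter_single comm n
        spans_def pm_scale_uminus)
qed (intro pm_linear_intros pm_linear_pm_filter_comp)+

text \<open>Deleting the appended \<open>m\<close> leaves a list that does not end in
  \<open>m\<close>, so only the faces of the original list survive. The condition
  \<open>m \<noteq> e\<close> keeps \<open>[m]\<close> from counting as a chain from
  \<open>e\<close> to \<open>m\<close>.\<close>

lemma spans_boundary_snoc_new:
  fixes w :: "'a list \<Rightarrow>\<^sub>0 'k::comm_ring_1"
  assumes "m \<noteq> e" "\<And>xs. xs \<in> Poly_Mapping.keys w \<Longrightarrow> last xs \<noteq> m"
  shows "pm_filter (spans e m) (lin_ext list_boundary (pm_map (\<lambda>xs. xs @ [m]) w))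
     = pm_map (\<lambda>xs. xs @ [m]) (pm_filter (based e) (lin_ext list_boundary w))"
proof (rule pm_linear_eqI[where f = w])
  fix u assume "u \<in> Poly_Mapping.keys w"
  then have u: "last u \<noteq> m" using assms by auto
  have comm: "pm_filter (spans e m) (pm_map (\<lambda>xs. xs @ [m]) f)
      = pm_map (\<lambda>xs. xs @ [m]) (pm_filter (based e) f)"
    for f :: "'a list \<Rightarrow>\<^sub>0 'k"
  proof -
    have "spans e m (v @ [m]) = based e v" for v
      using assms(1) by (auto simp: spans_def based_def hd_append)
    then show ?thesis by (simp add: pm_filter_pm_map)
  qed
  show "pm_filter (spans e m) (lin_ext list_boundary (pm_map (\<lambda>xs. xs @ [m]) (Poly_Mapping.single u (1::'k))))
     = pm_map (\<lambda>xs. xs @ [m]) (pm_filter (based e) (lin_ext list_boundary (Poly_Mapping.single u (1::'k))))"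
    using u by (simp add: list_boundary_append pm_filter_simps pm_filter_single comm; simp add: spans_def)
qed (intro pm_linear_intros pm_linear_pm_filter_comp)+

text \<open>A chain that contains the minimal element \<open>e\<close> starts with it. Hence a chain
  not starting at \<open>e\<close> has no face starting at \<open>e\<close>; such chains form a
  subcomplex, and the restricted boundary squares to zero.\<close>

lemma based_boundary_based:
  assumes "Poly_Mapping.keys f \<subseteq> chain_lists leq S n" "\<And>x. x \<in> S \<Longrightarrow> leq x e \<Longrightarrow> x = e"
  shows "pm_filter (based e) (lin_ext list_boundary (pm_filter (based e) f))
     = pm_filter (based e) (lin_ext list_boundary f)"
proof (rule pm_linear_eqI[where f = f])
  fix xs assume "xs \<in> Poly_Mapping.keys f"
  then have xs: "xs \<in> chain_lists leq S n" using assms by auto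
  have "pm_filter (based e) (list_boundary xs) = 0" if "\<not> based e xs"
  proof (rule pm_filter_none)
    fix ys assume "ys \<in> Poly_Mapping.keys (list_boundary xs)"
    then obtain i where i: "ys = omit i xs" "i < length xs" using keys_list_boundary by fast
    show "\<not> based e ys"
    proof
      assume "based e ys"
      then have ys: "ys \<noteq> []" "hd ys = e" by (auto simp: based_def)
      then have "e \<in> set ys" by (metis hd_in_set)
      then have e: "e \<in> set xs" using i set_omit by fast
      obtain x xs' where xx: "xs = x # xs'" using i by (cases xs) auto
      have "x = e \<or> leq x e" using e xs xx by (auto simp: chain_lists_def)
      then show False using assms(2)[of x] that xs xx by (auto simp: chain_lists_def based_def)
    qed
  qed
  then show "pm_filter (based e) (lin_ext list_boundary (pm_filter (based e) (Poly_Mapping.single xs 1)))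
     = pm_filter (based e) (lin_ext list_boundary (Poly_Mapping.single xs 1))"
    by (auto simp: pm_filter_single)
qed (intro pm_linear_intros pm_linear_pm_filter_comp)+

lemma based_boundary_boundary:
  assumes "Poly_Mapping.keys f \<subseteq> chain_lists leq S (Suc n)" "\<And>x. x \<in> S \<Longrightarrow> leq x e \<Longrightarrow> x = e"
  shows "pm_filter (based e) (lin_ext list_boundary (pm_filter (based e) (lin_ext list_boundary f))) = 0"
proof -
  have "lin_ext list_boundary (lin_ext list_boundary f) = 0"
    by (simp add: lin_ext_lin_ext list_boundary_boundary)
  then show ?thesis
    using based_boundary_based[OF lin_ext_list_boundary_chain_lists[OF assms(1)] assms(2)] by simp
qed

section \<open>Contraction along an increasing monotone map\<close>

lemma keys_prism:
  assumes "xs \<in> chain_lists leq Q n" "transp_on S leq" "Q \<subseteq> S"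
    and "\<And>x. x \<in> Q \<Longrightarrow> p x \<in> S \<and> leq x (p x)"
    and "\<And>x y. x \<in> Q \<Longrightarrow> y \<in> Q \<Longrightarrow> leq x y \<Longrightarrow> leq (p x) (p y)"
  shows "Poly_Mapping.keys (prism p xs) \<subseteq> {ys \<in> chain_lists leq S (Suc n). ys \<noteq> [] \<and> hd ys = hd xs \<and> set ys \<subseteq> set xs \<union> p ` set xs}"
  using assms(1)
proof (induction xs arbitrary: n)
  case (Cons x xs)
  then obtain k where k: "n = Suc k" "xs \<in> chain_lists leq Q k" by (auto simp: chain_lists_def)
  have x: "x \<in> Q" "\<forall>y\<in>set xs. leq x y" "set xs \<subseteq> Q" "sorted_wrt leq xs" "length xs = k"
    using Cons.prems k by (auto simp: chain_lists_def)
  have tr: "leq a c" if "leq a b" "leq b c" "a \<in> S" "b \<in> S" "c \<in> S" for a b c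
    using assms(2) that by (meson transp_onD)
  have xp: "leq x (p y)" if "y \<in> set xs" for y
    using tr[of x y "p y"] that x assms(3,4) by blast
  have "sorted_wrt leq (map p xs)"
    using x(3,4) assms(5) by (induction xs) auto
  then have 1: "x # p x # map p xs \<in> chain_lists leq S (Suc n)"
    using x xp assms(3,4,5) k by (auto simp: chain_lists_def)
  have 2: "x # ys \<in> chain_lists leq S (Suc n) \<and> set ys \<subseteq> set xs \<union> p ` set xs" if "ys \<in> Poly_Mapping.keys (prism p xs :: 'a list \<Rightarrow>\<^sub>0 'b)" for ys
  proof -
    have "ys \<in> chain_lists leq S (Suc k)" "set ys \<subseteq> set xs \<union> p ` set xs" using Cons.IH[OF k(2)] that by auto
    then show ?thesis using x xp k(1) assms(3) by (auto simp: chain_lists_def)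
  qed
  have "Poly_Mapping.keys (prism p (x # xs) :: 'a list \<Rightarrow>\<^sub>0 'b)
      \<subseteq> insert (x # p x # map p xs) ((#) x ` Poly_Mapping.keys (prism p xs :: 'a list \<Rightarrow>\<^sub>0 'b))"
    using keys_pm_map[of "(#) x" "prism p xs :: 'a list \<Rightarrow>\<^sub>0 'b"]
    by (auto dest!: subsetD[OF keys_diff] split: if_splits)
  then show ?case using 1 2 by fastforce
qed simp

lemma boundary_pm_filter:
  assumes "\<And>xs ys. xs \<in> Poly_Mapping.keys f \<Longrightarrow> ys \<in> Poly_Mapping.keys (list_boundary xs :: 'a list \<Rightarrow>\<^sub>0 'k)
    \<Longrightarrow> P ys \<Longrightarrow> Q xs"
  shows "pm_filter P (lin_ext list_boundary (pm_filter Q f)) = pm_filter P (lin_ext list_boundary (f :: 'a list \<Rightarrow>\<^sub>0 'k::comm_ring_1))"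
proof (rule pm_linear_eqI[where f = f])
  fix xs assume "xs \<in> Poly_Mapping.keys f"
  then have "\<not> Q xs \<Longrightarrow> pm_filter P (list_boundary xs :: 'a list \<Rightarrow>\<^sub>0 'k) = 0"
    using assms by (intro pm_filter_none) blast
  then show "pm_filter P (lin_ext list_boundary (pm_filter Q (Poly_Mapping.single xs (1::'k))))
     = pm_filter P (lin_ext list_boundary (Poly_Mapping.single xs (1::'k)))"
    by (auto simp: pm_filter_single)
qed (intro pm_linear_intros pm_linear_pm_filter_comp)+

lemma chain_lists_hd_last:
  assumes "xs \<in> chain_lists leq S n" "x \<in> set xs"
  shows "x = hd xs \<or> leq (hd xs) x" "x = last xs \<or> leq x (last xs)" "hd xs \<in> S" "last xs \<in> S"
  using assms
  by ((cases xs; auto simp: chain_lists_def)[1],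
     (cases xs rule: rev_cases; auto simp: chain_lists_def sorted_wrt_append)[1],
     (cases xs; auto simp: chain_lists_def)[1],
     (cases xs rule: rev_cases; auto simp: chain_lists_def)[1])

text \<open>A face contains \<open>m\<close> only if the chain does, and a chain containing a
  maximal element ends in it. Chains ending in \<open>m\<close> can therefore be treated separately
  from all others.\<close>

lemma boundary_last:
  assumes "Poly_Mapping.keys f \<subseteq> chain_lists leq S n" "\<And>x. x \<in> S \<Longrightarrow> leq m x \<Longrightarrow> x = m"
  shows "pm_filter (spans e m) (lin_ext list_boundary (pm_filter (\<lambda>xs. last xs = m) f))
     = pm_filter (spans e m) (lin_ext list_boundary (f :: 'a list \<Rightarrow>\<^sub>0 'k::comm_ring_1))"
proof (rule boundary_pm_filter)
  fix xs ys assume xs: "xs \<in> Poly_Mapping.keys f" and ys: "ys \<in> Poly_Mapping.keys (list_boundary xs :: 'a list \<Rightarrow>\<^sub>0 'k)" "spans e m ys"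
  obtain i where i: "ys = omit i xs" using ys keys_list_boundary by fast
  have "m \<in> set ys" using ys(2) by (auto simp: spans_def)
  then have "m \<in> set xs" using i set_omit by fast
  moreover have "xs \<in> chain_lists leq S n" using assms(1) xs by blast
  ultimately have "m = last xs \<or> leq m (last xs)" "last xs \<in> S" by (auto dest: chain_lists_hd_last)
  then show "last xs = m" using assms(2) by auto
qed

lemma spans_boundary_boundary:
  assumes "Poly_Mapping.keys f \<subseteq> chain_lists leq S (Suc n)"
    and "\<And>x. x \<in> S \<Longrightarrow> leq m x \<Longrightarrow> x = m" "\<And>x. x \<in> S \<Longrightarrow> leq x e \<Longrightarrow> x = e"
  shows "pm_filter (spans e m) (lin_ext list_boundary
     (pm_filter (spans e m) (lin_ext list_boundary (f :: 'a list \<Rightarrow>\<^sub>0 'k::comm_ring_1)))) = 0"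
proof -
  let ?g = "lin_ext list_boundary f :: 'a list \<Rightarrow>\<^sub>0 'k"
  have g: "Poly_Mapping.keys ?g \<subseteq> chain_lists leq S n" by (rule lin_ext_list_boundary_chain_lists[OF assms(1)])
  have "pm_filter (spans e m) (lin_ext list_boundary (pm_filter (spans e m) ?g))
      = pm_filter (spans e m) (lin_ext list_boundary ?g)"
  proof (rule boundary_pm_filter)
    fix xs ys assume xs: "xs \<in> Poly_Mapping.keys ?g"
      and ys: "ys \<in> Poly_Mapping.keys (list_boundary xs :: 'a list \<Rightarrow>\<^sub>0 'k)" "spans e m ys"
    obtain i where i: "ys = omit i xs" using ys keys_list_boundary by fast
    have "m \<in> set ys" "e \<in> set ys" using ys(2) by (auto simp: spans_def)
    then have "m \<in> set xs" "e \<in> set xs" using i set_omit by fast+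
    then show "spans e m xs"
      using chain_lists_hd_last[of xs leq S n m] chain_lists_hd_last[of xs leq S n e] assms(2,3) xs g
      unfolding spans_def by (metis empty_iff list.set(1) subsetD)
  qed
  then show ?thesis by (simp add: lin_ext_lin_ext list_boundary_boundary)
qed

lemma prism_hd: "ys \<in> Poly_Mapping.keys (prism p xs :: 'a list \<Rightarrow>\<^sub>0 'k::comm_ring_1) \<Longrightarrow> ys \<noteq> [] \<and> xs \<noteq> [] \<and> hd ys = hd xs"
  using keys_pm_map[of "(#) (hd xs)" "prism p (tl xs) :: 'a list \<Rightarrow>\<^sub>0 'k"]
  by (cases xs) (auto dest!: subsetD[OF keys_diff] split: if_splits)

text \<open>The prism keeps the first entry, while \<open>map p\<close> moves \<open>e\<close>.
  After restriction the homotopy formula thus equates the sum of both composites on \<open>w\<close>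
  with \<open>- w\<close>, and one composite vanishes for a cycle. The filling involves values of
  \<open>p\<close>, so it lies over \<open>S\<close> and not over \<open>Q\<close>.\<close>

lemma prism_contraction:
  fixes w :: "'a list \<Rightarrow>\<^sub>0 'k::comm_ring_1"
  assumes w: "Poly_Mapping.keys w \<subseteq> {xs \<in> chain_lists leq Q n. based e xs}"
    and cyc: "pm_filter (based e) (lin_ext list_boundary w) = 0"
    and tr: "transp_on S leq" and QS: "Q \<subseteq> S"
    and p: "\<And>x. x \<in> Q \<Longrightarrow> p x \<in> S \<and> leq x (p x)"
    and mono: "\<And>x y. x \<in> Q \<Longrightarrow> y \<in> Q \<Longrightarrow> leq x y \<Longrightarrow> leq (p x) (p y)"
    and pe: "p e \<noteq> e"
  shows "\<exists>v. Poly_Mapping.keys v \<subseteq> {xs \<in> chain_lists leq S (Suc n). based e xs} \<and>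
      pm_filter (based e) (lin_ext list_boundary v) = w"
proof (intro exI conjI)
  let ?h = "lin_ext (prism p) :: ('a list \<Rightarrow>\<^sub>0 'k) \<Rightarrow> _"
  let ?d = "lin_ext list_boundary :: ('a list \<Rightarrow>\<^sub>0 'k) \<Rightarrow> _"
  have base_h: "pm_filter (based e) (?h f) = ?h (pm_filter (based e) f)" for f
  proof (rule pm_linear_eqI[where f = f])
    fix xs :: "'a list"
    have "pm_filter (based e) (prism p xs :: _ \<Rightarrow>\<^sub>0 'k) = (if based e xs then prism p xs else 0)"
      using prism_hd[where 'k = 'k and p = p and xs = xs] by (auto intro!: pm_filter_id pm_filter_none simp: based_def)
    then show "pm_filter (based e) (?h (Poly_Mapping.single xs 1)) = ?h (pm_filter (based e) (Poly_Mapping.single xs 1))"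
      by (simp add: pm_filter_single)
  qed (auto intro: pm_linear_intros pm_linear_pm_filter_comp)
  have "pm_filter (based e) (pm_map (map p) w) = 0"
  proof (rule pm_filter_none)
    fix ys assume "ys \<in> Poly_Mapping.keys (pm_map (map p) w)"
    then obtain xs where "xs \<in> Poly_Mapping.keys w" "ys = map p xs" using keys_pm_map by fast
    then show "\<not> based e ys" using w pe by (cases xs) (auto simp: based_def)
  qed
  moreover have "pm_filter (based e) w = w" using w by (intro pm_filter_id) auto
  moreover have "pm_filter (based e) (?d (?h w) + ?h (?d w)) = pm_filter (based e) (pm_map (map p) w - w)"
    by (simp only: prism_homotopy_lin)
  ultimately show "pm_filter (based e) (?d (- ?h w)) = w"
    by (simp add: pm_filter_simps lin_ext_uminus base_h cyc)
  have "Poly_Mapping.keys (?h w) \<subseteq> {xs \<in> chain_lists leq S (Suc n). based e xs}"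
  proof (rule keys_lin_ext_subset[OF w], rule subsetI)
    fix xs ys assume "xs \<in> {xs \<in> chain_lists leq Q n. based e xs}" "ys \<in> Poly_Mapping.keys (prism p xs :: _ \<Rightarrow>\<^sub>0 'k)"
    then show "ys \<in> {xs \<in> chain_lists leq S (Suc n). based e xs}"
      using keys_prism[OF _ tr QS p mono, of xs n] by (force simp: based_def)
  qed
  then show "Poly_Mapping.keys (- ?h w) \<subseteq> {xs \<in> chain_lists leq S (Suc n). based e xs}" by simp
qed

text \<open>On \<open>K\<close> the map \<open>p\<close> is not controlled. The part of
  \<open>w\<close> that ends at some \<open>c\<close> in \<open>K\<close> is a cycle of chains up to
  \<open>c\<close>, filled by \<open>IH\<close>. Subtracting the boundaries of all these fillings
  leaves a cycle without chains ending in \<open>K\<close>; by maximality its chains avoid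
  \<open>K\<close> altogether, and the contraction along \<open>p\<close> applies.\<close>

lemma coatom_contraction:
  fixes w :: "'a list \<Rightarrow>\<^sub>0 'k::comm_ring_1"
  assumes w: "Poly_Mapping.keys w \<subseteq> {xs \<in> chain_lists leq S n. based e xs}"
    and cyc: "pm_filter (based e) (lin_ext list_boundary w) = 0"
    and tr: "transp_on S leq" and K: "finite K" "K \<subseteq> S"
    and max: "\<And>c x. c \<in> K \<Longrightarrow> x \<in> S \<Longrightarrow> leq c x \<Longrightarrow> x = c"
    and bot: "\<And>x. x \<in> S \<Longrightarrow> leq x e \<Longrightarrow> x = e"
    and p: "\<And>x. x \<in> S - K \<Longrightarrow> p x \<in> S \<and> leq x (p x)"
    and mono: "\<And>x y. x \<in> S - K \<Longrightarrow> y \<in> S - K \<Longrightarrow> leq x y \<Longrightarrow> leq (p x) (p y)"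
    and pe: "p e \<noteq> e"
    and IH: "\<And>c. c \<in> K \<Longrightarrow> pm_filter (spans e c) (lin_ext list_boundary (pm_filter (\<lambda>xs. last xs = c) w)) = 0
       \<Longrightarrow> \<exists>y. Poly_Mapping.keys y \<subseteq> {xs \<in> chain_lists leq S (Suc n). spans e c xs} \<and>
         pm_filter (spans e c) (lin_ext list_boundary y) = pm_filter (\<lambda>xs. last xs = c) w"
  shows "\<exists>v. Poly_Mapping.keys v \<subseteq> {xs \<in> chain_lists leq S (Suc n). based e xs} \<and>
      pm_filter (based e) (lin_ext list_boundary v) = w"
proof -
  let ?d = "lin_ext list_boundary :: ('a list \<Rightarrow>\<^sub>0 'k) \<Rightarrow> _"
  have sb: "pm_filter (spans e c) f = pm_filter (spans e c) (pm_filter (based e) f)" for c and f :: "'a list \<Rightarrow>\<^sub>0 'k"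
    by (simp add: pm_filter_filter, rule pm_filter_cong) (auto simp: spans_def based_def)
  have "\<exists>y. Poly_Mapping.keys y \<subseteq> {xs \<in> chain_lists leq S (Suc n). spans e c xs} \<and>
         pm_filter (spans e c) (?d y) = pm_filter (\<lambda>xs. last xs = c) w" if c: "c \<in> K" for c
  proof (rule IH[OF c])
    have "pm_filter (spans e c) (?d (pm_filter (\<lambda>xs. last xs = c) w)) = pm_filter (spans e c) (?d w)"
      by (rule boundary_last[of _ leq S n]) (use w max[OF c] in auto)
    then show "pm_filter (spans e c) (?d (pm_filter (\<lambda>xs. last xs = c) w)) = 0"
      using sb[of c "?d w"] cyc by simp
  qed
  then have "\<forall>c\<in>K. \<exists>y. Poly_Mapping.keys y \<subseteq> {xs \<in> chain_lists leq S (Suc n). spans e c xs} \<and>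
         pm_filter (spans e c) (?d y) = pm_filter (\<lambda>xs. last xs = c) w" by blast
  from bchoice[OF this] obtain y where y: "\<And>c. c \<in> K \<Longrightarrow> Poly_Mapping.keys (y c) \<subseteq> {xs \<in> chain_lists leq S (Suc n). spans e c xs}"
    "\<And>c. c \<in> K \<Longrightarrow> pm_filter (spans e c) (?d (y c)) = pm_filter (\<lambda>xs. last xs = c) w" by blast
  define Y where "Y = (\<Sum>c\<in>K. y c)"
  have "Poly_Mapping.keys Y \<subseteq> (\<Union>c\<in>K. Poly_Mapping.keys (y c))" unfolding Y_def by (rule keys_sum)
  then have keysY: "Poly_Mapping.keys Y \<subseteq> {xs \<in> chain_lists leq S (Suc n). based e xs}"
    using y(1) by (fastforce simp: spans_def based_def)
  define w' where "w' = w - pm_filter (based e) (?d Y)"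
  have dY: "Poly_Mapping.keys (pm_filter (based e) (?d Y)) \<subseteq> {xs \<in> chain_lists leq S n. based e xs}"
    using lin_ext_list_boundary_chain_lists[of Y leq S n] keysY by (fastforce simp: keys_pm_filter)
  then have keysw': "Poly_Mapping.keys w' \<subseteq> {xs \<in> chain_lists leq S n. based e xs}"
    using w keys_diff[of w "pm_filter (based e) (?d Y)"] unfolding w'_def by blast
  \<comment> \<open>Fillings for different \<open>c\<close> end in different entries, so restriction
    recovers each summand.\<close>
  have lastY: "pm_filter (\<lambda>xs. last xs = c) Y = y c" if c: "c \<in> K" for c
  proof -
    have "pm_filter (\<lambda>xs. last xs = c) Y = (\<Sum>d\<in>K. if d = c then y c else 0)"
      unfolding Y_def pm_filter_simps using y(1)
      by (intro sum.cong refl) (auto simp: spans_def intro!: pm_filter_id pm_filter_none)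
    then show ?thesis using K c by simp
  qed
  have none: "pm_filter (spans e c) w' = 0" if c: "c \<in> K" for c
  proof -
    have "pm_filter (spans e c) (pm_filter (based e) (?d Y)) = pm_filter (spans e c) (?d (pm_filter (\<lambda>xs. last xs = c) Y))"
      unfolding sb[symmetric] by (rule boundary_last[symmetric, of _ leq S "Suc n"]) (use keysY max[OF c] in auto)
    also have "\<dots> = pm_filter (\<lambda>xs. last xs = c) w" using lastY[OF c] y(2)[OF c] by simp
    also have "\<dots> = pm_filter (spans e c) w"
      using w by (intro pm_filter_cong) (auto simp: spans_def based_def)
    finally show ?thesis unfolding w'_def by (simp add: pm_filter_simps)
  qed
  have keysQ: "Poly_Mapping.keys w' \<subseteq> {xs \<in> chain_lists leq (S - K) n. based e xs}"
  proof
    fix xs assume xs: "xs \<in> Poly_Mapping.keys w'"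
    then have xs': "xs \<in> chain_lists leq S n" "based e xs" using keysw' by auto
    have "last xs \<notin> K"
    proof
      assume "last xs \<in> K"
      then have "Poly_Mapping.lookup (pm_filter (spans e (last xs)) w') xs = 0" using none by simp
      then show False using xs xs'(2) by (auto simp: in_keys_iff based_def spans_def)
    qed
    then have "x \<notin> K" if "x \<in> set xs" for x
      using chain_lists_hd_last(2,4)[OF xs'(1) that] max[of x "last xs"] that \<open>last xs \<notin> K\<close> by auto
    then show "xs \<in> {xs \<in> chain_lists leq (S - K) n. based e xs}" using xs' by (auto simp: chain_lists_def)
  qed
  have cyc': "pm_filter (based e) (?d w') = 0"
    using based_boundary_boundary[of Y leq S n e] keysY bot cyc
    unfolding w'_def by (auto simp: pm_filter_simps lin_ext_diff)
  obtain v where v: "Poly_Mapping.keys v \<subseteq> {xs \<in> chain_lists leq S (Suc n). based e xs}"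
    "pm_filter (based e) (?d v) = w'"
    using prism_contraction[OF keysQ cyc' tr _ p mono pe] by auto
  have "pm_filter (based e) (?d (v + Y)) = w" by (simp add: lin_ext_add pm_filter_simps v(2) w'_def)
  moreover have "Poly_Mapping.keys (v + Y) \<subseteq> {xs \<in> chain_lists leq S (Suc n). based e xs}"
    using v(1) keysY keys_add[of v Y] by blast
  ultimately show ?thesis by blast
qed

text \<open>For a cycle only the last summand of \<open>spans_boundary_snoc\<close> is left:
  appending \<open>m\<close> once more exhibits, up to sign, the part of \<open>z\<close> that
  repeats its top as a boundary.\<close>

lemma spans_cycle_snoc:
  fixes z :: "'a list \<Rightarrow>\<^sub>0 'k::comm_ring_1"
  assumes z: "Poly_Mapping.keys z \<subseteq> {xs \<in> chain_lists leq (insert m S) n. spans e m xs}"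
    and cyc: "pm_filter (spans e m) (lin_ext list_boundary z) = 0"
    and top: "leq m m" "\<And>x. x \<in> S \<Longrightarrow> leq x m"
  shows "\<exists>y. Poly_Mapping.keys y \<subseteq> {xs \<in> chain_lists leq (insert m S) (Suc n). spans e m xs} \<and>
      pm_filter (spans e m) (lin_ext list_boundary y) = pm_filter (\<lambda>xs. spans e m (butlast xs)) z"
proof (intro exI conjI)
  let ?y = "pm_scale ((- 1) ^ n) (pm_map (\<lambda>xs. xs @ [m]) z)"
  have "Poly_Mapping.keys (pm_map (\<lambda>xs. xs @ [m]) z) \<subseteq> {xs \<in> chain_lists leq (insert m S) (Suc n). spans e m xs}"
  proof (intro order_trans[OF keys_pm_map] image_subsetI)
    fix xs assume "xs \<in> Poly_Mapping.keys z"
    then have "xs \<in> chain_lists leq (insert m S) n" "spans e m xs" using z by auto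
    then show "xs @ [m] \<in> {xs \<in> chain_lists leq (insert m S) (Suc n). spans e m xs}"
      using top by (auto simp: chain_lists_def spans_def sorted_wrt_append)
  qed
  then show "Poly_Mapping.keys ?y \<subseteq> {xs \<in> chain_lists leq (insert m S) (Suc n). spans e m xs}"
    by (rule order_trans[OF keys_pm_scale])
  have "pm_filter (spans e m) (lin_ext list_boundary (pm_map (\<lambda>xs. xs @ [m]) z)) =
      pm_scale ((- 1) ^ n) (pm_filter (\<lambda>xs. spans e m (butlast xs)) z)"
    using spans_boundary_snoc[of z n e m] z cyc by (auto simp: chain_lists_def)
  then show "pm_filter (spans e m) (lin_ext list_boundary ?y) = pm_filter (\<lambda>xs. spans e m (butlast xs)) z"
    by (simp add: lin_ext_scale pm_filter_simps flip: power_mult_distrib)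
qed

text \<open>Split \<open>z\<close> by whether the top is repeated. The repeating part is a boundary
  and hence a cycle, so the rest is a cycle too; in it \<open>m\<close> occurs only at the end, and
  removing it gives a cycle \<open>w\<close> below \<open>m\<close>. Since \<open>w\<close> is a
  parameter tied to \<open>z\<close> by an equation, the proof of \<open>below\<close> can use what
  is known about the coefficients of \<open>z\<close>.\<close>

lemma spans_cycle_is_boundary:
  fixes z w :: "'a list \<Rightarrow>\<^sub>0 'k::comm_ring_1"
  assumes w: "w = pm_map butlast (pm_filter (\<lambda>xs. \<not> spans e m (butlast xs)) z)"
    and z: "Poly_Mapping.keys z \<subseteq> {xs \<in> chain_lists leq (insert m S) (Suc n). spans e m xs}"
    and cyc: "pm_filter (spans e m) (lin_ext list_boundary z) = 0"
    and top: "leq m m" "\<And>x. x \<in> S \<Longrightarrow> leq x m" "\<And>x. x \<in> S \<Longrightarrow> \<not> leq m x" "m \<notin> S"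
    and bot: "\<And>x. x \<in> insert m S \<Longrightarrow> leq x e \<Longrightarrow> x = e" "m \<noteq> e"
    and below: "Poly_Mapping.keys w \<subseteq> {xs \<in> chain_lists leq S n. based e xs} \<Longrightarrow>
      pm_filter (based e) (lin_ext list_boundary w) = 0 \<Longrightarrow>
      \<exists>v. Poly_Mapping.keys v \<subseteq> {xs \<in> chain_lists leq S (Suc n). based e xs} \<and>
        pm_filter (based e) (lin_ext list_boundary v) = w"
  shows "\<exists>y. Poly_Mapping.keys y \<subseteq> {xs \<in> chain_lists leq (insert m S) (Suc (Suc n)). spans e m xs} \<and>
      pm_filter (spans e m) (lin_ext list_boundary y) = z"
proof -
  let ?d = "lin_ext list_boundary :: ('a list \<Rightarrow>\<^sub>0 'k) \<Rightarrow> _"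
  let ?T = "\<lambda>xs. spans e m (butlast xs)"
  let ?s = "pm_map (\<lambda>xs. xs @ [m]) :: ('a list \<Rightarrow>\<^sub>0 'k) \<Rightarrow> _"
  obtain y1 where y1: "Poly_Mapping.keys y1 \<subseteq> {xs \<in> chain_lists leq (insert m S) (Suc (Suc n)). spans e m xs}"
      "pm_filter (spans e m) (?d y1) = pm_filter ?T z"
    using spans_cycle_snoc[OF z cyc top(1,2)] by blast
  define z2 where "z2 = pm_filter (\<lambda>xs. \<not> ?T xs) z"
  have z12: "z = pm_filter ?T z + z2" unfolding z2_def by (rule pm_filter_split)
  have key: "xs = butlast xs @ [m] \<and> butlast xs \<in> chain_lists leq S n \<and> based e (butlast xs)"
    if "xs \<in> Poly_Mapping.keys z2" for xs
  proof -
    have xs: "xs \<in> chain_lists leq (insert m S) (Suc n)" "spans e m xs" "\<not> ?T xs"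
      using that z by (auto simp: z2_def keys_pm_filter)
    define u where "u = butlast xs"
    have u: "xs = u @ [m]" using xs(2) unfolding u_def spans_def by (metis append_butlast_last_id)
    have "u \<noteq> []" using xs(2) u bot(2) by (auto simp: spans_def)
    then have hd: "hd u = e" using xs(2) u by (auto simp: spans_def)
    have lu: "last u \<noteq> m" using xs(3) hd \<open>u \<noteq> []\<close> u by (auto simp: spans_def)
    have cu: "u \<in> chain_lists leq (insert m S) n" using xs(1) u by (auto simp: chain_lists_def sorted_wrt_append)
    have "m \<notin> set u"
    proof
      assume "m \<in> set u"
      from chain_lists_hd_last(2,4)[OF cu this] show False using lu top(3)[of "last u"] by auto
    qed
    then have "u \<in> chain_lists leq S n" using cu by (auto simp: chain_lists_def)
    then show ?thesis using u hd \<open>u \<noteq> []\<close> by (simp add: based_def)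
  qed
  have wz: "w = pm_map butlast z2" by (simp add: w z2_def)
  have keysw: "Poly_Mapping.keys w \<subseteq> {xs \<in> chain_lists leq S n. based e xs}"
    unfolding wz using key by (intro order_trans[OF keys_pm_map]) auto
  have "?s w = lin_ext (\<lambda>xs. Poly_Mapping.single xs 1) z2"
    unfolding wz pm_map_pm_map by (rule lin_ext_cong[OF refl]) (use key in metis)
  then have sw: "?s w = z2" by simp
  have "pm_filter (spans e m) (?d (pm_filter ?T z)) = 0"
    unfolding y1(2)[symmetric]
    by (rule spans_boundary_boundary[of _ leq "insert m S" "Suc n"]) (use y1(1) top(3) bot(1) in auto)
  then have "pm_filter (spans e m) (?d z2) = 0"
    using cyc by (subst (asm) (2) z12) (simp add: lin_ext_add pm_filter_simps)
  then have "?s (pm_filter (based e) (?d w)) = 0"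
    unfolding sw[symmetric]
    by (subst (asm) spans_boundary_snoc_new)
      (use bot(2) keysw top(4) in \<open>auto simp: chain_lists_def based_def subset_iff\<close>)
  \<comment> \<open>Appending \<open>m\<close> is injective, with \<open>butlast\<close> as a left
    inverse.\<close>
  then have "pm_map butlast (?s (pm_filter (based e) (?d w))) = 0" by simp
  then have "pm_filter (based e) (?d w) = 0" by (simp add: pm_map_pm_map)
  from below[OF keysw this] obtain v where v:
    "Poly_Mapping.keys v \<subseteq> {xs \<in> chain_lists leq S (Suc n). based e xs}"
    "pm_filter (based e) (?d v) = w" by blast
  have "pm_filter (spans e m) (?d (?s v)) = z2"
    by (subst spans_boundary_snoc_new)
      (use bot(2) v(1) top(4) in \<open>auto simp: chain_lists_def based_def subset_iff v(2) sw\<close>)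
  then have "pm_filter (spans e m) (?d (y1 + ?s v)) = z"
    using z12 y1(2) by (simp add: lin_ext_add pm_filter_simps)
  moreover have "Poly_Mapping.keys (?s v) \<subseteq> {xs \<in> chain_lists leq (insert m S) (Suc (Suc n)). spans e m xs}"
    using v(1) top by (intro order_trans[OF keys_pm_map])
      (auto simp: chain_lists_def spans_def based_def sorted_wrt_append subset_iff)
  ultimately show ?thesis using y1(1) keys_add[of y1 "?s v"] by blast
qed

section \<open>Merging and cutting off blocks\<close>

definition coarser :: "'a set \<Rightarrow> 'a set set \<Rightarrow> 'a set set \<Rightarrow> bool" where
  "coarser U P Q \<longleftrightarrow> refines U Q P"

lemma transp_coarser: "transp_on S (coarser U)"
  unfolding coarser_def by (rule transp_onI) (rule refines_trans)

lemma partition_block_eq: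
  "partition_on U P \<Longrightarrow> X \<in> P \<Longrightarrow> Y \<in> P \<Longrightarrow> x \<in> X \<Longrightarrow> x \<in> Y \<Longrightarrow> X = Y"
  by (meson disjnt_iff pairwiseD partition_onD2)

lemma partition_block_nonempty: "partition_on U P \<Longrightarrow> X \<in> P \<Longrightarrow> X \<noteq> {}"
  by (auto simp: partition_on_def)

lemma partition_block_subset: "partition_on U P \<Longrightarrow> X \<in> P \<Longrightarrow> X \<subseteq> U"
  by (auto simp: partition_on_def)

lemma partition_on_finite: "finite U \<Longrightarrow> partition_on U P \<Longrightarrow> finite P"
  unfolding partition_on_def by (auto intro: finite_UnionD)

lemma partition_subset_eq:
  assumes "partition_on U P" "partition_on U Q" "P \<subseteq> Q"
  shows "P = Q"
proof
  show "Q \<subseteq> P"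
  proof
    fix X assume X: "X \<in> Q"
    then obtain x where x: "x \<in> X" using partition_block_nonempty[OF assms(2)] by blast
    then have "x \<in> U" using partition_block_subset[OF assms(2) X] by auto
    then obtain Y where "Y \<in> P" "x \<in> Y" using assms(1) by (auto simp: partition_on_def)
    then show "X \<in> P" using partition_block_eq[OF assms(2) X _ x] assms(3) by blast
  qed
qed (rule assms(3))

text \<open>Sending a fine block to the coarse block around it is onto. If the cardinalities agree
  it is also injective, so each coarse block contains a single fine block and equals it.\<close>

lemma refines_card:
  assumes "refines U P Q" "finite U"
  shows "card Q \<le> card P" "card Q = card P \<Longrightarrow> P = Q"
proof -
  have P: "partition_on U P" and Q: "partition_on U Q" using assms by (auto simp: refines_def)
  obtain f where f: "\<And>X. X \<in> P \<Longrightarrow> f X \<in> Q \<and> X \<subseteq> f X" using assms(1) unfolding refines_def by metis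
  have fin: "finite P" "finite Q" using assms(2) P Q partition_on_finite by auto
  have surj: "f ` P = Q"
  proof
    show "Q \<subseteq> f ` P"
    proof
      fix Y assume Y: "Y \<in> Q"
      then obtain y where y: "y \<in> Y" using partition_block_nonempty[OF Q] by blast
      then have "y \<in> U" using partition_block_subset[OF Q Y] by auto
      then obtain X where X: "X \<in> P" "y \<in> X" using P by (auto simp: partition_on_def)
      then have "f X = Y" using partition_block_eq[OF Q _ Y _ y] f by blast
      then show "Y \<in> f ` P" using X by blast
    qed
  qed (use f in blast)
  then show "card Q \<le> card P" using card_image_le[OF fin(1)] by metis
  assume "card Q = card P"
  then have inj: "inj_on f P" using surj fin by (metis eq_card_imp_inj_on)
  have "X = f X" if X: "X \<in> P" for X
  proof (rule ccontr)
    assume "X \<noteq> f X"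
    then obtain y where y: "y \<in> f X" "y \<notin> X" using f[OF X] by blast
    then have "y \<in> U" using partition_block_subset[OF Q] f[OF X] by blast
    then obtain Z where Z: "Z \<in> P" "y \<in> Z" using P by (auto simp: partition_on_def)
    then have "f Z = f X" using partition_block_eq[OF Q, of "f Z" "f X" y] f[OF X] f[OF Z(1)] y by blast
    then show False using inj Z X y by (auto dest: inj_onD)
  qed
  then have "P \<subseteq> Q" using f by (metis subsetI)
  then show "P = Q" by (rule partition_subset_eq[OF P Q])
qed

section \<open>Merging two blocks and cutting off a block\<close>

definition merge :: "'a set \<Rightarrow> 'a set \<Rightarrow> 'a set set \<Rightarrow> 'a set set" where
  "merge B C P = insert (B \<union> C) (P - {B, C})"

text \<open>If \<open>B\<close> lies inside a block of \<open>P\<close>, this is the common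
  refinement of \<open>P\<close> with the partition into \<open>B\<close> and its complement. The
  empty set is removed because \<open>B\<close> may already be a block.\<close>

definition cut_off :: "'a set \<Rightarrow> 'a set set \<Rightarrow> 'a set set" where
  "cut_off B P = insert B ((\<lambda>X. X - B) ` P - {{}})"

context
  fixes U :: "'a set" and P :: "'a set set" and B :: "'a set"
  assumes part: "partition_on U P" and B: "B \<in> P"
begin

context
  fixes C
  assumes C: "C \<in> P" "C \<noteq> B"
begin

lemma merge_partition: "partition_on U (merge B C P)"
proof -
  have "disjnt (B \<union> C) (\<Union>(P - {B, C}))"
    using partition_block_eq[OF part] B C by (auto simp: disjnt_iff)
  moreover have "partition_on (U - (B \<union> C)) (P - {B, C})"
  proof (rule partition_onI)
    show "\<Union>(P - {B, C}) = U - (B \<union> C)"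
      using partition_onD1[OF part] partition_block_eq[OF part] B C by blast
  qed (use part in \<open>auto simp: partition_on_def pairwise_def\<close>)
  ultimately show ?thesis
    unfolding merge_def
    using partition_block_subset[OF part] B C partition_block_nonempty[OF part B]
    by (subst partition_on_insert) auto
qed

lemma refines_merge: "refines U P (merge B C P)"
  unfolding refines_def using part merge_partition by (auto simp: merge_def)

lemma card_merge: "finite U \<Longrightarrow> Suc (card (merge B C P)) = card P"
proof -
  assume "finite U"
  then have fin: "finite P" using part partition_on_finite by auto
  have "B \<union> C \<notin> P - {B, C}"
    using partition_block_eq[OF part] partition_block_nonempty[OF part B] B by blast
  moreover have "card P = Suc (Suc (card (P - {B, C})))"
    using fin B C card.remove[of P B] card.remove[of "P - {B}" C] Diff_insert2[of P B "{C}"] by simp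
  ultimately show ?thesis using fin by (simp add: merge_def)
qed

lemma merge_block: "B \<union> C \<in> merge B C P"
  by (simp add: merge_def)

lemma merge_diff: "merge B C P - {B \<union> C} = P - {B, C}"
  using partition_block_eq[OF part] partition_block_nonempty[OF part B] B unfolding merge_def by blast

text \<open>A merge lowers the number of blocks by exactly one, which leaves no room for a partition
  strictly between: the mergers are coatoms below \<open>P\<close>.\<close>

lemma coarser_merge_max:
  assumes "finite U" "refines U P X" "X \<noteq> P" "refines U X (merge B C P)"
  shows "X = merge B C P"
proof -
  have "card X \<le> card P" "card X \<noteq> card P" using refines_card[OF assms(2,1)] assms(3) by auto
  moreover have "card (merge B C P) \<le> card X" using refines_card[OF assms(4,1)] by auto
  ultimately show ?thesis
    using refines_card(2)[OF assms(4,1)] card_merge[OF assms(1)] by force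
qed

end

text \<open>Cutting off moves up in the order \<open>coarser\<close>, but not beyond
  \<open>P\<close>, since \<open>B\<close> is a block of \<open>P\<close>. The operator thus acts on
  the interval below \<open>P\<close>.\<close>

lemma cut_off_partition:
  assumes "refines U P X"
  shows "partition_on U (cut_off B X)" "refines U (cut_off B X) X" "refines U P (cut_off B X)"
proof -
  have X: "partition_on U X" using assms by (simp add: refines_def)
  have "partition_on (U - B) ((\<lambda>Y. Y - B) ` X - {{}})"
  proof -
    have "partition_on ((U - B) \<inter> U) ((\<inter>) (U - B) ` X - {{}})" by (rule partition_on_restrict[OF X])
    moreover have "(\<inter>) (U - B) ` X = (\<lambda>Y. Y - B) ` X"
      using partition_block_subset[OF X] by (intro image_cong) auto
    moreover have "(U - B) \<inter> U = U - B" by auto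
    ultimately show ?thesis by simp
  qed
  moreover have "disjnt B (\<Union>((\<lambda>Y. Y - B) ` X - {{}}))" by (auto simp: disjnt_iff)
  ultimately show cut: "partition_on U (cut_off B X)"
    unfolding cut_off_def
    using partition_block_subset[OF part B] partition_block_nonempty[OF part B]
    by (subst partition_on_insert) auto
  obtain Y where "Y \<in> X" "B \<subseteq> Y" using assms B unfolding refines_def by blast
  then show "refines U (cut_off B X) X" unfolding refines_def using cut X by (auto simp: cut_off_def)
  have "\<exists>Z\<in>cut_off B X. M \<subseteq> Z" if M: "M \<in> P" for M
  proof (cases "M = B")
    case False
    obtain Y where Y: "Y \<in> X" "M \<subseteq> Y" using assms M unfolding refines_def by blast
    have "M \<inter> B = {}" using partition_block_eq[OF part M B] False by blast
    then have "M \<subseteq> Y - B" "Y - B \<noteq> {}" using Y partition_block_nonempty[OF part M] by auto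
    then show ?thesis using Y unfolding cut_off_def by blast
  qed (auto simp: cut_off_def)
  then show "refines U P (cut_off B X)" unfolding refines_def using part cut by auto
qed

lemma cut_off_mono:
  assumes "refines U P X" "refines U P Y" "refines U Y X"
  shows "refines U (cut_off B Y) (cut_off B X)"
proof -
  have "\<exists>W\<in>cut_off B X. Z \<subseteq> W" if "Z \<in> cut_off B Y" for Z
  proof (cases "Z = B")
    case False
    then have "Z \<in> (\<lambda>X. X - B) ` Y" "Z \<noteq> {}" using that by (auto simp: cut_off_def)
    then obtain M where M: "M \<in> Y" "Z = M - B" "Z \<noteq> {}" by blast
    then obtain N where "N \<in> X" "M \<subseteq> N" using assms(3) unfolding refines_def by blast
    then have "Z \<subseteq> N - B" "N - B \<in> cut_off B X" using M by (auto simp: cut_off_def)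
    then show ?thesis by blast
  qed (auto simp: cut_off_def)
  then show ?thesis unfolding refines_def using cut_off_partition assms by auto
qed

text \<open>Only the block \<open>Y\<close> around \<open>B\<close> is changed by cutting off. If
  the result is \<open>P\<close>, all other blocks of \<open>X\<close> belong to \<open>P\<close>,
  and so does \<open>Y - B\<close>, unless it is empty; but then \<open>X\<close> would be
  \<open>P\<close>.\<close>

lemma cut_off_eq_imp_merge:
  assumes "refines U P X" "X \<noteq> P" "cut_off B X = P"
  obtains C where "C \<in> P" "C \<noteq> B" "X = merge B C P"
proof -
  have X: "partition_on U X" using assms by (simp add: refines_def)
  obtain Y where Y: "Y \<in> X" "B \<subseteq> Y" using assms(1) B unfolding refines_def by blast
  have other: "Z \<in> P \<and> Z \<inter> B = {}" if Z: "Z \<in> X" "Z \<noteq> Y" for Z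
  proof -
    have "Z \<inter> B = {}" using partition_block_eq[OF X Z(1) Y(1)] Z(2) Y(2) by blast
    then have "Z - B = Z" by auto
    moreover have "Z - B \<in> cut_off B X"
      using Z calculation partition_block_nonempty[OF X Z(1)] by (auto simp: cut_off_def)
    ultimately show ?thesis using assms(3) \<open>Z \<inter> B = {}\<close> by simp
  qed
  have "Y \<noteq> B"
  proof
    assume "Y = B"
    then have "X \<subseteq> P" using other B by blast
    then show False using partition_subset_eq[OF X part] assms(2) by blast
  qed
  define C where "C = Y - B"
  have Cne: "C \<noteq> {}" using \<open>Y \<noteq> B\<close> Y by (auto simp: C_def)
  have CP: "C \<in> P" using Y Cne assms(3) unfolding C_def cut_off_def by auto
  have CB: "C \<noteq> B" using Cne by (auto simp: C_def)
  have "X \<subseteq> merge B C P"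
  proof
    fix Z assume Z: "Z \<in> X"
    show "Z \<in> merge B C P"
    proof (cases "Z = Y")
      case True then show ?thesis using Y by (simp add: merge_def C_def Un_absorb1)
    next
      case False
      then have "Z \<in> P" "Z \<inter> B = {}" using other Z by auto
      moreover have "Z \<noteq> B" using \<open>Z \<inter> B = {}\<close> partition_block_nonempty[OF part B] by auto
      moreover have "Z \<noteq> C" using partition_block_eq[OF X Z Y(1)] False Cne by (auto simp: C_def)
      ultimately show ?thesis by (simp add: merge_def)
    qed
  qed
  then have "X = merge B C P" by (rule partition_subset_eq[OF X merge_partition[OF CP CB]])
  then show ?thesis using that CP CB by blast
qed

end

lemma refines_one_block:
  assumes "partition_on U X" "U \<noteq> {}"
  shows "refines U X {U}"
  unfolding refines_def using assms partition_on_space[OF assms(2)] partition_block_subset by auto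

text \<open>Chains are listed from coarse to fine, so the merge performed first is recorded last.
  The block that grows from \<open>B\<close> to \<open>B \<union> C\<close> records which coatom is
  entered at each level of the induction.\<close>

primrec comb_chain :: "'a set \<Rightarrow> 'a set list \<Rightarrow> 'a set set list" where
  "comb_chain B [] = [{B}]"
| "comb_chain B (C # Cs) = comb_chain (B \<union> C) Cs @ [insert B (insert C (set Cs))]"

lemma last_comb_chain: "last (comb_chain B Cs) = insert B (set Cs)"
  by (cases Cs) auto

text \<open>The vanishing hypothesis constrains \<open>z\<close> only in the degree of the maximal
  chains, so one induction covers all degrees. It is inherited: a comb chain of
  \<open>merge B C P\<close> for the block \<open>B \<union> C\<close>, with \<open>P\<close>
  appended, is a comb chain of \<open>P\<close> for \<open>B\<close>. The distinguished block
  changes along the way and is therefore generalized together with \<open>P\<close>.\<close>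

lemma partition_chains_acyclic:
  fixes z :: "'a set set list \<Rightarrow>\<^sub>0 'k::comm_ring_1"
  assumes "finite U" "U \<noteq> {}" "partition_on U P" "B \<in> P"
    and "Poly_Mapping.keys z \<subseteq> {xs \<in> chain_lists (coarser U) {X. refines U P X} (Suc n). spans {U} P xs}"
    and "pm_filter (spans {U} P) (lin_ext list_boundary z) = 0"
    and "\<And>Cs. Suc n = card P \<Longrightarrow> distinct Cs \<Longrightarrow> set Cs = P - {B} \<Longrightarrow> Poly_Mapping.lookup z (comb_chain B Cs) = 0"
  shows "\<exists>y. Poly_Mapping.keys y \<subseteq> {xs \<in> chain_lists (coarser U) {X. refines U P X} (Suc (Suc n)). spans {U} P xs} \<and>
      pm_filter (spans {U} P) (lin_ext list_boundary y) = z"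
  using assms(3-7)
proof (induction "card P" arbitrary: P B n z rule: less_induct)
  case (less P B n z)
  let ?S = "{X. refines U P X} - {P}"
  have finP: "finite P" using less.prems(1) assms(1) partition_on_finite by auto
  have S: "{X. refines U P X} = insert P ?S" using refines_refl[OF less.prems(1)] by auto
  show ?case
  proof (cases "P = {U}")
    case True
    then have BU: "B = U" using less.prems(2) by simp
    have "X = {U}" if "refines U {U} X" for X
      using refines_asym[OF that] that refines_one_block[of U X] assms(2) by (simp add: refines_def)
    then have S1: "{X. refines U P X} = {P}" using True refines_refl[OF less.prems(1)] by auto
    obtain y where y: "Poly_Mapping.keys y \<subseteq> {xs \<in> chain_lists (coarser U) (insert P {}) (Suc (Suc n)). spans {U} P xs}"
      "pm_filter (spans {U} P) (lin_ext list_boundary y) = pm_filter (\<lambda>xs. spans {U} P (butlast xs)) z"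
      using spans_cycle_snoc[of z "coarser U" P "{}" "Suc n" "{U}"] less.prems(3,4) refines_refl[OF less.prems(1)]
      unfolding S1 by (auto simp: coarser_def)
    \<comment> \<open>Only constant lists occur. With two or more entries they repeat the top; the
      list with one entry is the comb chain without merges, at which \<open>z\<close> vanishes by
      hypothesis.\<close>
    have "pm_filter (\<lambda>xs. spans {U} P (butlast xs)) z = z"
    proof (cases n)
      case 0
      have "z = 0"
      proof (rule poly_mapping_eqI)
        fix xs
        show "Poly_Mapping.lookup z xs = Poly_Mapping.lookup 0 xs"
        proof (cases "xs \<in> Poly_Mapping.keys z")
          case True
          then have "xs = [{U}]" using less.prems(3) 0 by (auto simp: chain_lists_def spans_def length_Suc_conv)
          then show ?thesis using less.prems(5)[of "[]"] 0 \<open>P = {U}\<close> BU by simp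
        qed (auto simp: in_keys_iff)
      qed
      then show ?thesis by simp
    next
      case (Suc k)
      show ?thesis
      proof (rule pm_filter_id)
        fix xs assume "xs \<in> Poly_Mapping.keys z"
        then have xs: "length xs = Suc (Suc k)" "set xs \<subseteq> {{U}}"
          using less.prems(3) S1 unfolding Suc True by (auto simp: chain_lists_def)
        have "butlast xs \<noteq> []" "set (butlast xs) \<subseteq> {{U}}" using xs by (auto simp flip: length_0_conv dest: in_set_butlastD)
        then show "spans {U} P (butlast xs)"
          unfolding spans_def using True by (metis hd_in_set last_in_set singletonD subsetD)
      qed
    qed
    then show ?thesis using y unfolding S1 by auto
  next
    case False
    let ?K = "(\<lambda>C. merge B C P) ` (P - {B})"
    note part = less.prems(1,2)
    have m_in: "merge B C P \<in> ?S" if "C \<in> P - {B}" for C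
      using refines_merge[OF part, of C] card_merge[OF part, of C] assms(1) that by force
    have bot: "x = {U}" if "refines U P x" "coarser U x {U}" for x
      using that refines_one_block[of U x] assms(2) unfolding coarser_def
      by (metis refines_asym refines_def)
    define w where "w = pm_map butlast (pm_filter (\<lambda>xs. \<not> spans {U} P (butlast xs)) z)"
    have "\<exists>y. Poly_Mapping.keys y \<subseteq> {xs \<in> chain_lists (coarser U) (insert P ?S) (Suc (Suc n)). spans {U} P xs} \<and>
      pm_filter (spans {U} P) (lin_ext list_boundary y) = z"
    proof (rule spans_cycle_is_boundary[OF w_def])
      show "Poly_Mapping.keys z \<subseteq> {xs \<in> chain_lists (coarser U) (insert P ?S) (Suc n). spans {U} P xs}"
        using less.prems(3) unfolding S[symmetric] .
      show "pm_filter (spans {U} P) (lin_ext list_boundary z) = 0" by (rule less.prems(4))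
      show "coarser U P P" "\<And>x. x \<in> ?S \<Longrightarrow> coarser U x P"
        using refines_refl[OF less.prems(1)] by (auto simp: coarser_def)
      show "\<And>x. x \<in> ?S \<Longrightarrow> \<not> coarser U P x" using refines_asym by (auto simp: coarser_def)
      show "P \<notin> ?S" "P \<noteq> {U}" using False by auto
      show "\<And>x. x \<in> insert P ?S \<Longrightarrow> coarser U x {U} \<Longrightarrow> x = {U}" using bot unfolding S[symmetric] by blast
    next
      assume w: "Poly_Mapping.keys w \<subseteq> {xs \<in> chain_lists (coarser U) ?S n. based {U} xs}"
        "pm_filter (based {U}) (lin_ext list_boundary w) = 0"
      have cutS: "cut_off B x \<in> ?S \<and> coarser U x (cut_off B x)" if x: "x \<in> ?S - ?K" for x
      proof -
        have x': "refines U P x" "x \<noteq> P" "x \<notin> ?K" using x by auto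
        have "cut_off B x \<noteq> P"
        proof
          assume "cut_off B x = P"
          from cut_off_eq_imp_merge[OF part x'(1,2) this] show False using x'(3) by blast
        qed
        then show ?thesis using cut_off_partition[OF part x'(1)] by (auto simp: coarser_def)
      qed
      \<comment> \<open>A coefficient of \<open>w\<close> at \<open>v\<close> can come only from
        \<open>v @ [P]\<close>, because every chain in the support of \<open>z\<close> ends in
        \<open>P\<close>.\<close>
      have vanish: "Poly_Mapping.lookup w v = 0" if "Poly_Mapping.lookup z (v @ [P]) = 0" for v
      proof (rule ccontr)
        assume "Poly_Mapping.lookup w v \<noteq> 0"
        then have "v \<in> Poly_Mapping.keys w" by (simp add: in_keys_iff)
        then obtain xs where xs: "xs \<in> Poly_Mapping.keys z" "v = butlast xs"
          unfolding w_def using keys_pm_map by (fastforce simp: keys_pm_filter)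
        then have "spans {U} P xs" using less.prems(3) by blast
        then have "xs = v @ [P]" using xs(2) unfolding spans_def by (metis append_butlast_last_id)
        then show False using that xs(1) by (simp add: in_keys_iff)
      qed
      show "\<exists>v. Poly_Mapping.keys v \<subseteq> {xs \<in> chain_lists (coarser U) ?S (Suc n). based {U} xs} \<and>
        pm_filter (based {U}) (lin_ext list_boundary v) = w"
      proof (rule coatom_contraction[OF w transp_coarser, where K = ?K and p = "cut_off B"])
        show "finite ?K" using finP by simp
        show "?K \<subseteq> ?S" using m_in by blast
        show "x = c" if "c \<in> ?K" "x \<in> ?S" "coarser U c x" for c x
          using that coarser_merge_max[OF part _ _ assms(1), of _ x] by (auto simp: coarser_def)
        show "x = {U}" if "x \<in> ?S" "coarser U x {U}" for x using that bot by auto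
        show "cut_off B x \<in> ?S \<and> coarser U x (cut_off B x)" if "x \<in> ?S - ?K" for x using cutS[OF that] .
        show "coarser U (cut_off B x) (cut_off B y)" if "x \<in> ?S - ?K" "y \<in> ?S - ?K" "coarser U x y" for x y
          using that cut_off_mono[OF part] by (auto simp: coarser_def)
        show "cut_off B {U} \<noteq> {U}"
        proof
          assume "cut_off B {U} = {U}"
          then have "B = U" by (auto simp: cut_off_def)
          then show False using False less.prems(1,2) partition_subset_eq[of U "{U}" P] partition_on_space[OF assms(2)] by auto
        qed
        fix c assume c: "c \<in> ?K" and cyc: "pm_filter (spans {U} c) (lin_ext list_boundary (pm_filter (\<lambda>xs. last xs = c) w)) = 0"
        let ?zc = "pm_filter (\<lambda>xs. last xs = c) w"
        obtain C where C: "C \<in> P" "C \<noteq> B" "c = merge B C P" using c by auto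
        have cS: "refines U P c" "c \<noteq> P" using m_in[of C] C by auto
        have sub: "{X. refines U c X} \<subseteq> ?S"
          using cS refines_trans refines_asym by blast
        show "\<exists>y. Poly_Mapping.keys y \<subseteq> {xs \<in> chain_lists (coarser U) ?S (Suc n). spans {U} c xs} \<and>
         pm_filter (spans {U} c) (lin_ext list_boundary y) = ?zc"
        proof (cases n)
          case 0
          then have "?zc = 0" using w(1) by (intro pm_filter_none) (auto simp: chain_lists_def based_def)
          then show ?thesis by (intro exI[of _ 0]) simp
        next
          case (Suc k)
          have "\<exists>y. Poly_Mapping.keys y \<subseteq> {xs \<in> chain_lists (coarser U) {X. refines U c X} (Suc (Suc k)). spans {U} c xs} \<and>
            pm_filter (spans {U} c) (lin_ext list_boundary y) = ?zc"
          proof (rule less.hyps)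
            show "card c < card P" using card_merge[OF part C(1,2) assms(1)] C(3) by simp
            show "partition_on U c" "B \<union> C \<in> c"
              using merge_partition[OF part C(1,2)] C(3) by (auto simp: merge_def)
            show "Poly_Mapping.keys ?zc \<subseteq> {xs \<in> chain_lists (coarser U) {X. refines U c X} (Suc k). spans {U} c xs}"
            proof
              fix xs assume "xs \<in> Poly_Mapping.keys ?zc"
              then have xs: "xs \<in> chain_lists (coarser U) ?S (Suc k)" "based {U} xs" "last xs = c"
                using w(1) Suc by (auto simp: keys_pm_filter)
              have "x = c \<or> coarser U x c" if "x \<in> set xs" for x
                using chain_lists_hd_last(2)[OF xs(1) that] xs(3) by simp
              then have "set xs \<subseteq> {X. refines U c X}"
                using refines_refl[of U c] cS by (auto simp: coarser_def refines_def)
              then show "xs \<in> {xs \<in> chain_lists (coarser U) {X. refines U c X} (Suc k). spans {U} c xs}"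
                using xs by (auto simp: chain_lists_def based_def spans_def)
            qed
            show "pm_filter (spans {U} c) (lin_ext list_boundary ?zc) = 0" by (rule cyc)
            fix Cs assume Cs: "Suc k = card c" "distinct Cs" "set Cs = c - {B \<union> C}"
            have sCs: "set Cs = P - {B, C}" using Cs(3) merge_diff[OF part C(1,2)] C(3) by simp
            have "Poly_Mapping.lookup z (comb_chain B (C # Cs)) = 0"
            proof (rule less.prems(5))
              show "Suc n = card P" using card_merge[OF part C(1,2) assms(1)] C(3) Cs(1) Suc by simp
              show "distinct (C # Cs)" "set (C # Cs) = P - {B}" using Cs(2) sCs C by auto
            qed
            moreover have "insert B (insert C (set Cs)) = P" using sCs C part(2) by auto
            ultimately show "Poly_Mapping.lookup ?zc (comb_chain (B \<union> C) Cs) = 0"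
              using vanish[of "comb_chain (B \<union> C) Cs"] by simp
          qed
          then obtain y where y: "Poly_Mapping.keys y \<subseteq> {xs \<in> chain_lists (coarser U) {X. refines U c X} (Suc (Suc k)). spans {U} c xs}"
            "pm_filter (spans {U} c) (lin_ext list_boundary y) = ?zc" by blast
          then have "Poly_Mapping.keys y \<subseteq> {xs \<in> chain_lists (coarser U) ?S (Suc n). spans {U} c xs}"
            using sub Suc by (fastforce simp: chain_lists_def)
          then show ?thesis using y(2) by blast
        qed
      qed
    qed
    then show ?thesis unfolding S[symmetric] .
  qed
qed

text \<open>Deleting either of two equal neighbours gives the same face with opposite signs, and all
  other faces still contain both.\<close>

lemma list_boundary_repeat_distinct:
  assumes "distinct d"
  shows "Poly_Mapping.lookup (list_boundary (u @ a # a # v) :: 'a list \<Rightarrow>\<^sub>0 'k::comm_ring_1) d = 0"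
proof -
  have "list_boundary (a # a # v) = pm_map (\<lambda>xs. a # a # xs) (list_boundary v :: 'a list \<Rightarrow>\<^sub>0 'k)"
    by (simp add: lin_ext_simps lin_ext_lin_ext)
  then have eq: "list_boundary (u @ a # a # v) = pm_map (\<lambda>xs. xs @ a # a # v) (list_boundary u)
     + pm_scale ((- 1) ^ length u) (pm_map (\<lambda>xs. u @ a # a # xs) (list_boundary v :: 'a list \<Rightarrow>\<^sub>0 'k))"
    by (simp add: list_boundary_append lin_ext_lin_ext)
  have "Poly_Mapping.keys (list_boundary (u @ a # a # v) :: 'a list \<Rightarrow>\<^sub>0 'k) \<subseteq> {xs. \<not> distinct xs}"
    unfolding eq
    by (rule order_trans[OF keys_add], rule Un_least)
      (auto dest!: subsetD[OF keys_pm_map] subsetD[OF keys_pm_scale])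
  then show ?thesis using assms by (auto simp: in_keys_iff)
qed

text \<open>Without equal neighbours the number of blocks grows at each step, starting from at least
  one, so a chain could not have more entries than \<open>P\<close> has blocks.\<close>

lemma coarser_chain_repeats:
  assumes "finite U" "xs \<in> chain_lists (coarser U) {X. refines U P X} (Suc (card P))" "partition_on U P" "U \<noteq> {}"
  obtains u a v where "xs = u @ a # a # v"
proof -
  have step: "length xs \<le> card (last xs) \<or> (\<exists>u a v. xs = u @ a # a # v)"
    if "sorted_wrt (coarser U) xs" "xs \<noteq> []" "\<And>X. X \<in> set xs \<Longrightarrow> card X > 0" for xs
    using that
  proof (induction xs rule: rev_induct)
    case (snoc X xs)
    show ?case
    proof (cases "xs = []")
      case False
      then obtain u Y where xs: "xs = u @ [Y]" by (metis rev_exhaust)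
      have ref: "refines U X Y" using snoc.prems(1) xs by (auto simp: sorted_wrt_append coarser_def)
      consider "length xs \<le> card Y" | u a v where "xs = u @ a # a # v"
        using snoc.IH snoc.prems False xs by (auto simp: sorted_wrt_append)
      then show ?thesis
      proof cases
        case 1
        show ?thesis
        proof (cases "X = Y")
          case True then show ?thesis using xs by auto
        next
          case False
          then show ?thesis using 1 refines_card[OF ref assms(1)] by fastforce
        qed
      qed auto
    qed (use snoc.prems in \<open>auto simp: Suc_le_eq\<close>)
  qed simp
  have ne: "xs \<noteq> []" "length xs = Suc (card P)" "sorted_wrt (coarser U) xs"
    and ref: "\<And>X. X \<in> set xs \<Longrightarrow> refines U P X" using assms(2) by (auto simp: chain_lists_def)
  have "card X > 0" if "X \<in> set xs" for X
    using ref[OF that] assms(1,4) partition_on_finite[of U X] by (auto simp: refines_def card_gt_0_iff partition_on_def)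
  moreover have "card (last xs) \<le> card P" using refines_card(1)[OF ref assms(1)] ne(1) by simp
  ultimately show ?thesis using step[OF ne(3,1)] that ne(2) by fastforce
qed

section \<open>The bar construction\<close>

primrec bar :: "'a set list \<Rightarrow> ('a set list \<Rightarrow>\<^sub>0 'k::comm_ring_1)" where
  "bar [] = 0"
| "bar (B # xs) = (case xs of [] \<Rightarrow> 0 | C # ys \<Rightarrow> Poly_Mapping.single ((B \<union> C) # ys) 1) - pm_map ((#) B) (bar xs)"

text \<open>Let \<open>hm B\<close> merge \<open>B\<close> into the head of a list. Associativity of
  the union is \<open>hm_hm\<close>, and it makes \<open>hm B\<close> commute with
  \<open>bar\<close>; the two resulting copies of \<open>hm B\<close> applied to
  \<open>bar xs\<close> cancel.\<close>

lemma bar_bar: "lin_ext bar (bar xs :: 'a set list \<Rightarrow>\<^sub>0 'k::comm_ring_1) = 0"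
proof (induction xs)
  case (Cons B xs)
  define hm :: "'a set \<Rightarrow> 'a set list \<Rightarrow> ('a set list \<Rightarrow>\<^sub>0 'k)" where
    "hm B xs = (case xs of [] \<Rightarrow> 0 | C # ys \<Rightarrow> Poly_Mapping.single ((B \<union> C) # ys) 1)" for B xs
  have bar_Cons: "bar (B # xs) = hm B xs - pm_map ((#) B) (bar xs)" for B xs
    by (simp add: hm_def)
  have hm_hm: "lin_ext (hm B) (hm C xs) = hm (B \<union> C) xs" for B C xs
    by (cases xs) (auto simp: hm_def Un_assoc)
  have hm_push: "lin_ext (hm B) (pm_map ((#) C) f) = pm_map ((#) (B \<union> C)) f" for B C f
    by (simp add: lin_ext_lin_ext hm_def)
  have bar_hm: "lin_ext bar (hm B xs) = lin_ext (hm B) (bar xs)"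
  proof (cases xs)
    case (Cons C ys)
    have "lin_ext bar (hm B (C # ys)) = bar ((B \<union> C) # ys)" by (simp add: hm_def)
    then show ?thesis unfolding Cons bar_Cons by (simp only: lin_ext_simps hm_hm hm_push)
  qed (simp add: hm_def)
  have "lin_ext bar (pm_map ((#) B) f) = lin_ext (\<lambda>xs. bar (B # xs)) f" for f :: "'a set list \<Rightarrow>\<^sub>0 'k"
    by (simp only: lin_ext_lin_ext lin_ext_single pm_scale_simps)
  then have "lin_ext bar (pm_map ((#) B) f) = lin_ext (hm B) f - pm_map ((#) B) (lin_ext bar f)" for f
    unfolding bar_Cons by (simp add: lin_ext_diff_fun lin_ext_lin_ext)
  then show ?case
    unfolding bar_Cons by (simp only: lin_ext_simps bar_hm Cons) simp
qed simp

lemma bar_append_single: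
  "Poly_Mapping.keys (bar xs :: 'a set list \<Rightarrow>\<^sub>0 'k::comm_ring_1) \<subseteq> {u @ (B \<union> C) # v | u B C v. xs = u @ B # C # v}"
proof (induction xs)
  case (Cons B xs)
  have "Poly_Mapping.keys (pm_map ((#) B) (bar xs :: 'a set list \<Rightarrow>\<^sub>0 'k))
      \<subseteq> {u @ (D \<union> E) # v | u D E v. B # xs = u @ D # E # v}" (is "_ \<subseteq> ?R")
  proof (rule order_trans[OF keys_pm_map image_subsetI])
    fix ys assume "ys \<in> Poly_Mapping.keys (bar xs :: 'a set list \<Rightarrow>\<^sub>0 'k)"
    then obtain u D E v where "ys = u @ (D \<union> E) # v" "xs = u @ D # E # v" using Cons by blast
    then have "B # ys = (B # u) @ (D \<union> E) # v" "B # xs = (B # u) @ D # E # v" by auto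
    then have "\<exists>u D E v. B # ys = u @ (D \<union> E) # v \<and> B # xs = u @ D # E # v" by (intro exI conjI)
    then show "B # ys \<in> ?R" by blast
  qed
  moreover have "Poly_Mapping.keys (case xs of [] \<Rightarrow> 0 | C # ys \<Rightarrow> Poly_Mapping.single ((B \<union> C) # ys) (1::'k)) \<subseteq> ?R"
    by (cases xs) force+
  ultimately show ?case unfolding bar.simps by (intro order_trans[OF keys_diff Un_least])
qed simp

lemma bar_map_image: "bar (map ((`) w) xs) = pm_map (map ((`) w)) (bar xs)"
proof (induction xs)
  case (Cons B xs)
  have "(case map ((`) w) xs of [] \<Rightarrow> 0 | C # ys \<Rightarrow> Poly_Mapping.single ((w ` B \<union> C) # ys) 1)
      = pm_map (map ((`) w)) (case xs of [] \<Rightarrow> 0 | C # ys \<Rightarrow> Poly_Mapping.single ((B \<union> C) # ys) 1)"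
    by (cases xs) (auto simp: image_Un)
  then show ?case by (simp add: Cons lin_ext_diff lin_ext_lin_ext)
qed simp

text \<open>The recursion counts merges, since \<open>bar\<close> turns a list into a combination of
  shorter lists. After \<open>n\<close> merges a list of length \<open>Suc n\<close> has become one
  block.\<close>

primrec bar_chains :: "nat \<Rightarrow> 'a set list \<Rightarrow> ('a set set list \<Rightarrow>\<^sub>0 'k::comm_ring_1)" where
  "bar_chains 0 xs = Poly_Mapping.single [set xs] 1"
| "bar_chains (Suc n) xs = pm_map (\<lambda>c. c @ [set xs]) (lin_ext (bar_chains n) (bar xs))"

lemma bar_chains_map_image:
  "bar_chains n (map ((`) w) xs) = pm_map (map ((`) ((`) w))) (bar_chains n xs)"
proof (induction n arbitrary: xs)
  case (Suc n)
  show ?case by (simp add: bar_map_image lin_ext_lin_ext Suc)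
qed simp

definition block_lists :: "'a set \<Rightarrow> nat \<Rightarrow> 'a set list set" where
  "block_lists U n = {xs. length xs = n \<and> distinct xs \<and> partition_on U (set xs)}"

lemma bar_block_lists:
  assumes "xs \<in> block_lists U (Suc n)" "ys \<in> Poly_Mapping.keys (bar xs :: 'a set list \<Rightarrow>\<^sub>0 'k::comm_ring_1)"
  shows "ys \<in> block_lists U n" "refines U (set xs) (set ys)" "set xs \<noteq> set ys"
proof -
  obtain u B C v where ys: "ys = u @ (B \<union> C) # v" and xs: "xs = u @ B # C # v"
    using assms(2) bar_append_single by blast
  have P: "partition_on U (set xs)" and d: "distinct xs" and len: "length xs = Suc n"
    using assms(1) by (auto simp: block_lists_def)
  have BC: "B \<in> set xs" "C \<in> set xs" "C \<noteq> B" using xs d by auto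
  have eq: "set ys = merge B C (set xs)" using d unfolding xs ys merge_def by auto
  have "set xs - {B, C} = set u \<union> set v" using d unfolding xs by auto
  moreover have "B \<union> C = B" if "B \<union> C \<in> set xs"
    using partition_block_eq[OF P that BC(1)] partition_block_nonempty[OF P BC(1)] by blast
  ultimately have "B \<union> C \<notin> set u \<union> set v" by auto
  then have "distinct ys" using d unfolding xs ys by auto
  then show "ys \<in> block_lists U n"
    using merge_partition[OF P BC] len eq unfolding block_lists_def xs ys by simp
  show "refines U (set xs) (set ys)" using refines_merge[OF P BC] eq by simp
  show "set xs \<noteq> set ys"
    using distinct_card[OF d] distinct_card[OF \<open>distinct ys\<close>] xs ys by (metis length_append length_Cons add_Suc_right n_not_Suc_n)
qed

lemma bar_chains_in:
  assumes "xs \<in> block_lists U (Suc n)"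
  shows "Poly_Mapping.keys (bar_chains n xs :: 'a set set list \<Rightarrow>\<^sub>0 'k::comm_ring_1)
     \<subseteq> {c \<in> chain_lists (coarser U) {X. refines U (set xs) X} (Suc n). spans {U} (set xs) c}"
  using assms
proof (induction n arbitrary: xs)
  case 0
  then obtain B where "xs = [B]" "partition_on U {B}" by (auto simp: block_lists_def length_Suc_conv)
  moreover then have "B = U" by (auto simp: partition_on_def)
  ultimately show ?case by (auto simp: chain_lists_def spans_def refines_refl split: if_splits)
next
  case (Suc n)
  have P: "partition_on U (set xs)" using Suc.prems by (simp add: block_lists_def)
  have "Poly_Mapping.keys (lin_ext (bar_chains n) (bar xs) :: 'a set set list \<Rightarrow>\<^sub>0 'k)
      \<subseteq> {c \<in> chain_lists (coarser U) {X. refines U (set xs) X} (Suc n). based {U} c}"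
  proof (rule order_trans[OF keys_lin_ext UN_least])
    fix ys assume "ys \<in> Poly_Mapping.keys (bar xs :: 'a set list \<Rightarrow>\<^sub>0 'k)"
    note ys = bar_block_lists[OF Suc.prems this]
    show "Poly_Mapping.keys (bar_chains n ys :: 'a set set list \<Rightarrow>\<^sub>0 'k)
      \<subseteq> {c \<in> chain_lists (coarser U) {X. refines U (set xs) X} (Suc n). based {U} c}"
      using Suc.IH[OF ys(1)] refines_trans[OF ys(2)] by (fastforce simp: chain_lists_def based_def spans_def)
  qed
  moreover have "coarser U (set xs) (set xs)" "\<And>X. refines U (set xs) X \<Longrightarrow> coarser U X (set xs)"
    using refines_refl[OF P] by (auto simp: coarser_def)
  ultimately show ?case
    using refines_refl[OF P]
    by (auto simp: chain_lists_def spans_def based_def sorted_wrt_append subset_iff dest!: subsetD[OF keys_pm_map])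
qed

text \<open>Omitting an intermediate partition sums over two successive merges, which vanishes by
  \<open>bar_bar\<close>. Only the omission of the top remains. Leaving the upper end free is what
  lets the induction pass to the chains of \<open>bar xs\<close>.\<close>

lemma based_boundary_bar_chains:
  assumes "xs \<in> block_lists U (Suc n)"
  shows "pm_filter (based {U}) (lin_ext list_boundary (bar_chains n xs))
     = (case n of 0 \<Rightarrow> 0 | Suc k \<Rightarrow> pm_scale ((- 1) ^ n) (lin_ext (bar_chains k) (bar xs :: 'a set list \<Rightarrow>\<^sub>0 'k::comm_ring_1)))"
  using assms
proof (induction n arbitrary: xs)
  case 0
  then show ?case by (simp add: based_def pm_filter_single)
next
  case (Suc n)
  let ?g = "lin_ext (bar_chains n) (bar xs :: 'a set list \<Rightarrow>\<^sub>0 'k)"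
  have g: "Poly_Mapping.keys ?g \<subseteq> {c. length c = Suc n \<and> based {U} c}"
  proof (rule order_trans[OF keys_lin_ext UN_least])
    fix ys assume "ys \<in> Poly_Mapping.keys (bar xs :: 'a set list \<Rightarrow>\<^sub>0 'k)"
    then have "ys \<in> block_lists U (Suc n)" using bar_block_lists Suc.prems by blast
    from bar_chains_in[OF this] show "Poly_Mapping.keys (bar_chains n ys :: 'a set set list \<Rightarrow>\<^sub>0 'k)
      \<subseteq> {c. length c = Suc n \<and> based {U} c}" by (auto simp: chain_lists_def spans_def based_def)
  qed
  have snoc: "lin_ext list_boundary (pm_map (\<lambda>c. c @ [set xs]) f) =
      pm_map (\<lambda>c. c @ [set xs]) (lin_ext list_boundary f) + pm_scale ((- 1) ^ Suc n) f"
    if "Poly_Mapping.keys f \<subseteq> {c. length c = Suc n \<and> based {U} c}" for f :: "'a set set list \<Rightarrow>\<^sub>0 'k"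
    by (rule pm_linear_eqI[where f = f])
      (use that in \<open>auto intro!: pm_linear_intros simp: list_boundary_snoc\<close>)
  have zero: "pm_filter (based {U}) (lin_ext list_boundary ?g) = 0"
  proof -
    have "pm_filter (based {U}) (lin_ext list_boundary ?g)
        = lin_ext (\<lambda>ys. pm_filter (based {U}) (lin_ext list_boundary (bar_chains n ys))) (bar xs)"
      by (simp add: lin_ext_lin_ext pm_linear_apply_lin_ext)
    also have "\<dots> = lin_ext (\<lambda>ys. case n of 0 \<Rightarrow> 0 | Suc k \<Rightarrow> pm_scale ((- 1) ^ n) (lin_ext (bar_chains k) (bar ys))) (bar xs)"
      using Suc.IH bar_block_lists(1)[OF Suc.prems] by (intro lin_ext_cong) auto
    also have "\<dots> = (case n of 0 \<Rightarrow> 0 | Suc k \<Rightarrow> pm_scale ((- 1) ^ n) (lin_ext (bar_chains k) (lin_ext bar (bar xs))))"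
      by (cases n) (simp_all add: lin_ext_lin_ext lin_ext_scale_fun)
    finally show ?thesis by (simp add: bar_bar split: nat.splits)
  qed
  have "pm_filter (based {U}) (pm_map (\<lambda>c. c @ [set xs]) (lin_ext list_boundary ?g))
      = pm_map (\<lambda>c. c @ [set xs]) (pm_filter (based {U}) (lin_ext list_boundary ?g))"
    unfolding pm_filter_pm_map
  proof (intro arg_cong[where f = "pm_map _"] pm_filter_cong refl)
    fix ys
    show "based {U} (ys @ [set xs]) = based {U} ys"
    proof (cases "ys = []")
      case True
      \<comment> \<open>At least two blocks are present, so the appended top alone is not mistaken
        for a chain starting at the one-block partition.\<close>
      have "card (set xs) = Suc (Suc n)" using Suc.prems distinct_card[of xs] by (auto simp: block_lists_def)
      then have "set xs \<noteq> {U}" by auto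
      then show ?thesis using True by (simp add: based_def)
    qed (simp add: based_def)
  qed
  moreover have "pm_filter (based {U}) ?g = ?g" using g by (intro pm_filter_id) auto
  ultimately show ?case unfolding bar_chains.simps snoc[OF g] by (simp add: zero pm_filter_simps)
qed

text \<open>The one face left by \<open>based_boundary_bar_chains\<close> ends in a strictly coarser
  partition and is dropped.\<close>

lemma spans_boundary_bar_chains:
  assumes "xs \<in> block_lists U (Suc n)"
  shows "pm_filter (spans {U} (set xs)) (lin_ext list_boundary (bar_chains n xs :: 'a set set list \<Rightarrow>\<^sub>0 'k::comm_ring_1)) = 0"
proof -
  have "pm_filter (spans {U} (set xs)) (lin_ext list_boundary (bar_chains n xs :: 'a set set list \<Rightarrow>\<^sub>0 'k))
     = pm_filter (spans {U} (set xs)) (pm_filter (based {U}) (lin_ext list_boundary (bar_chains n xs)))"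
    unfolding pm_filter_filter by (rule pm_filter_cong) (auto simp: spans_def based_def)
  also have "\<dots> = 0"
    unfolding based_boundary_bar_chains[OF assms]
  proof (cases n)
    case (Suc k)
    have "pm_filter (spans {U} (set xs)) (lin_ext (bar_chains k) (bar xs :: 'a set list \<Rightarrow>\<^sub>0 'k)) = 0"
    proof (rule pm_filter_none)
      fix c assume "c \<in> Poly_Mapping.keys (lin_ext (bar_chains k) (bar xs :: 'a set list \<Rightarrow>\<^sub>0 'k))"
      then obtain ys where ys: "ys \<in> Poly_Mapping.keys (bar xs :: 'a set list \<Rightarrow>\<^sub>0 'k)"
          "c \<in> Poly_Mapping.keys (bar_chains k ys :: 'a set set list \<Rightarrow>\<^sub>0 'k)" by (rule keys_lin_extE)
      note b = bar_block_lists[OF assms ys(1)]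
      then have "spans {U} (set ys) c" using bar_chains_in[of ys U k] Suc ys(2) by blast
      then show "\<not> spans {U} (set xs) c" using b(3) by (auto simp: spans_def)
    qed
    then show "pm_filter (spans {U} (set xs)) (case n of 0 \<Rightarrow> 0 | Suc k \<Rightarrow> pm_scale ((- 1) ^ n) (lin_ext (bar_chains k) (bar xs :: 'a set list \<Rightarrow>\<^sub>0 'k))) = 0"
      using Suc by (simp add: pm_filter_simps)
  qed simp
  finally show ?thesis .
qed

section \<open>Coefficients of comb chains\<close>

lemma comb_chain_coarser:
  assumes "finite U" "partition_on U P" "B \<in> P" "distinct Cs" "set Cs = P - {B}"
  shows "distinct (comb_chain B Cs) \<and> (\<forall>X\<in>set (comb_chain B Cs). refines U P X)"
  using assms(2-)
proof (induction Cs arbitrary: B P)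
  case Nil
  then have "P = {B}" by auto
  then show ?case using Nil by (auto simp: refines_refl)
next
  case (Cons C Cs)
  have C: "C \<in> P" "C \<noteq> B" using Cons.prems(4) by auto
  note m = Cons.prems(1,2) C
  have "set Cs = P - {B, C}" using Cons.prems(3,4) by auto
  then have Cs: "set Cs = merge B C P - {B \<union> C}" using merge_diff[OF m] by simp
  have IH: "distinct (comb_chain (B \<union> C) Cs) \<and> (\<forall>X\<in>set (comb_chain (B \<union> C) Cs). refines U (merge B C P) X)"
    using Cons.IH[OF merge_partition[OF m] merge_block[OF m] _ Cs] Cons.prems(3) by simp
  have "\<not> refines U (merge B C P) P"
    using refines_asym[OF refines_merge[OF m]] card_merge[OF m assms(1)] by auto
  moreover have "insert B (insert C (set Cs)) = P" using Cons.prems(2,4) by auto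
  ultimately show ?case
    using IH refines_trans[OF refines_merge[OF m]] refines_refl[OF Cons.prems(1)] by auto
qed

text \<open>A chain one step longer than a maximal one has equal neighbours, whereas comb chains are
  distinct. Coefficients at comb chains are thus invariants of homology classes in the top
  degree.\<close>

lemma boundary_vanishes_on_comb_chain:
  assumes "finite U" "U \<noteq> {}" "partition_on U P" "B \<in> P" "distinct Cs" "set Cs = P - {B}"
    and "Poly_Mapping.keys y \<subseteq> chain_lists (coarser U) {X. refines U P X} (Suc (card P))"
  shows "Poly_Mapping.lookup (lin_ext list_boundary (y :: _ \<Rightarrow>\<^sub>0 'k::comm_ring_1)) (comb_chain B Cs) = 0"
  unfolding lookup_lin_ext
proof (rule sum.neutral, rule ballI)
  fix xs assume "xs \<in> Poly_Mapping.keys y"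
  then obtain u a v where xs: "xs = u @ a # a # v"
    using coarser_chain_repeats[OF assms(1) _ assms(3,2)] assms(7) by blast
  have "Poly_Mapping.lookup (list_boundary xs :: _ \<Rightarrow>\<^sub>0 'k) (comb_chain B Cs) = 0"
    unfolding xs using comb_chain_coarser[OF assms(1,3-6)] by (intro list_boundary_repeat_distinct) blast
  then show "Poly_Mapping.lookup y xs * Poly_Mapping.lookup (list_boundary xs) (comb_chain B Cs) = 0"
    by simp
qed

text \<open>If \<open>val\<close> ignores all lists that still contain \<open>B\<close>, only the
  merges of \<open>B\<close> with its left and right neighbour count.\<close>

lemma pm_eval_bar_middle:
  fixes val :: "'a set list \<Rightarrow> 'k::comm_ring_1"
  assumes "\<And>ys. B \<in> set ys \<Longrightarrow> val ys = 0"
  shows "pm_eval val (bar (xs @ B # ys)) =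
    (if xs = [] then 0 else (- 1) ^ length (butlast xs) * val (butlast xs @ (last xs \<union> B) # ys)) +
    (case ys of [] \<Rightarrow> 0 | D # zs \<Rightarrow> (- 1) ^ length xs * val (xs @ (B \<union> D) # zs))"
  using assms
proof (induction xs arbitrary: val)
  case Nil
  have "pm_eval val (pm_map ((#) B) f) = 0" for f
    using Nil.prems by (simp add: pm_eval_lin_ext) (simp add: pm_eval_def)
  then show ?case by (cases ys) (auto simp: pm_eval_diff simp del: bar.simps(2)[of _ "_ # _"])
next
  case (Cons x xs)
  have push: "pm_eval val (pm_map ((#) x) f) = pm_eval (\<lambda>y. val (x # y)) f" for f
    by (simp add: pm_eval_lin_ext)
  have IH: "pm_eval (\<lambda>y. val (x # y)) (bar (xs @ B # ys)) =
    (if xs = [] then 0 else (- 1) ^ length (butlast xs) * val (x # butlast xs @ (last xs \<union> B) # ys)) +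
    (case ys of [] \<Rightarrow> 0 | D # zs \<Rightarrow> (- 1) ^ length xs * val (x # xs @ (B \<union> D) # zs))"
    using Cons.IH[of "\<lambda>y. val (x # y)"] Cons.prems by simp
  have 1: "bar ((x # xs) @ B # ys) = (case xs @ B # ys of [] \<Rightarrow> 0 | C # zs \<Rightarrow> Poly_Mapping.single ((x \<union> C) # zs) 1)
      - pm_map ((#) x) (bar (xs @ B # ys))" by simp
  have 2: "pm_eval val (case xs @ B # ys of [] \<Rightarrow> 0 | C # zs \<Rightarrow> Poly_Mapping.single ((x \<union> C) # zs) 1)
      = (if xs = [] then val ((x \<union> B) # ys) else 0)"
    using Cons.prems by (cases xs) auto
  show ?case unfolding 1 pm_eval_diff push IH 2
    by (cases ys; cases xs) (auto simp del: butlast.simps simp: butlast.simps(2))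
qed

text \<open>
  The coefficient of the word \<open>rev us @ x # vs\<close> in the left-normed bracket of \<open>x\<close> with the letters
  of \<open>cs\<close>: the letters to the left of \<open>x\<close> are listed from right to left, so that each letter of \<open>cs\<close>
  is removed from the head of \<open>us\<close> or of \<open>vs\<close>.
\<close>

primrec comb_coeff :: "'a list \<Rightarrow> 'a list \<Rightarrow> 'a list \<Rightarrow> 'k::comm_ring_1" where
  "comb_coeff us vs [] = (if us = [] \<and> vs = [] then 1 else 0)"
| "comb_coeff us vs (c # cs) =
     (case vs of [] \<Rightarrow> 0 | v # vs' \<Rightarrow> if v = c then comb_coeff us vs' cs else 0)
     - (case us of [] \<Rightarrow> 0 | u # us' \<Rightarrow> if u = c then comb_coeff us' vs cs else 0)"

lemma last_bar_chains:
  "c \<in> Poly_Mapping.keys (bar_chains n xs :: _ \<Rightarrow>\<^sub>0 'k::comm_ring_1) \<Longrightarrow> last c = set xs"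
  by (cases n) (auto dest!: subsetD[OF keys_pm_map] split: if_splits)

lemma lookup_snoc: "Poly_Mapping.lookup (pm_map (\<lambda>c. c @ [x]) f) (c @ [x]) = Poly_Mapping.lookup f c"
  by (rule lookup_pm_map_inj[of "\<lambda>c. c @ [x]"]) (simp add: inj_on_def)

section \<open>Signs of words and coefficients of bar cycles at comb chains\<close>

context
  fixes sg :: "'a list \<Rightarrow> 'k::comm_ring_1" and A :: "'a set"
  assumes sg_swap: "\<And>u a b v. distinct (u @ a # b # v) \<Longrightarrow> set (u @ a # b # v) = A \<Longrightarrow> sg (u @ a # b # v) = - sg (u @ b # a # v)"
    and sg_square: "\<And>u. distinct u \<Longrightarrow> set u = A \<Longrightarrow> sg u * sg u = 1"
begin

lemma sg_move:
  assumes "distinct (u @ xs @ c # v)" "set (u @ xs @ c # v) = A"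
  shows "sg (u @ xs @ c # v) = (- 1) ^ length xs * sg (u @ c # xs @ v)"
  using assms
proof (induction xs arbitrary: u)
  case (Cons x xs)
  have "sg ((u @ [x]) @ xs @ c # v) = (- 1) ^ length xs * sg ((u @ [x]) @ c # xs @ v)"
    using Cons.prems by (intro Cons.IH) auto
  also have "sg ((u @ [x]) @ c # xs @ v) = - sg (u @ c # x # xs @ v)"
    using sg_swap[of u x c "xs @ v"] Cons.prems by auto
  finally show ?case by simp
qed simp

text \<open>The induction needs a block that has already absorbed the letters of \<open>bs\<close>.
  If the next letter comes from the right, the exponent changes by \<open>length us\<close>, which
  is the sign of this merge in \<open>bar\<close>. If it comes from the left, it must also pass
  \<open>bs\<close>, and the parities leave one factor \<open>- 1\<close>: the minus sign in the
  commutator.\<close>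

lemma lookup_bar_chains_comb_chain:
  assumes "distinct (rev us @ bs @ vs)" "set (rev us @ bs @ vs) = A" "bs \<noteq> []"
    and "distinct cs" "set cs = set us \<union> set vs"
  shows "Poly_Mapping.lookup (bar_chains (length cs) (map (\<lambda>x. {x}) (rev us) @ set bs # map (\<lambda>x. {x}) vs))
      (comb_chain (set bs) (map (\<lambda>x. {x}) cs))
    = sg (rev us @ bs @ vs) * sg (bs @ cs) * (- 1) ^ (length us * Suc (length bs)) * comb_coeff us vs cs"
  using assms
proof (induction cs arbitrary: us bs vs)
  case Nil
  then show ?case using sg_square[of bs] by simp
next
  case (Cons c cs)
  let ?s = "map (\<lambda>x. {x}) :: 'a list \<Rightarrow> _"
  let ?v = "comb_chain (set bs \<union> {c}) (?s cs)"
  define val :: "'a set list \<Rightarrow> 'k" where "val ys = Poly_Mapping.lookup (bar_chains (length cs) ys) ?v" for ys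
  \<comment> \<open>A chain ends in the partition it was built from, so a nonzero value determines
    the set of blocks.\<close>
  have val_ne: "set ys = insert (set bs \<union> {c}) ((\<lambda>x. {x}) ` set cs)" if "val ys \<noteq> 0" for ys
  proof -
    have "?v \<in> Poly_Mapping.keys (bar_chains (length cs) ys :: _ \<Rightarrow>\<^sub>0 'k)"
      using that by (simp add: val_def in_keys_iff)
    from last_bar_chains[OF this] show ?thesis by (simp add: last_comb_chain)
  qed
  have c: "c \<notin> set bs" "c \<notin> set cs" "set bs \<inter> set cs = {}"
    using Cons.prems by auto
  have block: "X = set bs \<union> {c}" if "val ys \<noteq> 0" "X \<in> set ys" "x \<in> X" "x \<in> set bs" for X x ys
    using val_ne[OF that(1)] that(2-) c by auto
  obtain b where b: "b \<in> set bs" using Cons.prems(3) by (cases bs) auto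
  have val0: "val ys = 0" if "set bs \<in> set ys" for ys
    using block[of ys "set bs" b] that b c(1) by auto
  have val1: "val (xs @ (set bs \<union> {q}) # ys) = 0" if "q \<noteq> c" "q \<notin> set bs" for xs ys q
    using block[of "xs @ (set bs \<union> {q}) # ys" "set bs \<union> {q}" b] that b c(1) by auto
  have last: "set (?s (rev us) @ set bs # ?s vs) = insert (set bs) (insert {c} (set (?s cs)))"
    using Cons.prems(5) by auto
  have "Poly_Mapping.lookup (bar_chains (length (c # cs)) (?s (rev us) @ set bs # ?s vs))
      (comb_chain (set bs) (?s (c # cs))) = pm_eval val (bar (?s (rev us) @ set bs # ?s vs))"
    by (simp only: list.size add_Suc_right add_0_right bar_chains.simps comb_chain.simps list.map last lookup_snoc)
      (simp only: lookup_lin_ext_eval val_def[abs_def])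
  also have "\<dots> = (if us = [] then 0 else (- 1) ^ length (tl us) * val (?s (rev (tl us)) @ (set bs \<union> {hd us}) # ?s vs)) +
    (case vs of [] \<Rightarrow> 0 | v # ws \<Rightarrow> (- 1) ^ length us * val (?s (rev us) @ (set bs \<union> {v}) # ?s ws))"
    by (subst pm_eval_bar_middle[OF val0]) (cases us; cases vs; auto simp: Un_commute butlast_append)+
  finally have eval: "Poly_Mapping.lookup (bar_chains (length (c # cs)) (?s (rev us) @ set bs # ?s vs))
      (comb_chain (set bs) (?s (c # cs))) = (if us = [] then 0 else (- 1) ^ length (tl us) * val (?s (rev (tl us)) @ (set bs \<union> {hd us}) # ?s vs)) +
    (case vs of [] \<Rightarrow> 0 | v # ws \<Rightarrow> (- 1) ^ length us * val (?s (rev us) @ (set bs \<union> {v}) # ?s ws))" .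
  have 1: "(if us = [] then 0 else (- 1) ^ length (tl us) * val (?s (rev (tl us)) @ (set bs \<union> {hd us}) # ?s vs))
     = sg (rev us @ bs @ vs) * sg (bs @ c # cs) * (- 1) ^ (length us * Suc (length bs)) *
       - (case us of [] \<Rightarrow> 0 | u # us' \<Rightarrow> if u = c then comb_coeff us' vs cs else 0)"
  proof (cases us)
    case (Cons u us')
    show ?thesis
    proof (cases "u = c")
      case True
      have "insert c (set cs) = insert c (set us' \<union> set vs)" "c \<notin> set us' \<union> set vs"
        using Cons.prems Cons True by auto
      then have cs: "set cs = set us' \<union> set vs" using c(2) by (metis insert_ident)
      have "val (?s (rev us') @ set (bs @ [c]) # ?s vs) = sg (rev us' @ (bs @ [c]) @ vs) * sg ((bs @ [c]) @ cs) *
          (- 1) ^ (length us' * Suc (length (bs @ [c]))) * comb_coeff us' vs cs"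
        unfolding val_def using Cons.IH[of us' "bs @ [c]" vs] Cons.prems Cons True cs by auto
      \<comment> \<open>The letter stood to the left of the block but is stored at the right end of
        \<open>bs\<close>, so it has to be moved across \<open>bs\<close>.\<close>
      moreover have "sg (rev us' @ bs @ c # vs) = (- 1) ^ length bs * sg (rev us' @ c # bs @ vs)"
        using Cons.prems Cons True by (intro sg_move) auto
      ultimately show ?thesis using Cons True
        by (auto simp: minus_one_power_iff)
    next
      case False
      then show ?thesis using val1[of u] Cons Cons.prems by auto
    qed
  qed simp
  have 2: "(case vs of [] \<Rightarrow> 0 | v # ws \<Rightarrow> (- 1) ^ length us * val (?s (rev us) @ (set bs \<union> {v}) # ?s ws))
     = sg (rev us @ bs @ vs) * sg (bs @ c # cs) * (- 1) ^ (length us * Suc (length bs)) *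
       (case vs of [] \<Rightarrow> 0 | v # vs' \<Rightarrow> if v = c then comb_coeff us vs' cs else 0)"
  proof (cases vs)
    case (Cons v vs')
    show ?thesis
    proof (cases "v = c")
      case True
      have "insert c (set cs) = insert c (set us \<union> set vs')" "c \<notin> set us \<union> set vs'"
        using Cons.prems Cons True by auto
      then have cs: "set cs = set us \<union> set vs'" using c(2) by (metis insert_ident)
      have "val (?s (rev us) @ set (bs @ [c]) # ?s vs') = sg (rev us @ (bs @ [c]) @ vs') * sg ((bs @ [c]) @ cs) *
          (- 1) ^ (length us * Suc (length (bs @ [c]))) * comb_coeff us vs' cs"
        unfolding val_def using Cons.IH[of us "bs @ [c]" vs'] Cons.prems Cons True cs by auto
      then show ?thesis using Cons True
        by (auto simp: minus_one_power_iff)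
    next
      case False
      then show ?thesis using val1[of v] Cons Cons.prems by auto
    qed
  qed simp
  show ?case unfolding eval 1 2 by (simp only: comb_coeff.simps) (simp add: algebra_simps)
qed

end

section \<open>Modules with a group action\<close>

lemma type_ring_simps [simp]:
  "carrier type_ring = UNIV" "x \<otimes>\<^bsub>type_ring\<^esub> y = x * y" "x \<oplus>\<^bsub>type_ring\<^esub> y = x + y"
  "\<one>\<^bsub>type_ring\<^esub> = 1" "\<zero>\<^bsub>type_ring\<^esub> = 0"
  by (simp_all add: type_ring_def)

lemma cring_type_ring: "cring (type_ring :: 'k::comm_ring_1 ring)"
proof (rule cringI)
  show "abelian_group (type_ring :: 'k ring)"
    by (rule abelian_groupI) (auto simp: add.assoc add.commute intro: exI[of _ "- x" for x])
  show "Group.comm_monoid (type_ring :: 'k ring)"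
    by (rule comm_monoidI) (auto simp: mult.assoc mult.commute)
qed (simp add: algebra_simps)

lemma is_gmoduleI:
  assumes "abelian_group M" "group G"
    and "\<And>c x. x \<in> carrier M \<Longrightarrow> c \<odot>\<^bsub>M\<^esub> x \<in> carrier M"
    and "\<And>c d x. x \<in> carrier M \<Longrightarrow> (c + d) \<odot>\<^bsub>M\<^esub> x = c \<odot>\<^bsub>M\<^esub> x \<oplus>\<^bsub>M\<^esub> d \<odot>\<^bsub>M\<^esub> x"
    and "\<And>c x y. x \<in> carrier M \<Longrightarrow> y \<in> carrier M \<Longrightarrow> c \<odot>\<^bsub>M\<^esub> (x \<oplus>\<^bsub>M\<^esub> y) = c \<odot>\<^bsub>M\<^esub> x \<oplus>\<^bsub>M\<^esub> c \<odot>\<^bsub>M\<^esub> y"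
    and "\<And>c d x. x \<in> carrier M \<Longrightarrow> (c * d) \<odot>\<^bsub>M\<^esub> x = c \<odot>\<^bsub>M\<^esub> (d \<odot>\<^bsub>M\<^esub> x)"
    and "\<And>x. x \<in> carrier M \<Longrightarrow> 1 \<odot>\<^bsub>M\<^esub> x = x"
    and "\<And>g x. g \<in> carrier G \<Longrightarrow> x \<in> carrier M \<Longrightarrow> act M g x \<in> carrier M"
    and "\<And>g x y. g \<in> carrier G \<Longrightarrow> x \<in> carrier M \<Longrightarrow> y \<in> carrier M \<Longrightarrow> act M g (x \<oplus>\<^bsub>M\<^esub> y) = act M g x \<oplus>\<^bsub>M\<^esub> act M g y"
    and "\<And>g c x. g \<in> carrier G \<Longrightarrow> x \<in> carrier M \<Longrightarrow> act M g (c \<odot>\<^bsub>M\<^esub> x) = c \<odot>\<^bsub>M\<^esub> act M g x"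
    and "\<And>x. x \<in> carrier M \<Longrightarrow> act M \<one>\<^bsub>G\<^esub> x = x"
    and "\<And>g h x. g \<in> carrier G \<Longrightarrow> h \<in> carrier G \<Longrightarrow> x \<in> carrier M \<Longrightarrow> act M (g \<otimes>\<^bsub>G\<^esub> h) x = act M g (act M h x)"
  shows "is_gmodule (type_ring :: 'k::comm_ring_1 ring) G M"
  unfolding is_gmodule_def using assms by (auto intro!: moduleI cring_type_ring)

lemma is_gmoduleD:
  assumes "is_gmodule (type_ring :: 'k::comm_ring_1 ring) G M"
  shows "module type_ring M" "abelian_group M" "group G"
    and "\<And>c x. x \<in> carrier M \<Longrightarrow> c \<odot>\<^bsub>M\<^esub> x \<in> carrier M"
    and "\<And>c d x. x \<in> carrier M \<Longrightarrow> (c + d) \<odot>\<^bsub>M\<^esub> x = c \<odot>\<^bsub>M\<^esub> x \<oplus>\<^bsub>M\<^esub> d \<odot>\<^bsub>M\<^esub> x"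
    and "\<And>c x y. x \<in> carrier M \<Longrightarrow> y \<in> carrier M \<Longrightarrow> c \<odot>\<^bsub>M\<^esub> (x \<oplus>\<^bsub>M\<^esub> y) = c \<odot>\<^bsub>M\<^esub> x \<oplus>\<^bsub>M\<^esub> c \<odot>\<^bsub>M\<^esub> y"
    and "\<And>c d x. x \<in> carrier M \<Longrightarrow> (c * d) \<odot>\<^bsub>M\<^esub> x = c \<odot>\<^bsub>M\<^esub> (d \<odot>\<^bsub>M\<^esub> x)"
    and "\<And>x. x \<in> carrier M \<Longrightarrow> 1 \<odot>\<^bsub>M\<^esub> x = x"
    and "\<And>g x. g \<in> carrier G \<Longrightarrow> x \<in> carrier M \<Longrightarrow> act M g x \<in> carrier M"
    and "\<And>g x y. g \<in> carrier G \<Longrightarrow> x \<in> carrier M \<Longrightarrow> y \<in> carrier M \<Longrightarrow> act M g (x \<oplus>\<^bsub>M\<^esub> y) = act M g x \<oplus>\<^bsub>M\<^esub> act M g y"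
    and "\<And>g c x. g \<in> carrier G \<Longrightarrow> x \<in> carrier M \<Longrightarrow> act M g (c \<odot>\<^bsub>M\<^esub> x) = c \<odot>\<^bsub>M\<^esub> act M g x"
    and "\<And>x. x \<in> carrier M \<Longrightarrow> act M \<one>\<^bsub>G\<^esub> x = x"
    and "\<And>g h x. g \<in> carrier G \<Longrightarrow> h \<in> carrier G \<Longrightarrow> x \<in> carrier M \<Longrightarrow> act M (g \<otimes>\<^bsub>G\<^esub> h) x = act M g (act M h x)"
proof -
  show m: "module type_ring M" using assms by (simp add: is_gmodule_def)
  then show "abelian_group M" by (simp add: module_def)
  show "\<And>c x. x \<in> carrier M \<Longrightarrow> c \<odot>\<^bsub>M\<^esub> x \<in> carrier M"
    and "\<And>c d x. x \<in> carrier M \<Longrightarrow> (c + d) \<odot>\<^bsub>M\<^esub> x = c \<odot>\<^bsub>M\<^esub> x \<oplus>\<^bsub>M\<^esub> d \<odot>\<^bsub>M\<^esub> x"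
    and "\<And>c x y. x \<in> carrier M \<Longrightarrow> y \<in> carrier M \<Longrightarrow> c \<odot>\<^bsub>M\<^esub> (x \<oplus>\<^bsub>M\<^esub> y) = c \<odot>\<^bsub>M\<^esub> x \<oplus>\<^bsub>M\<^esub> c \<odot>\<^bsub>M\<^esub> y"
    and "\<And>c d x. x \<in> carrier M \<Longrightarrow> (c * d) \<odot>\<^bsub>M\<^esub> x = c \<odot>\<^bsub>M\<^esub> (d \<odot>\<^bsub>M\<^esub> x)"
    and "\<And>x. x \<in> carrier M \<Longrightarrow> 1 \<odot>\<^bsub>M\<^esub> x = x"
    using m module.smult_closed[OF m] module.smult_l_distr[OF m] module.smult_r_distr[OF m]
      module.smult_assoc1[OF m] module.smult_one[OF m] by auto
qed (use assms in \<open>auto simp: is_gmodule_def\<close>)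

text \<open>The axioms are equational and pass to images. This provides the module structure on
  quotients and on both sides of the final isomorphism.\<close>

lemma is_gmodule_surj_image:
  fixes M :: "('k::comm_ring_1, 'm, 'g) gmodule"
  assumes M: "is_gmodule (type_ring :: 'k ring) G M"
    and q: "\<phi> \<in> gmodule_hom (type_ring :: 'k ring) G M Q" and surj: "\<phi> ` carrier M = carrier Q" and zero: "\<phi> \<zero>\<^bsub>M\<^esub> = \<zero>\<^bsub>Q\<^esub>"
  shows "is_gmodule (type_ring :: 'k ring) G Q"
proof -
  note D = is_gmoduleD[OF M]
  interpret M: abelian_group M by (rule D(2))
  interpret G: group G by (rule D(3))
  have q: "\<And>x. x \<in> carrier M \<Longrightarrow> \<phi> x \<in> carrier Q"
     "\<And>x y. x \<in> carrier M \<Longrightarrow> y \<in> carrier M \<Longrightarrow> \<phi> x \<oplus>\<^bsub>Q\<^esub> \<phi> y = \<phi> (x \<oplus>\<^bsub>M\<^esub> y)"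
     "\<And>c x. x \<in> carrier M \<Longrightarrow> c \<odot>\<^bsub>Q\<^esub> \<phi> x = \<phi> (c \<odot>\<^bsub>M\<^esub> x)"
     "\<And>g x. g \<in> carrier G \<Longrightarrow> x \<in> carrier M \<Longrightarrow> act Q g (\<phi> x) = \<phi> (act M g x)"
    using q by (auto simp: gmodule_hom_def)
  note q' = q zero[symmetric] D(4-)
  have c: "x \<in> carrier Q \<Longrightarrow> \<exists>y\<in>carrier M. x = \<phi> y" for x using surj by auto
  show ?thesis
  proof (rule is_gmoduleI)
    show "abelian_group Q"
    proof (rule abelian_groupI)
      fix x assume "x \<in> carrier Q"
      then obtain a where a: "a \<in> carrier M" "x = \<phi> a" using c by blast
      then have "\<phi> (\<ominus>\<^bsub>M\<^esub> a) \<in> carrier Q" "\<phi> (\<ominus>\<^bsub>M\<^esub> a) \<oplus>\<^bsub>Q\<^esub> x = \<zero>\<^bsub>Q\<^esub>"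
        using q' by (auto simp: M.l_neg)
      then show "\<exists>y\<in>carrier Q. y \<oplus>\<^bsub>Q\<^esub> x = \<zero>\<^bsub>Q\<^esub>" by blast
    qed (use q' in \<open>auto dest!: c simp: M.a_assoc intro!: M.a_comm arg_cong[where f = \<phi>]\<close>)
    show "group G" by (rule D(3))
  qed (use q' in \<open>auto dest!: c\<close>)
qed

text \<open>The isomorphism sends \<open>\<phi> x\<close> to \<open>\<psi> x\<close>; the equality
  of the kernels makes it well defined and injective.\<close>

lemma gmodule_iso_of_surjections:
  fixes F :: "('k::comm_ring_1, 'm, 'g) gmodule"
  assumes F: "is_gmodule (type_ring :: 'k ring) G F"
    and \<phi>: "\<phi> \<in> gmodule_hom (type_ring :: 'k ring) G F M" "\<phi> ` carrier F = carrier M" "\<phi> \<zero>\<^bsub>F\<^esub> = \<zero>\<^bsub>M\<^esub>"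
    and \<psi>: "\<psi> \<in> gmodule_hom (type_ring :: 'k ring) G F N" "\<psi> ` carrier F = carrier N" "\<psi> \<zero>\<^bsub>F\<^esub> = \<zero>\<^bsub>N\<^esub>"
    and eq: "\<And>x y. x \<in> carrier F \<Longrightarrow> y \<in> carrier F \<Longrightarrow> \<phi> x = \<phi> y \<longleftrightarrow> \<psi> x = \<psi> y"
  shows "gmodule_iso (type_ring :: 'k ring) G M N"
proof -
  define \<theta> where "\<theta> m = \<psi> (inv_into (carrier F) \<phi> m)" for m
  have \<theta>: "\<theta> (\<phi> x) = \<psi> x" if "x \<in> carrier F" for x
    unfolding \<theta>_def using eq[of "inv_into (carrier F) \<phi> (\<phi> x)" x] that
    by (simp add: inv_into_into f_inv_into_f)
  have c: "m \<in> carrier M \<Longrightarrow> \<exists>x\<in>carrier F. m = \<phi> x" for m using \<phi>(2) by auto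
  note D = is_gmoduleD(4,9)[OF F] abelian_groupE(1)[OF is_gmoduleD(2)[OF F]]
  have \<phi>': "\<And>x y. x \<in> carrier F \<Longrightarrow> y \<in> carrier F \<Longrightarrow> \<phi> x \<oplus>\<^bsub>M\<^esub> \<phi> y = \<phi> (x \<oplus>\<^bsub>F\<^esub> y)"
     "\<And>c x. x \<in> carrier F \<Longrightarrow> c \<odot>\<^bsub>M\<^esub> \<phi> x = \<phi> (c \<odot>\<^bsub>F\<^esub> x)"
     "\<And>g x. g \<in> carrier G \<Longrightarrow> x \<in> carrier F \<Longrightarrow> act M g (\<phi> x) = \<phi> (act F g x)"
    using \<phi>(1) by (auto simp: gmodule_hom_def)
  have \<psi>': "\<And>x y. x \<in> carrier F \<Longrightarrow> y \<in> carrier F \<Longrightarrow> \<psi> (x \<oplus>\<^bsub>F\<^esub> y) = \<psi> x \<oplus>\<^bsub>N\<^esub> \<psi> y"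
     "\<And>c x. x \<in> carrier F \<Longrightarrow> \<psi> (c \<odot>\<^bsub>F\<^esub> x) = c \<odot>\<^bsub>N\<^esub> \<psi> x"
     "\<And>g x. g \<in> carrier G \<Longrightarrow> x \<in> carrier F \<Longrightarrow> \<psi> (act F g x) = act N g (\<psi> x)"
     "\<And>x. x \<in> carrier F \<Longrightarrow> \<psi> x \<in> carrier N"
    using \<psi>(1) by (auto simp: gmodule_hom_def)
  have "\<theta> \<in> gmodule_hom (type_ring :: 'k ring) G M N"
    unfolding gmodule_hom_def using \<psi>' D by (auto dest!: c simp: \<phi>' \<theta>)
  moreover have "bij_betw \<theta> (carrier M) (carrier N)"
    unfolding bij_betw_def
  proof
    show "inj_on \<theta> (carrier M)" by (rule inj_onI) (auto dest!: c simp: \<theta> eq)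
    have "\<theta> ` carrier M = (\<lambda>x. \<theta> (\<phi> x)) ` carrier F" by (simp add: \<phi>(2)[symmetric] image_image)
    also have "\<dots> = \<psi> ` carrier F" by (rule image_cong[OF refl \<theta>])
    finally show "\<theta> ` carrier M = carrier N" by (simp add: \<psi>(2))
  qed
  ultimately show ?thesis
    unfolding gmodule_iso_def using is_gmodule_surj_image[OF F \<phi>] is_gmodule_surj_image[OF F \<psi>] by blast
qed

lemma is_gmodule_zero: "group G \<Longrightarrow> is_gmodule (type_ring :: 'k::comm_ring_1 ring) G zero_gmodule"
  by (rule is_gmoduleI) (auto simp: zero_gmodule_def intro!: abelian_groupI)

lemma module_submoduleI:
  fixes M :: "('k::comm_ring_1, 'm, 'g) gmodule"
  assumes "module type_ring M" "H \<subseteq> carrier M" "\<zero>\<^bsub>M\<^esub> \<in> H"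
    "\<And>x y. x \<in> H \<Longrightarrow> y \<in> H \<Longrightarrow> x \<oplus>\<^bsub>M\<^esub> y \<in> H" "\<And>c x. x \<in> H \<Longrightarrow> c \<odot>\<^bsub>M\<^esub> x \<in> H"
  shows "submodule H type_ring M"
proof -
  interpret module "type_ring :: 'k ring" M by fact
  have R: "\<ominus>\<^bsub>type_ring\<^esub> (1::'k) = - 1"
    by (rule R.minus_equality) auto
  have "\<ominus>\<^bsub>M\<^esub> x \<in> H" if "x \<in> H" for x
  proof -
    have "x \<in> carrier M" using that assms(2) by auto
    then have "\<ominus>\<^bsub>M\<^esub> x = (- 1 :: 'k) \<odot>\<^bsub>M\<^esub> x"
      using smult_l_minus[of "1::'k" x] smult_one[of x] by (simp add: R)
    then show ?thesis using assms(5)[OF that] by simp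
  qed
  then show ?thesis using assms by (intro submoduleI) auto
qed

lemma submoduleD:
  assumes "submodule H type_ring M"
  shows "\<zero>\<^bsub>M\<^esub> \<in> H" "\<And>x y. x \<in> H \<Longrightarrow> y \<in> H \<Longrightarrow> x \<oplus>\<^bsub>M\<^esub> y \<in> H" "\<And>c x. x \<in> H \<Longrightarrow> c \<odot>\<^bsub>M\<^esub> x \<in> H"
    "H \<subseteq> carrier M"
proof -
  interpret submodule H type_ring M by fact
  show "\<zero>\<^bsub>M\<^esub> \<in> H" "\<And>x y. x \<in> H \<Longrightarrow> y \<in> H \<Longrightarrow> x \<oplus>\<^bsub>M\<^esub> y \<in> H" "\<And>c x. x \<in> H \<Longrightarrow> c \<odot>\<^bsub>M\<^esub> x \<in> H"
    "H \<subseteq> carrier M"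
    using one_closed m_closed smult_closed subset by auto
qed

lemma submodule_span_least: "submodule N type_ring M \<Longrightarrow> S \<subseteq> N \<Longrightarrow> submodule_span M S \<subseteq> N"
  unfolding submodule_span_def by (rule hull_minimal)

lemma submodule_span_superset: "S \<subseteq> submodule_span M S"
  unfolding submodule_span_def by (rule hull_subset)

lemma submodule_submodule_span:
  fixes M :: "('k::comm_ring_1, 'm, 'g) gmodule"
  assumes "module type_ring M" "S \<subseteq> carrier M"
  shows "submodule (submodule_span M S) type_ring M"
proof (rule module_submoduleI[OF assms(1)])
  show "submodule_span M S \<subseteq> carrier M"
    by (rule submodule_span_least[OF module.carrier_is_submodule[OF assms(1)] assms(2)])
qed (auto simp: submodule_span_def hull_def dest: submoduleD)

lemma act_submodule_span:
  fixes M :: "('k::comm_ring_1, 'm, 'g) gmodule"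
  assumes M: "is_gmodule type_ring G M" and S: "S \<subseteq> carrier M"
    and inv: "\<And>x. x \<in> S \<Longrightarrow> act M g x \<in> submodule_span M S" and g: "g \<in> carrier G"
    and x: "x \<in> submodule_span M S"
  shows "act M g x \<in> submodule_span M S"
proof -
  note D = is_gmoduleD[OF M]
  have sub: "submodule (submodule_span M S) type_ring M" by (rule submodule_submodule_span[OF D(1) S])
  note sD = submoduleD[OF sub]
  have z: "act M g \<zero>\<^bsub>M\<^esub> = \<zero>\<^bsub>M\<^esub>"
  proof -
    interpret abelian_group M by (rule D(2))
    have "act M g \<zero>\<^bsub>M\<^esub> \<oplus>\<^bsub>M\<^esub> act M g \<zero>\<^bsub>M\<^esub> = act M g \<zero>\<^bsub>M\<^esub>" using D(10)[OF g, of "\<zero>\<^bsub>M\<^esub>" "\<zero>\<^bsub>M\<^esub>"] by simp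
    then show ?thesis using D(9)[OF g, of "\<zero>\<^bsub>M\<^esub>"] by (simp add: add.r_cancel_one)
  qed
  have "submodule {x \<in> carrier M. act M g x \<in> submodule_span M S} type_ring M"
  proof (rule module_submoduleI[OF D(1)])
    show "\<zero>\<^bsub>M\<^esub> \<in> {x \<in> carrier M. act M g x \<in> submodule_span M S}"
      using sD(1) z abelian_group.axioms(1)[OF D(2)] abelian_monoid.zero_closed by auto
  qed (use D(4,10,11) g sD abelian_groupE(1)[OF D(2)] in auto)
  from submodule_span_least[OF this] show ?thesis using S inv x by blast
qed

lemma is_gmodule_submodule:
  fixes M :: "('k::comm_ring_1, 'm, 'g) gmodule"
  assumes M: "is_gmodule type_ring G M" and H: "submodule H type_ring M"
    and inv: "\<And>g x. g \<in> carrier G \<Longrightarrow> x \<in> H \<Longrightarrow> act M g x \<in> H"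
  shows "is_gmodule type_ring G (M\<lparr>carrier := H\<rparr>)"
  using M inv submoduleD(4)[OF H] submodule.submodule_is_module[OF H is_gmoduleD(1)[OF M]]
  unfolding is_gmodule_def by (auto simp: subset_iff)

lemma is_gmodule_dual:
  assumes M: "is_gmodule (type_ring :: 'k::comm_ring_1 ring) G M"
  shows "is_gmodule (type_ring :: 'k ring) G (dual_gmodule G M)"
proof -
  note D = is_gmoduleD[OF M]
  interpret M: abelian_group M by (rule D(2))
  interpret G: group G by (rule D(3))
  note dd = dual_gmodule_def PiE_def extensional_def
  show ?thesis
  proof (rule is_gmoduleI)
    show "abelian_group (dual_gmodule G M)"
    proof (rule abelian_groupI)
      fix f assume f: "f \<in> carrier (dual_gmodule G M)"
      have "(\<lambda>x\<in>carrier M. - f x) \<in> carrier (dual_gmodule G M)"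
        using f D(4) by (auto simp: dd)
      moreover have "(\<lambda>x\<in>carrier M. - f x) \<oplus>\<^bsub>dual_gmodule G M\<^esub> f = \<zero>\<^bsub>dual_gmodule G M\<^esub>"
        by (auto simp: dd)
      ultimately show "\<exists>g\<in>carrier (dual_gmodule G M). g \<oplus>\<^bsub>dual_gmodule G M\<^esub> f = \<zero>\<^bsub>dual_gmodule G M\<^esub>" by blast
    qed (use D(4) in \<open>auto simp: dd algebra_simps fun_eq_iff restrict_def\<close>)
    show "group G" by (rule D(3))
  qed (use D in \<open>auto simp: dd algebra_simps fun_eq_iff restrict_def G.inv_mult_group\<close>)
qed

lemma dual_gmodule_simps:
  "\<zero>\<^bsub>dual_gmodule G M\<^esub> = (\<lambda>x\<in>carrier M. 0)"
  "f \<oplus>\<^bsub>dual_gmodule G M\<^esub> h = (\<lambda>x\<in>carrier M. f x + h x)"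
  "c \<odot>\<^bsub>dual_gmodule G M\<^esub> f = (\<lambda>x\<in>carrier M. c * f x)"
  "act (dual_gmodule G M) w f = (\<lambda>x\<in>carrier M. f (act M (inv\<^bsub>G\<^esub> w) x))"
  by (simp_all add: dual_gmodule_def)

text \<open>Free modules, the free nonassociative algebra and the modules of cycles share the
  operations of formal sums and differ in carrier and action. Fixing only the operations lets one
  set of coset rules serve them all.\<close>

definition formal_module :: "('k::comm_ring_1, 'x \<Rightarrow>\<^sub>0 'k, 'g) gmodule \<Rightarrow> bool" where
  "formal_module M \<longleftrightarrow> \<zero>\<^bsub>M\<^esub> = 0 \<and> add M = (+) \<and> smult M = pm_scale"

lemma is_gmodule_formal:
  fixes M :: "('k::comm_ring_1, 'x \<Rightarrow>\<^sub>0 'k, 'g) gmodule"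
  assumes "formal_module M" "group G"
    and "0 \<in> carrier M" "\<And>x y. x \<in> carrier M \<Longrightarrow> y \<in> carrier M \<Longrightarrow> x + y \<in> carrier M"
    and "\<And>c x. x \<in> carrier M \<Longrightarrow> pm_scale c x \<in> carrier M"
    and "\<And>g. g \<in> carrier G \<Longrightarrow> pm_linear (act M g)"
    and "\<And>g x. g \<in> carrier G \<Longrightarrow> x \<in> carrier M \<Longrightarrow> act M g x \<in> carrier M"
    and "\<And>x. x \<in> carrier M \<Longrightarrow> act M \<one>\<^bsub>G\<^esub> x = x"
    and "\<And>g h x. g \<in> carrier G \<Longrightarrow> h \<in> carrier G \<Longrightarrow> x \<in> carrier M \<Longrightarrow> act M (g \<otimes>\<^bsub>G\<^esub> h) x = act M g (act M h x)"
  shows "is_gmodule type_ring G M"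
proof (rule is_gmoduleI)
  have uminus: "- x \<in> carrier M" if "x \<in> carrier M" for x
    using assms(5)[OF that, of "-1"] by (simp add: pm_scale_uminus)
  show "abelian_group M"
  proof (rule abelian_groupI)
    fix x assume "x \<in> carrier M"
    then show "\<exists>y\<in>carrier M. y \<oplus>\<^bsub>M\<^esub> x = \<zero>\<^bsub>M\<^esub>"
      using uminus assms(1) by (intro bexI[of _ "- x"]) (auto simp: formal_module_def)
  qed (use assms in \<open>auto simp: formal_module_def add.assoc add.commute\<close>)
qed (use assms in \<open>auto simp: formal_module_def pm_scale_add pm_scale_left_add pm_linear_def\<close>)

lemma formal_module_free: "formal_module (free_gmodule S \<alpha>)"
  by (simp add: formal_module_def free_gmodule_def)

lemma carrier_free: "carrier (free_gmodule S \<alpha>) = {f. Poly_Mapping.keys f \<subseteq> S}"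
  and act_free: "act (free_gmodule S \<alpha>) g = pm_map (\<alpha> g)"
  by (simp_all add: free_gmodule_def)

lemma is_gmodule_free:
  assumes "group G"
    and "\<And>g x. g \<in> carrier G \<Longrightarrow> x \<in> S \<Longrightarrow> \<alpha> g x \<in> S"
    and "\<And>x. x \<in> S \<Longrightarrow> \<alpha> \<one>\<^bsub>G\<^esub> x = x"
    and "\<And>g h x. g \<in> carrier G \<Longrightarrow> h \<in> carrier G \<Longrightarrow> x \<in> S \<Longrightarrow> \<alpha> (g \<otimes>\<^bsub>G\<^esub> h) x = \<alpha> g (\<alpha> h x)"
  shows "is_gmodule (type_ring :: 'k::comm_ring_1 ring) G (free_gmodule S \<alpha>)"
proof (rule is_gmodule_formal[OF formal_module_free assms(1)])
  fix x :: "_ \<Rightarrow>\<^sub>0 'k" and g h and y :: "_ \<Rightarrow>\<^sub>0 'k" and c :: 'k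
  let ?M = "free_gmodule S \<alpha> :: ('k, _, _) gmodule"
  assume x: "x \<in> carrier ?M"
  show "x + y \<in> carrier ?M" if "y \<in> carrier ?M"
    using x that keys_add[of x y] by (auto simp: carrier_free)
  show "pm_scale c x \<in> carrier ?M" using x keys_pm_scale[of c x] by (auto simp: carrier_free)
  show "act ?M g x \<in> carrier ?M" if "g \<in> carrier G"
    using x assms(2)[OF that] unfolding carrier_free act_free
    by (auto dest!: subsetD[OF keys_pm_map])
  have "act ?M \<one>\<^bsub>G\<^esub> x = pm_map (\<lambda>x. x) x"
    unfolding act_free using x assms(3) by (intro lin_ext_cong) (auto simp: carrier_free)
  then show "act ?M \<one>\<^bsub>G\<^esub> x = x" by simp
  show "act ?M (g \<otimes>\<^bsub>G\<^esub> h) x = act ?M g (act ?M h x)" if "g \<in> carrier G" "h \<in> carrier G"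
    unfolding act_free pm_map_pm_map using x that assms(4) by (intro lin_ext_cong) (auto simp: carrier_free)
qed (auto simp: carrier_free act_free)

lemma formal_coset: "formal_module M \<Longrightarrow> N +>\<^bsub>M\<^esub> a = (\<lambda>n. n + a) ` N"
  by (auto simp: a_r_coset_def r_coset_def formal_module_def)

context
  fixes M :: "('k::comm_ring_1, 'x \<Rightarrow>\<^sub>0 'k, 'g) gmodule" and N
  assumes M: "formal_module M" and N: "submodule N type_ring M"
begin

lemma formal_submodule:
  "0 \<in> N" "\<And>x y. x \<in> N \<Longrightarrow> y \<in> N \<Longrightarrow> x + y \<in> N" "\<And>c x. x \<in> N \<Longrightarrow> pm_scale c x \<in> N"
  "\<And>x. x \<in> N \<Longrightarrow> - x \<in> N" "\<And>x y. x \<in> N \<Longrightarrow> y \<in> N \<Longrightarrow> x - y \<in> N" "N \<subseteq> carrier M"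
proof -
  note D = submoduleD[OF N]
  show *: "0 \<in> N" "\<And>x y. x \<in> N \<Longrightarrow> y \<in> N \<Longrightarrow> x + y \<in> N" "\<And>c x. x \<in> N \<Longrightarrow> pm_scale c x \<in> N" "N \<subseteq> carrier M"
    using D M by (auto simp: formal_module_def)
  show **: "\<And>x. x \<in> N \<Longrightarrow> - x \<in> N" using *(3)[of _ "-1"] by (simp add: pm_scale_uminus)
  show "\<And>x y. x \<in> N \<Longrightarrow> y \<in> N \<Longrightarrow> x - y \<in> N" using *(2) ** by (metis diff_conv_add_uminus)
qed

lemma coset_eq_iff: "N +>\<^bsub>M\<^esub> a = N +>\<^bsub>M\<^esub> b \<longleftrightarrow> a - b \<in> N"
proof
  assume "N +>\<^bsub>M\<^esub> a = N +>\<^bsub>M\<^esub> b"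
  then have "0 + a \<in> (\<lambda>n. n + b) ` N" using formal_submodule(1) unfolding formal_coset[OF M] by blast
  then show "a - b \<in> N" by auto
next
  have sub: "(\<lambda>n. n + a) ` N \<subseteq> (\<lambda>n. n + b) ` N" if "a - b \<in> N" for a b
  proof (rule image_subsetI)
    fix n assume "n \<in> N"
    then have "n + (a - b) \<in> N" "n + a = n + (a - b) + b" using that formal_submodule(2) by auto
    then show "n + a \<in> (\<lambda>n. n + b) ` N" by blast
  qed
  assume "a - b \<in> N"
  moreover from this have "b - a \<in> N" using formal_submodule(4)[of "a - b"] by simp
  ultimately show "N +>\<^bsub>M\<^esub> a = N +>\<^bsub>M\<^esub> b" unfolding formal_coset[OF M] using sub by blast
qed

lemma coset_zero: "N +>\<^bsub>M\<^esub> 0 = N"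
  by (simp add: formal_coset[OF M])

lemma coset_add: "(N +>\<^bsub>M\<^esub> a) <+>\<^bsub>M\<^esub> (N +>\<^bsub>M\<^esub> b) = N +>\<^bsub>M\<^esub> (a + b)"
proof -
  have "(N +>\<^bsub>M\<^esub> a) <+>\<^bsub>M\<^esub> (N +>\<^bsub>M\<^esub> b) = {(n + a) + (n' + b) | n n'. n \<in> N \<and> n' \<in> N}"
    unfolding formal_coset[OF M] set_add_def set_mult_def using M by (auto simp: formal_module_def)
  also have "\<dots> = (\<lambda>n. n + (a + b)) ` N"
  proof (intro equalityI subsetI)
    fix x assume "x \<in> {(n + a) + (n' + b) | n n'. n \<in> N \<and> n' \<in> N}"
    then obtain n n' where "n \<in> N" "n' \<in> N" "x = (n + n') + (a + b)" by (auto simp: algebra_simps)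
    then show "x \<in> (\<lambda>n. n + (a + b)) ` N" using formal_submodule(2) by blast
  next
    fix x assume "x \<in> (\<lambda>n. n + (a + b)) ` N"
    then obtain n where "n \<in> N" "x = (n + a) + (0 + b)" by (auto simp: algebra_simps)
    then have "\<exists>n n'. x = (n + a) + (n' + b) \<and> n \<in> N \<and> n' \<in> N" using formal_submodule(1) by metis
    then show "x \<in> {(n + a) + (n' + b) | n n'. n \<in> N \<and> n' \<in> N}" by blast
  qed
  finally show ?thesis unfolding formal_coset[OF M] .
qed

lemma coset_smult: "c \<odot>\<^bsub>quotient_gmodule M N\<^esub> (N +>\<^bsub>M\<^esub> a) = N +>\<^bsub>M\<^esub> (pm_scale c a)"
proof -
  let ?A = "N +>\<^bsub>M\<^esub> a"
  have eq: "N +>\<^bsub>M\<^esub> (pm_scale c a') = N +>\<^bsub>M\<^esub> (pm_scale c a)" if "a' \<in> ?A" for a'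
    using that formal_submodule(3) unfolding coset_eq_iff pm_scale_diff[symmetric]
    by (auto simp: formal_coset[OF M])
  have "a \<in> ?A" using formal_submodule(1) by (force simp: formal_coset[OF M])
  have "(\<Union>a'\<in>?A. N +>\<^bsub>M\<^esub> (pm_scale c a')) = (\<Union>a'\<in>?A. N +>\<^bsub>M\<^esub> (pm_scale c a))"
    by (rule SUP_cong[OF refl eq])
  also have "\<dots> = N +>\<^bsub>M\<^esub> (pm_scale c a)" using \<open>a \<in> ?A\<close> by blast
  finally show ?thesis using M by (simp add: quotient_gmodule_def formal_module_def)
qed

lemma quotient_simps:
  "carrier (quotient_gmodule M N) = (\<lambda>a. N +>\<^bsub>M\<^esub> a) ` carrier M"
  "\<zero>\<^bsub>quotient_gmodule M N\<^esub> = N"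
  "(N +>\<^bsub>M\<^esub> a) \<oplus>\<^bsub>quotient_gmodule M N\<^esub> (N +>\<^bsub>M\<^esub> b) = N +>\<^bsub>M\<^esub> (a + b)"
  by (auto simp: quotient_gmodule_def A_RCOSETS_def' coset_add)

lemma coset_act:
  assumes "is_gmodule type_ring G M" "g \<in> carrier G" "a \<in> carrier M"
    and inv: "\<And>g n. g \<in> carrier G \<Longrightarrow> n \<in> N \<Longrightarrow> act M g n \<in> N"
  shows "act (quotient_gmodule M N) g (N +>\<^bsub>M\<^esub> a) = N +>\<^bsub>M\<^esub> (act M g a)"
proof -
  note D = is_gmoduleD[OF assms(1)]
  interpret G: group G by (rule D(3))
  have add: "act M g (n + a) = act M g n + act M g a" if "n \<in> N" for n
    using D(10)[OF assms(2) _ assms(3), of n] that formal_submodule(6) M by (auto simp: formal_module_def)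
  \<comment> \<open>The inverse of \<open>g\<close> preserves \<open>N\<close> as well, so the image
    of a coset is a full coset.\<close>
  have "act M g ` N = N"
  proof
    show "N \<subseteq> act M g ` N"
    proof
      fix n assume n: "n \<in> N"
      then have "act M g (act M (inv\<^bsub>G\<^esub> g) n) = n"
        using D(13)[OF assms(2) G.inv_closed[OF assms(2)], of n] D(12)[of n] formal_submodule(6) assms(2) by auto
      then show "n \<in> act M g ` N" using inv[OF G.inv_closed[OF assms(2)] n] by force
    qed
  qed (use inv assms(2) in auto)
  then have "(\<lambda>n. act M g n + act M g a) ` N = (\<lambda>n. n + act M g a) ` N"
    by (metis (no_types, lifting) image_cong image_image)
  then show ?thesis unfolding formal_coset[OF M] by (simp add: quotient_gmodule_def image_image add)
qed

lemma quotient_hom: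
  assumes "is_gmodule type_ring G M"
    and inv: "\<And>g n. g \<in> carrier G \<Longrightarrow> n \<in> N \<Longrightarrow> act M g n \<in> N"
  shows "(\<lambda>a. N +>\<^bsub>M\<^esub> a) \<in> gmodule_hom type_ring G M (quotient_gmodule M N)"
  unfolding gmodule_hom_def
  using coset_act[OF assms(1) _ _ inv] coset_smult quotient_simps M by (auto simp: formal_module_def)

lemma is_gmodule_quotient:
  assumes "is_gmodule type_ring G M"
    and "\<And>g n. g \<in> carrier G \<Longrightarrow> n \<in> N \<Longrightarrow> act M g n \<in> N"
  shows "is_gmodule type_ring G (quotient_gmodule M N)"
  by (rule is_gmodule_surj_image[OF assms(1) quotient_hom[OF assms]])
    (use M in \<open>auto simp: quotient_simps formal_module_def coset_zero\<close>)

end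

lemma is_gmodule_sgn: "is_gmodule (type_ring :: 'k::comm_ring_1 ring) (sym_group r) sgn_gmodule"
proof (rule is_gmoduleI)
  show "abelian_group (sgn_gmodule :: ('k, _, _) gmodule)"
    by (rule abelian_groupI) (auto simp: sgn_gmodule_def algebra_simps intro: exI[of _ "- x" for x])
  fix g h and x :: 'k assume "g \<in> carrier (sym_group r)" "h \<in> carrier (sym_group r)"
  then show "act sgn_gmodule (g \<otimes>\<^bsub>sym_group r\<^esub> h) x = act sgn_gmodule g (act sgn_gmodule h x)"
    using sym_group_carrier' by (simp add: sgn_gmodule_def sym_group_mult sign_compose)
qed (auto simp: sgn_gmodule_def sym_group_is_group sym_group_one algebra_simps)

section \<open>Tensor products\<close>

lemma tensor_relations_cases [consumes 1, case_names add_left add_right smult_left smult_right]: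
  assumes "z \<in> tensor_relations M N"
  obtains x x' y where "z = Poly_Mapping.single (x \<oplus>\<^bsub>M\<^esub> x', y) 1 - Poly_Mapping.single (x, y) 1
        - Poly_Mapping.single (x', y) 1" "x \<in> carrier M" "x' \<in> carrier M" "y \<in> carrier N"
  | x y y' where "z = Poly_Mapping.single (x, y \<oplus>\<^bsub>N\<^esub> y') 1 - Poly_Mapping.single (x, y) 1
        - Poly_Mapping.single (x, y') 1" "x \<in> carrier M" "y \<in> carrier N" "y' \<in> carrier N"
  | c x y where "z = Poly_Mapping.single (c \<odot>\<^bsub>M\<^esub> x, y) 1 - Poly_Mapping.single (x, y) c"
        "x \<in> carrier M" "y \<in> carrier N"
  | c x y where "z = Poly_Mapping.single (x, c \<odot>\<^bsub>N\<^esub> y) 1 - Poly_Mapping.single (x, y) c"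
        "x \<in> carrier M" "y \<in> carrier N"
  using assms unfolding tensor_relations_def by blast

lemma tensor_relationsI:
  "x \<in> carrier M \<Longrightarrow> x' \<in> carrier M \<Longrightarrow> y \<in> carrier N \<Longrightarrow>
     Poly_Mapping.single (x \<oplus>\<^bsub>M\<^esub> x', y) 1 - Poly_Mapping.single (x, y) 1
        - Poly_Mapping.single (x', y) 1 \<in> tensor_relations M N"
  "x \<in> carrier M \<Longrightarrow> y \<in> carrier N \<Longrightarrow> y' \<in> carrier N \<Longrightarrow>
     Poly_Mapping.single (x, y \<oplus>\<^bsub>N\<^esub> y') 1 - Poly_Mapping.single (x, y) 1
        - Poly_Mapping.single (x, y') 1 \<in> tensor_relations M N"
  "x \<in> carrier M \<Longrightarrow> y \<in> carrier N \<Longrightarrow>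
     Poly_Mapping.single (c \<odot>\<^bsub>M\<^esub> x, y) 1 - Poly_Mapping.single (x, y) c \<in> tensor_relations M N"
  "x \<in> carrier M \<Longrightarrow> y \<in> carrier N \<Longrightarrow>
     Poly_Mapping.single (x, c \<odot>\<^bsub>N\<^esub> y) 1 - Poly_Mapping.single (x, y) c \<in> tensor_relations M N"
  unfolding tensor_relations_def by blast+

lemma keys_diff_subset: "Poly_Mapping.keys a \<subseteq> S \<Longrightarrow> Poly_Mapping.keys b \<subseteq> S \<Longrightarrow> Poly_Mapping.keys (a - b) \<subseteq> S"
  using keys_diff[of a b] by blast

context
  fixes G :: "('g, 'h) monoid_scheme" and M :: "('k::comm_ring_1, 'm, 'g) gmodule" and N :: "('k, 'n, 'g) gmodule"
  assumes M: "is_gmodule (type_ring :: 'k ring) G M" and N: "is_gmodule (type_ring :: 'k ring) G N"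
begin

abbreviation (input) "pairs_gmodule \<equiv>
  free_gmodule (carrier M \<times> carrier N) (\<lambda>g (x, y). (act M g x, act N g y)) :: ('k, 'm \<times> 'n \<Rightarrow>\<^sub>0 'k, 'g) gmodule"

abbreviation (input) "tensor_span \<equiv> submodule_span pairs_gmodule (tensor_relations M N)"

lemma tensor_gmodule_eq: "tensor_gmodule M N = quotient_gmodule pairs_gmodule tensor_span"
  by (simp add: tensor_gmodule_def Let_def)

lemma is_gmodule_pairs: "is_gmodule (type_ring :: 'k ring) G pairs_gmodule"
  using is_gmoduleD[OF M] is_gmoduleD[OF N] by (intro is_gmodule_free) auto

lemma tensor_relations_carrier: "tensor_relations M N \<subseteq> carrier pairs_gmodule"
proof
  note c = is_gmoduleD(4)[OF M] is_gmoduleD(4)[OF N]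
      abelian_groupE(1)[OF is_gmoduleD(2)[OF M]] abelian_groupE(1)[OF is_gmoduleD(2)[OF N]]
  fix z assume "z \<in> tensor_relations M N"
  then show "z \<in> carrier pairs_gmodule"
  proof (cases rule: tensor_relations_cases)
    case (add_left x x' y)
    then show ?thesis unfolding carrier_free by (auto simp: c split: if_splits dest!: subsetD[OF keys_diff])
  next
    case (add_right x y y')
    then show ?thesis unfolding carrier_free by (auto simp: c split: if_splits dest!: subsetD[OF keys_diff])
  next
    case (smult_left d x y)
    then show ?thesis unfolding carrier_free smult_left(1) mem_Collect_eq by (intro keys_diff_subset) (simp_all add: c(1))
  next
    case (smult_right d x y)
    then show ?thesis unfolding carrier_free smult_right(1) mem_Collect_eq by (intro keys_diff_subset) (simp_all add: c(2))
  qed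
qed

lemma submodule_tensor_span: "submodule tensor_span type_ring pairs_gmodule"
  by (rule submodule_submodule_span[OF is_gmoduleD(1)[OF is_gmodule_pairs] tensor_relations_carrier])

lemma act_tensor_span:
  assumes g: "g \<in> carrier G" and n: "n \<in> tensor_span"
  shows "act pairs_gmodule g n \<in> tensor_span"
proof (rule act_submodule_span[OF is_gmodule_pairs tensor_relations_carrier _ g n])
  note MM = is_gmoduleD(9-11)[OF M] and NN = is_gmoduleD(9-11)[OF N]
  fix x assume "x \<in> tensor_relations M N"
  then have "act pairs_gmodule g x \<in> tensor_relations M N"
    unfolding act_free
    by (cases rule: tensor_relations_cases) (simp_all add: lin_ext_diff MM NN g tensor_relationsI)
  then show "act pairs_gmodule g x \<in> tensor_span" by (rule subsetD[OF submodule_span_superset])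
qed

lemmas tensor_quotient =
  coset_eq_iff[OF formal_module_free submodule_tensor_span]
  quotient_simps[OF formal_module_free submodule_tensor_span]
  coset_smult[OF formal_module_free submodule_tensor_span]

lemmas act_tensor_coset =
  coset_act[OF formal_module_free submodule_tensor_span is_gmodule_pairs _ _ act_tensor_span]

lemma tensor_coset_relation:
  assumes "a - b \<in> tensor_relations M N"
  shows "tensor_span +>\<^bsub>pairs_gmodule\<^esub> a = tensor_span +>\<^bsub>pairs_gmodule\<^esub> b"
  by (rule tensor_quotient(1)[THEN iffD2, OF subsetD[OF submodule_span_superset assms]])

end

text \<open>The pure tensor of \<open>x\<close> with \<open>1\<close>. As the second factor has rank
  one, every tensor has this form, and tensoring merely twists the action.\<close>

definition sgn_tensor ::
  "('k::comm_ring_1, 'm, nat \<Rightarrow> nat) gmodule \<Rightarrow> 'm \<Rightarrow> ('m \<times> 'k \<Rightarrow>\<^sub>0 'k) set" where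
  "sgn_tensor D x =
     (let F = free_gmodule (carrier D \<times> carrier sgn_gmodule) (\<lambda>g (x, y). (act D g x, act sgn_gmodule g y))
            :: ('k, 'm \<times> 'k \<Rightarrow>\<^sub>0 'k, nat \<Rightarrow> nat) gmodule
      in submodule_span F (tensor_relations D sgn_gmodule) +>\<^bsub>F\<^esub> Poly_Mapping.single (x, 1) 1)"

context
  fixes D :: "('k::comm_ring_1, 'm, nat \<Rightarrow> nat) gmodule" and r :: nat
  assumes D: "is_gmodule (type_ring :: 'k ring) (sym_group r) D"
begin

abbreviation (input) "SG \<equiv> sgn_gmodule :: ('k, 'k, nat \<Rightarrow> nat) gmodule"

abbreviation (input) "PG \<equiv>
  free_gmodule (carrier D \<times> carrier SG) (\<lambda>g (x, y). (act D g x, act SG g y)) :: ('k, 'm \<times> 'k \<Rightarrow>\<^sub>0 'k, nat \<Rightarrow> nat) gmodule"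

abbreviation (input) "cst a \<equiv> submodule_span PG (tensor_relations D SG) +>\<^bsub>PG\<^esub> a"

lemmas sgn_relation = tensor_coset_relation[OF D is_gmodule_sgn]
lemmas sgn_quotient = tensor_quotient[OF D is_gmodule_sgn] tensor_gmodule_eq[OF D is_gmodule_sgn]

lemma sgn_gmodule_simps: "carrier SG = UNIV" "c \<odot>\<^bsub>SG\<^esub> y = c * y" "act SG g y = of_int (sign g) * y"
  by (simp_all add: sgn_gmodule_def)

lemma sgn_tensor_eq: "sgn_tensor D x = cst (Poly_Mapping.single (x, 1) 1)"
  by (simp add: sgn_tensor_def Let_def)

lemma cst_scale: "x \<in> carrier D \<Longrightarrow> cst (Poly_Mapping.single (x, 1) c) = sgn_tensor D (c \<odot>\<^bsub>D\<^esub> x)"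
  unfolding sgn_tensor_eq
  by (rule sgn_relation[symmetric, OF tensor_relationsI(3)]) (simp_all add: sgn_gmodule_simps)

lemma cst_right_scale: "x \<in> carrier D \<Longrightarrow> cst (Poly_Mapping.single (x, c) 1) = cst (Poly_Mapping.single (x, 1) c)"
  using sgn_relation[OF tensor_relationsI(4)[of x D 1 SG c]] by (simp add: sgn_gmodule_simps)

lemma cst_add:
  assumes "x \<in> carrier D" "y \<in> carrier D"
  shows "cst (Poly_Mapping.single (x, 1) 1 + Poly_Mapping.single (y, 1) 1) = sgn_tensor D (x \<oplus>\<^bsub>D\<^esub> y)"
  unfolding sgn_tensor_eq
  by (rule sgn_relation[symmetric]) (use tensor_relationsI(1)[OF assms, of 1 SG] in \<open>simp add: sgn_gmodule_simps diff_diff_eq\<close>)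

lemma sgn_tensor_zero: "sgn_tensor D \<zero>\<^bsub>D\<^esub> = \<zero>\<^bsub>tensor_gmodule D SG\<^esub>"
proof -
  have m: "module type_ring D" by (rule is_gmoduleD(1)[OF D])
  then interpret module "type_ring :: 'k ring" D .
  have "(0::'k) \<odot>\<^bsub>D\<^esub> \<zero>\<^bsub>D\<^esub> = \<zero>\<^bsub>D\<^esub>" using smult_l_null[of "\<zero>\<^bsub>D\<^esub>"] by simp
  then have "sgn_tensor D \<zero>\<^bsub>D\<^esub> = cst (Poly_Mapping.single (\<zero>\<^bsub>D\<^esub>, 1) 0)" using cst_scale[of "\<zero>\<^bsub>D\<^esub>" 0] by simp
  also have "\<dots> = submodule_span PG (tensor_relations D SG)"
    using coset_zero[OF formal_module_free submodule_tensor_span[OF D is_gmodule_sgn]] by simp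
  finally show ?thesis by (simp add: sgn_quotient)
qed

lemma sgn_tensor_surj: "sgn_tensor D ` carrier D = carrier (tensor_gmodule D SG)"
proof
  show "sgn_tensor D ` carrier D \<subseteq> carrier (tensor_gmodule D SG)"
    unfolding sgn_tensor_eq sgn_quotient by (auto simp: carrier_free sgn_gmodule_simps)
  note ab = is_gmoduleD(2,4)[OF D]
  have "cst a \<in> sgn_tensor D ` carrier D" if "Poly_Mapping.keys a \<subseteq> carrier D \<times> carrier SG" for a
    using that
  proof (induction rule: pm_linear_induct)
    case zero
    then show ?case
      using coset_zero[OF formal_module_free submodule_tensor_span[OF D is_gmodule_sgn]]
        sgn_tensor_zero abelian_monoid.zero_closed[OF abelian_group.axioms(1)[OF ab(1)]]
      by (auto simp: sgn_quotient intro!: image_eqI[of _ _ "\<zero>\<^bsub>D\<^esub>"])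
  next
    case (single c p)
    obtain x s where p: "p = (x, s)" by (cases p)
    then have x: "x \<in> carrier D" using single by auto
    have "cst (Poly_Mapping.single (x, s) c) = c \<odot>\<^bsub>tensor_gmodule D SG\<^esub> cst (Poly_Mapping.single (x, s) 1)"
      by (simp add: sgn_quotient)
    also have "\<dots> = c \<odot>\<^bsub>tensor_gmodule D SG\<^esub> cst (Poly_Mapping.single (x, 1) s)"
      by (simp only: cst_right_scale[OF x])
    also have "\<dots> = cst (Poly_Mapping.single (x, 1) (c * s))"
      by (simp add: sgn_quotient)
    finally show ?case unfolding p cst_scale[OF x] using ab(2)[OF x] by blast
  next
    case (add f g)
    then obtain x y where xy: "x \<in> carrier D" "y \<in> carrier D" "cst f = sgn_tensor D x" "cst g = sgn_tensor D y" by auto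
    have "cst (f + g) = cst f \<oplus>\<^bsub>tensor_gmodule D SG\<^esub> cst g" by (simp add: sgn_quotient)
    also have "\<dots> = cst (Poly_Mapping.single (x, 1) 1 + Poly_Mapping.single (y, 1) 1)"
      unfolding xy(3,4) sgn_tensor_eq by (simp add: sgn_quotient)
    finally show ?case unfolding cst_add[OF xy(1,2)] using abelian_groupE(1)[OF ab(1) xy(1,2)] by blast
  qed
  then show "carrier (tensor_gmodule D SG) \<subseteq> sgn_tensor D ` carrier D"
    unfolding sgn_quotient by (auto simp: carrier_free)
qed

text \<open>The sign that \<open>\<kappa>\<close> picks up is the one by which \<open>g\<close> acts
  on the second factor; moved across the tensor product, it makes the composite equivariant.\<close>

lemma sgn_tensor_hom:
  fixes F :: "('k, 'f, nat \<Rightarrow> nat) gmodule"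
  assumes \<kappa>: "\<And>x. x \<in> carrier F \<Longrightarrow> \<kappa> x \<in> carrier D"
    "\<And>x y. x \<in> carrier F \<Longrightarrow> y \<in> carrier F \<Longrightarrow> \<kappa> (x \<oplus>\<^bsub>F\<^esub> y) = \<kappa> x \<oplus>\<^bsub>D\<^esub> \<kappa> y"
    "\<And>c x. x \<in> carrier F \<Longrightarrow> \<kappa> (c \<odot>\<^bsub>F\<^esub> x) = c \<odot>\<^bsub>D\<^esub> \<kappa> x"
    "\<And>g x. g \<in> carrier (sym_group r) \<Longrightarrow> x \<in> carrier F \<Longrightarrow> \<kappa> (act F g x) = of_int (sign g) \<odot>\<^bsub>D\<^esub> act D g (\<kappa> x)"
  shows "(\<lambda>x. sgn_tensor D (\<kappa> x)) \<in> gmodule_hom (type_ring :: 'k ring) (sym_group r) F (tensor_gmodule D sgn_gmodule)"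
  unfolding gmodule_hom_def
proof (intro CollectI conjI ballI)
  show "(\<lambda>x. sgn_tensor D (\<kappa> x)) \<in> carrier F \<rightarrow> carrier (tensor_gmodule D SG)"
    using \<kappa>(1) sgn_tensor_surj by auto
  fix x assume x: "x \<in> carrier F"
  show "sgn_tensor D (\<kappa> (x \<oplus>\<^bsub>F\<^esub> y)) = sgn_tensor D (\<kappa> x) \<oplus>\<^bsub>tensor_gmodule D SG\<^esub> sgn_tensor D (\<kappa> y)"
    if y: "y \<in> carrier F" for y
    unfolding \<kappa>(2)[OF x y] cst_add[OF \<kappa>(1)[OF x] \<kappa>(1)[OF y], symmetric] by (simp add: sgn_tensor_eq sgn_quotient)
  show "sgn_tensor D (\<kappa> (c \<odot>\<^bsub>F\<^esub> x)) = c \<odot>\<^bsub>tensor_gmodule D SG\<^esub> sgn_tensor D (\<kappa> x)" for c :: 'k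
    unfolding \<kappa>(3)[OF x] cst_scale[OF \<kappa>(1)[OF x], symmetric] by (simp add: sgn_tensor_eq sgn_quotient)
  fix g assume g: "g \<in> carrier (sym_group r)"
  have y: "act D g (\<kappa> x) \<in> carrier D" by (rule is_gmoduleD(9)[OF D g \<kappa>(1)[OF x]])
  have s: "Poly_Mapping.single (\<kappa> x, 1) 1 \<in> carrier PG"
    using \<kappa>(1)[OF x] by (simp add: carrier_free sgn_gmodule_simps)
  have "act (tensor_gmodule D SG) g (sgn_tensor D (\<kappa> x)) = cst (act PG g (Poly_Mapping.single (\<kappa> x, 1) 1))"
    unfolding sgn_tensor_eq sgn_quotient(6) by (rule act_tensor_coset[OF D is_gmodule_sgn g s])
  also have "\<dots> = cst (Poly_Mapping.single (act D g (\<kappa> x), of_int (sign g)) 1)"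
    by (simp add: act_free sgn_gmodule_simps)
  also have "\<dots> = sgn_tensor D (\<kappa> (act F g x))"
    unfolding cst_right_scale[OF y] cst_scale[OF y] \<kappa>(4)[OF g x] ..
  finally show "sgn_tensor D (\<kappa> (act F g x)) = act (tensor_gmodule D SG) g (sgn_tensor D (\<kappa> x))" ..
qed

end

text \<open>Sending \<open>(h, s)\<close> to \<open>s * h m\<close> kills the tensor relations for
  each \<open>m\<close>. Equal tensors therefore come from functionals with the same values.\<close>

lemma sgn_tensor_dual_inj:
  fixes M :: "('k::comm_ring_1, 'm, nat \<Rightarrow> nat) gmodule"
  assumes M: "is_gmodule (type_ring :: 'k ring) (sym_group r) M"
    and f: "f \<in> carrier (dual_gmodule (sym_group r) M)" and f': "f' \<in> carrier (dual_gmodule (sym_group r) M)"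
    and eq: "sgn_tensor (dual_gmodule (sym_group r) M) f = sgn_tensor (dual_gmodule (sym_group r) M) f'"
  shows "f = f'"
proof -
  let ?D = "dual_gmodule (sym_group r) M :: ('k, _, _) gmodule"
  let ?S = "sgn_gmodule :: ('k, _, _) gmodule"
  note D = is_gmodule_dual[OF M]
  let ?F = "free_gmodule (carrier ?D \<times> carrier ?S) (\<lambda>g (x, y). (act ?D g x, act ?S g y)) :: ('k, _, nat \<Rightarrow> nat) gmodule"
  define e :: "'m \<Rightarrow> (('m \<Rightarrow> 'k) \<times> 'k \<Rightarrow>\<^sub>0 'k) \<Rightarrow> 'k" where "e m = pm_eval (\<lambda>(h, s). s * h m)" for m
  have diff: "Poly_Mapping.single (f, 1) 1 - Poly_Mapping.single (f', 1) (1::'k) \<in> submodule_span ?F (tensor_relations ?D ?S)"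
    using eq unfolding sgn_tensor_eq[OF D] tensor_quotient(1)[OF D is_gmodule_sgn] .
  have "f m = f' m" if m: "m \<in> carrier M" for m
  proof -
    have "submodule {a \<in> carrier ?F. e m a = 0} type_ring ?F"
      by (rule module_submoduleI[OF is_gmoduleD(1)[OF is_gmodule_pairs[OF D is_gmodule_sgn]]])
        (use is_gmoduleD(4)[OF is_gmodule_pairs[OF D is_gmodule_sgn]]
           abelian_groupE(1,2)[OF is_gmoduleD(2)[OF is_gmodule_pairs[OF D is_gmodule_sgn]]]
         in \<open>auto simp: e_def pm_eval_add pm_eval_scale formal_module_free[unfolded formal_module_def]\<close>)
    moreover have "tensor_relations ?D ?S \<subseteq> {a \<in> carrier ?F. e m a = 0}"
    proof
      fix a assume a: "a \<in> tensor_relations ?D ?S"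
      then have "e m a = 0"
        by (cases rule: tensor_relations_cases)
          (simp_all add: m e_def pm_eval_diff dual_gmodule_simps sgn_gmodule_def ring_distribs mult.left_commute)
      then show "a \<in> {a \<in> carrier ?F. e m a = 0}" using tensor_relations_carrier[OF D is_gmodule_sgn] a by blast
    qed
    ultimately have "e m (Poly_Mapping.single (f, 1) 1 - Poly_Mapping.single (f', 1) (1::'k)) = 0"
      using submodule_span_least diff by blast
    then show ?thesis by (simp add: e_def pm_eval_diff)
  qed
  moreover have "f \<in> carrier M \<rightarrow>\<^sub>E UNIV" "f' \<in> carrier M \<rightarrow>\<^sub>E UNIV" using f f' by (auto simp: dual_gmodule_def)
  ultimately show ?thesis by (intro PiE_ext) auto
qed

section \<open>Expansion of Lie monomials into words\<close>

text \<open>The product of noncommutative power series, a sum over all splittings of the word.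
  Functions on words, with recursion on the word, avoid finite supports and explicit
  splittings.\<close>

primrec conv :: "('x list \<Rightarrow> 'k::comm_ring_1) \<Rightarrow> ('x list \<Rightarrow> 'k) \<Rightarrow> 'x list \<Rightarrow> 'k" where
  "conv f g [] = f [] * g []"
| "conv f g (x # w) = f [] * g (x # w) + conv (\<lambda>u. f (x # u)) g w"

lemma conv_left_linear:
  "conv (\<lambda>w. f w + f' w) g w = conv f g w + conv f' g w"
  "conv (\<lambda>w. c * f w) g w = c * conv f g w"
  "conv (\<lambda>w. f w - f' w) g w = conv f g w - conv f' g w"
  "conv (\<lambda>w. 0) g w = 0"
  by (induction w arbitrary: f f') (auto simp: algebra_simps)

lemma conv_right_linear:
  "conv f (\<lambda>w. g w + g' w) w = conv f g w + conv f g' w"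
  "conv f (\<lambda>w. c * g w) w = c * conv f g w"
  "conv f (\<lambda>w. g w - g' w) w = conv f g w - conv f g' w"
  "conv f (\<lambda>w. 0) w = 0"
  by (induction w arbitrary: f) (auto simp: algebra_simps)

lemma conv_sum:
  "conv (\<lambda>w. \<Sum>i\<in>I. F i w) g w = (\<Sum>i\<in>I. conv (F i) g w)"
  "conv f (\<lambda>w. \<Sum>i\<in>I. F i w) w = (\<Sum>i\<in>I. conv f (F i) w)"
  by (induction I rule: infinite_finite_induct) (auto simp: conv_left_linear conv_right_linear)

lemma conv_assoc: "conv (conv f g) h w = conv f (conv g h) w"
  by (induction w arbitrary: f) (auto simp: conv_left_linear algebra_simps)

lemma conv_unit: "conv (\<lambda>u. if u = [] then c else 0) g w = c * g w"
  by (cases w) (auto simp: conv_left_linear)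

lemma conv_letter_left:
  fixes g :: "'x list \<Rightarrow> 'k::comm_ring_1"
  shows "conv (\<lambda>u. if u = [c] then 1 else 0) g w = (if w \<noteq> [] \<and> hd w = c then g (tl w) else 0)"
proof (cases w)
  case (Cons x u)
  have "(\<lambda>u. if x # u = [c] then 1 else 0 :: 'k) = (\<lambda>u. if u = [] then if x = c then 1 else 0 else 0)"
    by auto
  then show ?thesis using Cons by (simp add: conv_unit)
qed simp

lemma conv_letter_right:
  "conv f (\<lambda>u. if u = [c] then 1 else 0) w = (if w \<noteq> [] \<and> last w = c then f (butlast w) else 0)"
  by (induction w arbitrary: f) auto

definition lie_conv :: "('x list \<Rightarrow> 'k::comm_ring_1) \<Rightarrow> ('x list \<Rightarrow> 'k) \<Rightarrow> 'x list \<Rightarrow> 'k" where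
  "lie_conv f g w = conv f g w - conv g f w"

lemma lie_conv_jacobi:
  fixes f :: "'x list \<Rightarrow> 'k::comm_ring_1"
  shows "lie_conv f (lie_conv g h) w + lie_conv g (lie_conv h f) w + lie_conv h (lie_conv f g) w = 0"
proof -
  have "lie_conv f (lie_conv g h) w = conv f (conv g h) w - conv f (conv h g) w - conv g (conv h f) w + conv h (conv g f) w"
    for f g h :: "'x list \<Rightarrow> 'k"
    unfolding lie_conv_def[abs_def] by (simp add: conv_left_linear conv_right_linear conv_assoc)
  then show ?thesis by simp
qed

primrec expansion :: "'x monomial \<Rightarrow> 'x list \<Rightarrow> 'k::comm_ring_1" where
  "expansion (Gen x) = (\<lambda>w. if w = [x] then 1 else 0)"
| "expansion (Br s t) = lie_conv (expansion s) (expansion t)"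

lemma monomial_mult_lin_ext:
  "monomial_mult f g = lin_ext (\<lambda>s. lin_ext (\<lambda>t. Poly_Mapping.single (Br s t) 1) g) f"
  by (simp add: monomial_mult_def lin_ext_def pm_scale_sum)

text \<open>Expansion turns the nonassociative product into the commutator of word series, which is
  why its kernel is an ideal containing the Lie relations.\<close>

lemma pm_eval_expansion_mult:
  "pm_eval (\<lambda>t. expansion t w) (monomial_mult f g)
     = lie_conv (\<lambda>w. pm_eval (\<lambda>t. expansion t w) f) (\<lambda>w. pm_eval (\<lambda>t. expansion t w) g) w"
  unfolding monomial_mult_lin_ext pm_eval_lin_ext
  by (simp add: pm_eval_def lie_conv_def conv_sum conv_left_linear conv_right_linear sum_distrib_left
      sum_subtractf right_diff_distrib mult.assoc)
    (subst sum.swap, simp add: mult.left_commute)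

definition comb :: "'x \<Rightarrow> 'x list \<Rightarrow> 'x monomial" where
  "comb x cs = foldl (\<lambda>t c. Br t (Gen c)) (Gen x) cs"

lemma comb_simps [simp]: "comb x [] = Gen x" "comb x (cs @ [c]) = Br (comb x cs) (Gen c)"
  by (simp_all add: comb_def)

text \<open>\<open>comb_coeff\<close> first removes the innermost letter, next to \<open>x\<close>,
  whereas the structure of \<open>comb\<close> exposes the outermost bracket. Recursion from the
  other end reconciles the two.\<close>

lemma comb_coeff_snoc:
  "(comb_coeff us vs (cs @ [c]) :: 'k::comm_ring_1) =
     (if vs \<noteq> [] \<and> last vs = c then comb_coeff us (butlast vs) cs else 0)
     - (if us \<noteq> [] \<and> last us = c then comb_coeff (butlast us) vs cs else 0)"
proof (induction cs arbitrary: us vs)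
  case Nil
  have *: "butlast (x # xs) = [] \<longleftrightarrow> xs = []" for x :: 'a and xs by (cases xs) auto
  show ?case by (cases us; cases vs) (auto simp: * split: if_splits)
next
  case (Cons d cs)
  show ?case
    by (cases us; cases vs) (auto simp: Cons split: if_splits list.splits)
qed

text \<open>Bracketing with \<open>c\<close> puts \<open>c\<close> at the right end with a plus sign
  or at the left end with a minus sign. Since \<open>x\<close> differs from every such letter, the
  end lies on a definite side of \<open>x\<close>.\<close>

lemma expansion_comb:
  assumes "x \<notin> set cs"
  shows "expansion (comb x cs) (rev us @ x # vs) = (comb_coeff us vs cs :: 'k::comm_ring_1)"
  using assms
proof (induction cs arbitrary: us vs rule: rev_induct)
  case (snoc c cs)
  have 1: "(if last (rev us @ x # vs) = c then expansion (comb x cs) (butlast (rev us @ x # vs)) else 0)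
      = (if vs \<noteq> [] \<and> last vs = c then comb_coeff us (butlast vs) cs else (0::'k))"
    using snoc by (cases vs rule: rev_cases) (auto simp: butlast_append)
  have 2: "(if hd (rev us @ x # vs) = c then expansion (comb x cs) (tl (rev us @ x # vs)) else 0)
      = (if us \<noteq> [] \<and> last us = c then comb_coeff (butlast us) vs cs else (0::'k))"
    using snoc by (cases us rule: rev_cases) auto
  show ?case
    unfolding comb_simps expansion.simps lie_conv_def conv_letter_left conv_letter_right comb_coeff_snoc
    using 1 2 by simp
qed (auto simp: append_eq_Cons_conv)

text \<open>The duality of combs with the words that begin with \<open>x\<close>: every letter must
  have been added on the right.\<close>

lemma comb_coeff_Nil: "comb_coeff [] vs cs = (if vs = cs then 1 else 0)"
  by (induction cs arbitrary: vs) (auto split: list.splits)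

lemma conv_map:
  assumes "inj h"
  shows "conv f g (map h w) = conv (\<lambda>u. f (map h u)) (\<lambda>u. g (map h u)) w"
  by (induction w arbitrary: f) auto

lemma expansion_map:
  assumes "inj h"
  shows "expansion (map_monomial h t) (map h w) = expansion t w"
proof (induction t arbitrary: w)
  case (Gen x)
  then show ?case using assms by (cases w) (auto dest: injD)
next
  case (Br s t)
  show ?case by (simp add: lie_conv_def conv_map[OF assms] Br)
qed

primrec distinct_leaves :: "'x monomial \<Rightarrow> bool" where
  "distinct_leaves (Gen x) = True"
| "distinct_leaves (Br s t) = (distinct_leaves s \<and> distinct_leaves t \<and> set_monomial s \<inter> set_monomial t = {})"

lemma degree_in_pos: "(x :: 'x) \<in> set_monomial t \<longleftrightarrow> degree_in x t > 0"
  by (induction t) auto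

lemma degree_in_distinct_leaves: "(\<And>x :: 'x. degree_in x t \<le> 1) \<Longrightarrow> distinct_leaves t"
proof (induction t)
  case (Br s t)
  have "degree_in x s \<le> 1 \<and> degree_in x t \<le> 1 \<and> \<not> (degree_in x s > 0 \<and> degree_in x t > 0)" for x
    using Br.prems[of x] by auto
  then show ?case using Br.IH by (simp add: degree_in_pos disjoint_iff) (metis not_gr_zero)
qed simp

section \<open>Comb monomials span the multilinear part of the free Lie algebra\<close>

context
  fixes X :: "'x set"
begin

abbreviation (input) "NA \<equiv> free_nonassoc_algebra X :: ('k::comm_ring_1, 'x monomial \<Rightarrow>\<^sub>0 'k, 'x \<Rightarrow> 'x) gmodule"

lemma nonassoc_simps:
  "carrier (NA :: ('k::comm_ring_1, _, _) gmodule) = {f. Poly_Mapping.keys f \<subseteq> {t. set_monomial t \<subseteq> X}}"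
  "monoid.mult (NA :: ('k::comm_ring_1, _, _) gmodule) = monomial_mult"
  "add (NA :: ('k::comm_ring_1, _, _) gmodule) = (+)" "\<zero>\<^bsub>NA :: ('k::comm_ring_1, _, _) gmodule\<^esub> = 0"
  "smult (NA :: ('k::comm_ring_1, _, _) gmodule) = pm_scale"
  "act (NA :: ('k::comm_ring_1, _, _) gmodule) g = pm_map (map_monomial g)"
  by (simp_all add: free_nonassoc_algebra_def free_gmodule_def)

lemma formal_module_nonassoc: "formal_module NA"
  by (simp add: formal_module_def nonassoc_simps)

lemma module_nonassoc: "module type_ring (NA :: ('k::comm_ring_1, _, _) gmodule)"
proof -
  \<comment> \<open>\<open>is_gmodule_formal\<close> asks for a group; the trivial one suffices to
    obtain the module axioms.\<close>
  let ?G = "\<lparr>carrier = {id}, mult = (\<circ>), one = id\<rparr> :: ('x \<Rightarrow> 'x) monoid"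
  have "group ?G" by (rule groupI) auto
  then have "is_gmodule type_ring ?G (NA :: ('k, _, _) gmodule)"
  proof (rule is_gmodule_formal[OF formal_module_nonassoc])
    fix x y :: "'x monomial \<Rightarrow>\<^sub>0 'k" and c :: 'k
    show "x + y \<in> carrier NA" if "x \<in> carrier NA" "y \<in> carrier NA"
      using that keys_add[of x y] unfolding nonassoc_simps by auto
    show "pm_scale c x \<in> carrier NA" if "x \<in> carrier NA"
      using that keys_pm_scale[of c x] unfolding nonassoc_simps by auto
  qed (auto simp: nonassoc_simps monomial.map_id0)
  then show ?thesis by (rule is_gmoduleD)
qed

lemma nonassoc_closed:
  "0 \<in> carrier NA" "\<And>x y. x \<in> carrier NA \<Longrightarrow> y \<in> carrier NA \<Longrightarrow> x + y \<in> carrier NA"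
  "\<And>x y. x \<in> carrier NA \<Longrightarrow> y \<in> carrier NA \<Longrightarrow> x - y \<in> carrier NA"
  "\<And>c x. x \<in> carrier NA \<Longrightarrow> pm_scale c x \<in> carrier NA"
  "\<And>x. x \<in> carrier NA \<Longrightarrow> - x \<in> carrier NA"
  using formal_submodule[OF formal_module_nonassoc module.carrier_is_submodule[OF module_nonassoc]] by auto

lemma monomial_mult_closed:
  "f \<in> carrier NA \<Longrightarrow> g \<in> carrier NA \<Longrightarrow> monomial_mult f g \<in> carrier NA"
  unfolding monomial_mult_lin_ext nonassoc_simps by (intro CollectI keys_lin_ext_subset) auto

lemma monomial_mult_bilinear:
  "monomial_mult (f + f') g = monomial_mult f g + monomial_mult f' g"
  "monomial_mult f (g + g') = monomial_mult f g + monomial_mult f g'"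
  "monomial_mult (f - f') g = monomial_mult f g - monomial_mult f' g"
  "monomial_mult f (g - g') = monomial_mult f g - monomial_mult f g'"
  "monomial_mult (- f) g = - monomial_mult f g"
  "monomial_mult f (- g) = - monomial_mult f g"
  "monomial_mult (pm_scale c f) g = pm_scale c (monomial_mult f g)"
  "monomial_mult f (pm_scale c g) = pm_scale c (monomial_mult f g)"
  "monomial_mult 0 g = 0" "monomial_mult f 0 = 0"
  "monomial_mult (Poly_Mapping.single s a) (Poly_Mapping.single t b) = Poly_Mapping.single (Br s t) (a * b)"
  by (simp_all add: monomial_mult_lin_ext lin_ext_simps lin_ext_add_fun lin_ext_diff_fun lin_ext_uminus_fun lin_ext_scale_fun)

abbreviation (input) "LI \<equiv> lie_ideal X :: ('x monomial \<Rightarrow>\<^sub>0 'k::comm_ring_1) set"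

lemma two_sided_ideal_nonassoc_iff:
  "two_sided_ideal NA J \<longleftrightarrow> submodule J type_ring NA \<and>
     (\<forall>a\<in>carrier NA. \<forall>j\<in>J. monomial_mult a j \<in> J \<and> monomial_mult j a \<in> J)"
  by (simp add: two_sided_ideal_def nonassoc_simps)

lemma lie_ideal_least:
  fixes J :: "('x monomial \<Rightarrow>\<^sub>0 'k::comm_ring_1) set"
  assumes "two_sided_ideal NA J" "\<And>a. a \<in> carrier NA \<Longrightarrow> monomial_mult a a \<in> J"
    "\<And>a b c. a \<in> carrier NA \<Longrightarrow> b \<in> carrier NA \<Longrightarrow> c \<in> carrier NA \<Longrightarrow>
      monomial_mult a (monomial_mult b c) + monomial_mult b (monomial_mult c a) + monomial_mult c (monomial_mult a b) \<in> J"
  shows "LI \<subseteq> J"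
  unfolding lie_ideal_def Let_def by (rule hull_minimal) (use assms in \<open>auto simp: nonassoc_simps\<close>)

lemma lie_ideal_relations:
  "a \<in> carrier NA \<Longrightarrow> monomial_mult a a \<in> LI"
  "a \<in> carrier NA \<Longrightarrow> b \<in> carrier NA \<Longrightarrow> c \<in> carrier NA \<Longrightarrow>
      monomial_mult a (monomial_mult b c) + monomial_mult b (monomial_mult c a) + monomial_mult c (monomial_mult a b) \<in> LI"
  unfolding lie_ideal_def Let_def nonassoc_simps by (rule hull_inc; blast)+

text \<open>A hull need not have the property it is formed with. Here it does, being an intersection
  of two-sided ideals, among them the whole algebra.\<close>

lemma lie_ideal_ideal: "two_sided_ideal NA LI"
proof -
  let ?R = "{a \<otimes>\<^bsub>NA\<^esub> a | a. a \<in> carrier NA} \<union>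
            {a \<otimes>\<^bsub>NA\<^esub> (b \<otimes>\<^bsub>NA\<^esub> c) \<oplus>\<^bsub>NA\<^esub> b \<otimes>\<^bsub>NA\<^esub> (c \<otimes>\<^bsub>NA\<^esub> a) \<oplus>\<^bsub>NA\<^esub> c \<otimes>\<^bsub>NA\<^esub> (a \<otimes>\<^bsub>NA\<^esub> b)
               | a b c. a \<in> carrier NA \<and> b \<in> carrier NA \<and> c \<in> carrier NA}"
  have car: "two_sided_ideal NA (carrier NA)"
    unfolding two_sided_ideal_nonassoc_iff
    using module.carrier_is_submodule[OF module_nonassoc] monomial_mult_closed by blast
  have R: "?R \<subseteq> carrier NA"
    unfolding nonassoc_simps(2,3) by (auto intro!: nonassoc_closed(2) monomial_mult_closed)
  have LI: "LI = \<Inter>{J. two_sided_ideal NA J \<and> ?R \<subseteq> J}"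
    unfolding lie_ideal_def Let_def hull_def by auto
  have sub: "J \<in> {J. two_sided_ideal NA J \<and> ?R \<subseteq> J} \<Longrightarrow> submodule J type_ring NA" for J
    by (simp add: two_sided_ideal_def)
  have "submodule LI type_ring NA"
  proof (rule module_submoduleI[OF module_nonassoc])
    show "LI \<subseteq> carrier NA" unfolding LI using car R by blast
    show "\<zero>\<^bsub>NA\<^esub> \<in> LI" unfolding LI by (intro InterI) (rule submoduleD(1)[OF sub])
    fix x y c assume x: "x \<in> LI"
    show "x \<oplus>\<^bsub>NA\<^esub> y \<in> LI" if "y \<in> LI"
      using x that unfolding LI by (intro InterI) (rule submoduleD(2)[OF sub]; blast)
    show "c \<odot>\<^bsub>NA\<^esub> x \<in> LI"
      using x unfolding LI by (intro InterI) (rule submoduleD(3)[OF sub]; blast)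
  qed
  moreover have "monomial_mult a j \<in> LI \<and> monomial_mult j a \<in> LI" if "a \<in> carrier NA" "j \<in> LI" for a j
    using that unfolding LI two_sided_ideal_nonassoc_iff by blast
  ultimately show ?thesis unfolding two_sided_ideal_nonassoc_iff by blast
qed
lemma submodule_lie_ideal:
  "submodule (lie_ideal X :: ('x monomial \<Rightarrow>\<^sub>0 'k::comm_ring_1) set) (type_ring :: 'k ring) NA"
  by (rule conjunct1[OF lie_ideal_ideal[unfolded two_sided_ideal_def]])

lemma lie_ideal_mult:
  "a \<in> carrier NA \<Longrightarrow> j \<in> lie_ideal X \<Longrightarrow> monomial_mult a j \<in> lie_ideal X"
  "a \<in> carrier NA \<Longrightarrow> j \<in> lie_ideal X \<Longrightarrow> monomial_mult j a \<in> lie_ideal X"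
  using lie_ideal_ideal unfolding two_sided_ideal_nonassoc_iff by blast+

lemmas lie_ideal_closed = formal_submodule[OF formal_module_nonassoc submodule_lie_ideal]

text \<open>Polarization: expand the square of \<open>a + b\<close>. This is valid in every
  characteristic.\<close>

lemma lie_ideal_antisym:
  assumes "a \<in> carrier NA" "b \<in> carrier NA"
  shows "monomial_mult a b + monomial_mult b a \<in> lie_ideal X"
proof -
  have "monomial_mult (a + b) (a + b) - monomial_mult a a - monomial_mult b b \<in> lie_ideal X"
    using assms by (intro lie_ideal_closed(5) lie_ideal_relations(1) nonassoc_closed(2))
  then show ?thesis by (simp add: monomial_mult_bilinear algebra_simps)
qed

text \<open>The Jacobi expression with its factors brought into left-normed order by antisymmetry.
  It reduces multiplication by a bracket to successive multiplications by its factors.\<close>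

lemma lie_ideal_leibniz:
  assumes "a \<in> carrier NA" "b \<in> carrier NA" "c \<in> carrier NA"
  shows "monomial_mult a (monomial_mult b c)
     - (monomial_mult (monomial_mult a b) c - monomial_mult (monomial_mult a c) b) \<in> lie_ideal X"
proof -
  let ?m = monomial_mult
  have "(?m a (?m b c) + ?m b (?m c a) + ?m c (?m a b)) - (?m b (?m c a) + ?m (?m c a) b)
     - (?m c (?m a b) + ?m (?m a b) c) + ?m (?m c a + ?m a c) b \<in> lie_ideal X"
    using assms by (intro lie_ideal_closed(2,5) lie_ideal_mult(2) lie_ideal_relations(2) lie_ideal_antisym monomial_mult_closed)
  then show ?thesis by (simp add: monomial_mult_bilinear algebra_simps)
qed

text \<open>Working with representatives rather than cosets keeps \<open>monomial_mult\<close> and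
  its bilinearity at hand.\<close>

definition comb_class :: "'x \<Rightarrow> 'x set \<Rightarrow> ('x monomial \<Rightarrow>\<^sub>0 'k::comm_ring_1) set" where
  "comb_class x V = {f \<in> carrier NA. \<exists>g. Poly_Mapping.keys g \<subseteq> {cs. distinct cs \<and> set cs = V} \<and>
     f - pm_map (comb x) g \<in> lie_ideal X}"

lemma comb_class_diff:
  assumes "f \<in> comb_class x V" "f' \<in> comb_class x V"
  shows "f - f' \<in> comb_class x V"
proof -
  obtain g g' where g: "Poly_Mapping.keys g \<subseteq> {cs. distinct cs \<and> set cs = V}" "f - pm_map (comb x) g \<in> lie_ideal X"
    "Poly_Mapping.keys g' \<subseteq> {cs. distinct cs \<and> set cs = V}" "f' - pm_map (comb x) g' \<in> lie_ideal X"
    using assms unfolding comb_class_def by blast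
  have "(f - f') - pm_map (comb x) (g - g') = (f - pm_map (comb x) g) - (f' - pm_map (comb x) g')"
    by (simp add: lin_ext_diff algebra_simps)
  then have "(f - f') - pm_map (comb x) (g - g') \<in> lie_ideal X" using lie_ideal_closed(5)[OF g(2,4)] by (simp only:)
  moreover have "Poly_Mapping.keys (g - g') \<subseteq> {cs. distinct cs \<and> set cs = V}"
    by (rule keys_diff_subset[OF g(1,3)])
  ultimately show ?thesis using assms nonassoc_closed(3) unfolding comb_class_def by blast
qed

lemma comb_class_cong:
  assumes "f \<in> comb_class x V" "f' \<in> carrier NA" "f' - f \<in> lie_ideal X"
  shows "f' \<in> comb_class x V"
proof -
  obtain g where g: "Poly_Mapping.keys g \<subseteq> {cs. distinct cs \<and> set cs = V}" "f - pm_map (comb x) g \<in> lie_ideal X"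
    using assms unfolding comb_class_def by blast
  have "f' - pm_map (comb x) g \<in> lie_ideal X" using lie_ideal_closed(2)[OF assms(3) g(2)] by simp
  then show ?thesis using g(1) assms(2) unfolding comb_class_def by blast
qed

lemma single_nonassoc: "set_monomial t \<subseteq> X \<Longrightarrow> Poly_Mapping.single t 1 \<in> carrier NA"
  by (simp add: nonassoc_simps)

text \<open>A letter extends each comb at its end. A bracket is replaced by
  \<open>lie_ideal_leibniz\<close> with products by its two factors in both orders, to which the
  induction hypotheses apply.\<close>

lemma comb_class_mult:
  fixes f :: "'x monomial \<Rightarrow>\<^sub>0 'k::comm_ring_1"
  assumes "f \<in> comb_class x V" "distinct_leaves u" "set_monomial u \<subseteq> X" "set_monomial u \<inter> V = {}"
  shows "monomial_mult f (Poly_Mapping.single u 1) \<in> comb_class x (V \<union> set_monomial u)"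
  using assms
proof (induction u arbitrary: f V)
  case (Gen y)
  obtain g where g: "Poly_Mapping.keys g \<subseteq> {cs. distinct cs \<and> set cs = V}" "f - pm_map (comb x) g \<in> lie_ideal X"
    and f: "f \<in> carrier NA"
    using Gen.prems(1) unfolding comb_class_def by blast
  have y: "Poly_Mapping.single (Gen y) 1 \<in> carrier NA" using Gen.prems by (intro single_nonassoc) simp
  have "monomial_mult (f - pm_map (comb x) g) (Poly_Mapping.single (Gen y) 1) \<in> lie_ideal X"
    using g(2) y by (rule lie_ideal_mult(2)[rotated])
  moreover have "monomial_mult (pm_map (comb x) g) (Poly_Mapping.single (Gen y) 1)
      = pm_map (comb x) (pm_map (\<lambda>cs. cs @ [y]) g)"
    by (simp add: monomial_mult_lin_ext lin_ext_lin_ext)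
  ultimately have "monomial_mult f (Poly_Mapping.single (Gen y) 1) - pm_map (comb x) (pm_map (\<lambda>cs. cs @ [y]) g) \<in> lie_ideal X"
    by (simp add: monomial_mult_bilinear)
  moreover have "Poly_Mapping.keys (pm_map (\<lambda>cs. cs @ [y]) g) \<subseteq> {cs. distinct cs \<and> set cs = V \<union> set_monomial (Gen y)}"
    using g(1) Gen.prems by (intro order_trans[OF keys_pm_map]) auto
  ultimately show ?case using monomial_mult_closed[OF f y] unfolding comb_class_def by blast
next
  case (Br u v)
  let ?s = "\<lambda>t. Poly_Mapping.single t 1 :: 'x monomial \<Rightarrow>\<^sub>0 'k"
  have f: "f \<in> carrier NA" using Br.prems unfolding comb_class_def by blast
  have uv: "?s u \<in> carrier NA" "?s v \<in> carrier NA" using Br.prems by (auto intro!: single_nonassoc)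
  have "monomial_mult (monomial_mult f (?s u)) (?s v) \<in> comb_class x (V \<union> set_monomial u \<union> set_monomial v)"
    using Br.prems by (intro Br.IH) auto
  moreover have "monomial_mult (monomial_mult f (?s v)) (?s u) \<in> comb_class x (V \<union> set_monomial v \<union> set_monomial u)"
    using Br.prems by (intro Br.IH) auto
  ultimately have "monomial_mult (monomial_mult f (?s u)) (?s v) - monomial_mult (monomial_mult f (?s v)) (?s u)
      \<in> comb_class x (V \<union> set_monomial (Br u v))"
    by (intro comb_class_diff) (simp_all add: Un_ac)
  then have "monomial_mult f (monomial_mult (?s u) (?s v)) \<in> comb_class x (V \<union> set_monomial (Br u v))"
    by (rule comb_class_cong[OF _ monomial_mult_closed[OF f monomial_mult_closed[OF uv]] lie_ideal_leibniz[OF f uv]])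
  then show ?case by (simp add: monomial_mult_bilinear)
qed

text \<open>The factor containing \<open>x\<close> is a combination of combs by induction and
  absorbs the other one by \<open>comb_class_mult\<close>; antisymmetry exchanges the factors if
  \<open>x\<close> lies in the second.\<close>

lemma monomial_in_comb_class:
  assumes "distinct_leaves t" "set_monomial t \<subseteq> X" "x \<in> set_monomial t"
  shows "(Poly_Mapping.single t 1 :: 'x monomial \<Rightarrow>\<^sub>0 'k::comm_ring_1) \<in> comb_class x (set_monomial t - {x})"
  using assms
proof (induction t)
  case (Gen y)
  then have "Poly_Mapping.single (Gen y) 1 - pm_map (comb x) (Poly_Mapping.single [] (1::'k)) \<in> lie_ideal X"
    using lie_ideal_closed(1) by simp
  moreover have "Poly_Mapping.keys (Poly_Mapping.single [] (1::'k)) \<subseteq> {cs. distinct cs \<and> set cs = set_monomial (Gen y) - {x}}"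
    using Gen by (auto split: if_splits)
  ultimately show ?case using single_nonassoc[of "Gen y"] Gen.prems unfolding comb_class_def by blast
next
  case (Br s t)
  let ?s = "\<lambda>t. Poly_Mapping.single t 1 :: 'x monomial \<Rightarrow>\<^sub>0 'k"
  have st: "?s s \<in> carrier NA" "?s t \<in> carrier NA" "?s (Br s t) \<in> carrier NA"
    using Br.prems by (auto intro!: single_nonassoc)
  show ?case
  proof (cases "x \<in> set_monomial s")
    case True
    have "monomial_mult (?s s) (?s t) \<in> comb_class x (set_monomial s - {x} \<union> set_monomial t)"
      using Br True by (intro comb_class_mult) auto
    moreover have "set_monomial s - {x} \<union> set_monomial t = set_monomial (Br s t) - {x}"
      using Br.prems True by auto
    ultimately show ?thesis by (simp add: monomial_mult_bilinear)
  next
    case False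
    then have x: "x \<in> set_monomial t" using Br.prems by auto
    have "monomial_mult (?s t) (?s s) \<in> comb_class x (set_monomial t - {x} \<union> set_monomial s)"
      using Br x by (intro comb_class_mult) auto
    moreover have eq: "set_monomial t - {x} \<union> set_monomial s = set_monomial (Br s t) - {x}"
      using Br.prems x by auto
    ultimately have ts: "monomial_mult (?s t) (?s s) \<in> comb_class x (set_monomial (Br s t) - {x})" by simp
    \<comment> \<open>Zero is obtained as the difference of an element with itself, and negatives
      from it.\<close>
    have "0 - monomial_mult (?s t) (?s s) \<in> comb_class x (set_monomial (Br s t) - {x})"
      using comb_class_diff[OF comb_class_diff[OF ts ts] ts] by simp
    then show ?thesis
      by (rule comb_class_cong) (use st lie_ideal_antisym[OF st(1,2)] in \<open>auto simp: monomial_mult_bilinear\<close>)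
  qed
qed

text \<open>The elements with zero expansion form a two-sided ideal that contains the squares and,
  by \<open>lie_conv_jacobi\<close>, the Jacobi expressions. Hence coefficients of words are defined
  on the free Lie algebra.\<close>

lemma expansion_lie_ideal:
  fixes f :: "'x monomial \<Rightarrow>\<^sub>0 'k::comm_ring_1"
  assumes "f \<in> lie_ideal X"
  shows "pm_eval (\<lambda>t. expansion t w) f = 0"
proof -
  let ?e = "\<lambda>f w. pm_eval (\<lambda>t. expansion t w) f"
  let ?J = "{f \<in> carrier NA. \<forall>w. ?e f w = 0} :: ('x monomial \<Rightarrow>\<^sub>0 'k) set"
  have z: "lie_conv f g = (\<lambda>_. 0)" if "f = (\<lambda>_. 0) \<or> g = (\<lambda>_. 0)" for f g :: "'x list \<Rightarrow> 'k"
    using that unfolding lie_conv_def[abs_def] by (auto simp: conv_left_linear conv_right_linear)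
  have "submodule ?J type_ring NA"
  proof (rule module_submoduleI[OF module_nonassoc])
    fix a b :: "'x monomial \<Rightarrow>\<^sub>0 'k" and c :: 'k
    assume "a \<in> ?J"
    then show "c \<odot>\<^bsub>NA\<^esub> a \<in> ?J" "b \<in> ?J \<Longrightarrow> a \<oplus>\<^bsub>NA\<^esub> b \<in> ?J"
      using nonassoc_closed(2,4) unfolding nonassoc_simps(3,4,5) by (auto simp: pm_eval_add pm_eval_scale)
  qed (auto simp: nonassoc_simps)
  moreover have "monomial_mult a j \<in> ?J \<and> monomial_mult j a \<in> ?J" if "a \<in> carrier NA" "j \<in> ?J" for a j
    using that monomial_mult_closed by (auto simp: pm_eval_expansion_mult z)
  ultimately have "two_sided_ideal NA ?J" unfolding two_sided_ideal_nonassoc_iff by blast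
  moreover have "monomial_mult a a \<in> ?J" if "a \<in> carrier NA" for a
    using that monomial_mult_closed by (auto simp: pm_eval_expansion_mult lie_conv_def)
  moreover have "monomial_mult a (monomial_mult b c) + monomial_mult b (monomial_mult c a) + monomial_mult c (monomial_mult a b) \<in> ?J"
    if "a \<in> carrier NA" "b \<in> carrier NA" "c \<in> carrier NA" for a b c
    using that by (auto simp: pm_eval_expansion_mult[abs_def] pm_eval_add lie_conv_jacobi
        intro!: monomial_mult_closed nonassoc_closed(2))
  ultimately have "lie_ideal X \<subseteq> ?J" by (rule lie_ideal_least)
  then show ?thesis using assms by blast
qed

end

section \<open>Functionals on the Lie operad\<close>

lemma degree_in_map: "inj g \<Longrightarrow> degree_in (g i) (map_monomial g t) = degree_in i t"
  by (induction t) (auto dest: injD)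

lemma finite_words: "finite A \<Longrightarrow> finite {xs. distinct xs \<and> set xs = A}"
  by (rule finite_subset[OF _ finite_lists_length_eq[of A "card A"]]) (auto simp: distinct_card)

text \<open>The word is read as the permutation from positions to letters, fixed outside
  \<open>{1..r}\<close>; \<open>i - 1\<close> accounts for list positions starting at zero.\<close>

definition word_sign :: "nat \<Rightarrow> nat list \<Rightarrow> 'k::comm_ring_1" where
  "word_sign r xs = of_int (sign (\<lambda>i. if i \<in> {1..r} then xs ! (i - 1) else i))"

definition words :: "nat \<Rightarrow> nat list set" where
  "words r = {xs. distinct xs \<and> set xs = {1..r}}"

lemma words_length: "xs \<in> words r \<Longrightarrow> length xs = r"
  using distinct_card[of xs] by (auto simp: words_def)

lemma word_permutes:
  assumes "xs \<in> words r"
  shows "(\<lambda>i. if i \<in> {1..r} then xs ! (i - 1) else i) permutes {1..r}"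
proof (rule bij_imp_permutes)
  have len: "length xs = r" by (rule words_length[OF assms])
  have "bij_betw (\<lambda>i. xs ! (i - 1)) {1..r} {1..r}"
  proof (rule bij_betw_trans[of "\<lambda>i. i - 1" _ "{..<r}" "\<lambda>i. xs ! i", unfolded comp_def])
    show "bij_betw (\<lambda>i. i - 1) {1..r} {..<r}"
      by (rule bij_betw_byWitness[where f' = Suc]) auto
    show "bij_betw (\<lambda>i. xs ! i) {..<r} {1..r}"
      using bij_betw_nth[of xs "{..<r}" "{1..r}"] assms len by (auto simp: words_def)
  qed
  then show "bij_betw (\<lambda>i. if i \<in> {1..r} then xs ! (i - 1) else i) {1..r} {1..r}"
    by (rule bij_betw_cong[THEN iffD1, rotated]) auto
qed auto

lemma word_sign_square: "xs \<in> words r \<Longrightarrow> word_sign r xs * word_sign r xs = (1 :: 'k::comm_ring_1)"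
  unfolding word_sign_def by (simp add: sign_def)

lemma word_sign_map:
  assumes "g permutes {1..r}" "xs \<in> words r"
  shows "word_sign r (map g xs) = of_int (sign g) * (word_sign r xs :: 'k::comm_ring_1)"
proof -
  have "(\<lambda>i. if i \<in> {1..r} then map g xs ! (i - 1) else i) = g \<circ> (\<lambda>i. if i \<in> {1..r} then xs ! (i - 1) else i)"
  proof
    fix i
    show "(if i \<in> {1..r} then map g xs ! (i - 1) else i) = (g \<circ> (\<lambda>i. if i \<in> {1..r} then xs ! (i - 1) else i)) i"
      using words_length[OF assms(2)] permutes_not_in[OF assms(1), of i] by (cases "i \<in> {1..r}") auto
  qed
  moreover have "permutation g" "permutation (\<lambda>i. if i \<in> {1..r} then xs ! (i - 1) else i)"
    using assms(1) word_permutes[OF assms(2)] by (auto simp: permutation_permutes)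
  ultimately show ?thesis unfolding word_sign_def by (simp add: sign_compose)
qed

text \<open>Exchanging neighbours acts on positions, by a transposition on the right, whereas the
  relabelling in \<open>word_sign_map\<close> composes on the left.\<close>

lemma word_sign_swap:
  assumes "u @ a # b # v \<in> words r"
  shows "word_sign r (u @ a # b # v) = - (word_sign r (u @ b # a # v) :: 'k::comm_ring_1)"
proof -
  let ?p = "\<lambda>xs i. if i \<in> {1..r} then xs ! (i - 1) else i"
  let ?n = "Suc (length u)"
  have len: "length (u @ a # b # v) = r" by (rule words_length[OF assms])
  have w: "u @ b # a # v \<in> words r" using assms by (auto simp: words_def)
  have "?p (u @ a # b # v) = ?p (u @ b # a # v) \<circ> transpose ?n (Suc ?n)"
  proof
    fix i
    consider "i = ?n" | "i = Suc ?n" | "i \<noteq> ?n" "i \<noteq> Suc ?n" by blast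
    then show "?p (u @ a # b # v) i = (?p (u @ b # a # v) \<circ> transpose ?n (Suc ?n)) i"
      by cases (use len in \<open>auto simp: nth_append transpose_def nth_Cons' split: if_splits\<close>)
  qed
  moreover have "permutation (?p (u @ b # a # v))" using word_permutes[OF w] by (auto simp: permutation_permutes)
  ultimately have "sign (?p (u @ a # b # v)) = - sign (?p (u @ b # a # v))"
    by (simp add: sign_compose permutation_swap_id sign_swap_id)
  then show ?thesis unfolding word_sign_def by simp
qed

text \<open>The variable \<open>ty\<close> only serves to fix the coefficient ring \<open>'k\<close> in the following context.\<close>

context
  fixes r :: nat and ty :: "'k::comm_ring_1 itself"
begin

abbreviation (input) "NR \<equiv> free_nonassoc_algebra {1..r} :: ('k, nat monomial \<Rightarrow>\<^sub>0 'k, nat \<Rightarrow> nat) gmodule"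
abbreviation (input) "LA \<equiv> free_lie_algebra {1..r} :: ('k, (nat monomial \<Rightarrow>\<^sub>0 'k) set, nat \<Rightarrow> nat) gmodule"
abbreviation (input) "LO \<equiv> Lie_operad r :: ('k, (nat monomial \<Rightarrow>\<^sub>0 'k) set, nat \<Rightarrow> nat) gmodule"
abbreviation (input) "lc a \<equiv> lie_ideal {1..r} +>\<^bsub>NR\<^esub> a"
abbreviation (input) "multilinear t \<equiv> set_monomial t \<subseteq> {1..r} \<and> (\<forall>i\<in>{1..r}. degree_in i t = 1)"

lemma is_gmodule_NR: "is_gmodule (type_ring :: 'k ring) (sym_group r) NR"
proof (rule is_gmodule_formal[OF formal_module_nonassoc sym_group_is_group])
  fix g and x :: "nat monomial \<Rightarrow>\<^sub>0 'k" assume g: "g \<in> carrier (sym_group r)" and x: "x \<in> carrier NR"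
  then have "g ` {1..r} = {1..r}" by (simp add: sym_group_carrier permutes_image)
  then have "set_monomial (map_monomial g t) \<subseteq> {1..r}" if "set_monomial t \<subseteq> {1..r}" for t
    using that by (auto simp: monomial.set_map)
  then show "act NR g x \<in> carrier NR"
    using x unfolding nonassoc_simps by (auto dest!: subsetD[OF keys_pm_map])
next
  show "0 \<in> carrier NR" "\<And>x y. x \<in> carrier NR \<Longrightarrow> y \<in> carrier NR \<Longrightarrow> x + y \<in> carrier NR"
    "\<And>c x. x \<in> carrier NR \<Longrightarrow> pm_scale c x \<in> carrier NR"
    by (rule nonassoc_closed; assumption)+
next
  fix g h and x :: "nat monomial \<Rightarrow>\<^sub>0 'k"
  show "pm_linear (act NR g)" by (simp add: nonassoc_simps)
  show "act NR \<one>\<^bsub>sym_group r\<^esub> x = x" by (simp add: nonassoc_simps sym_group_one monomial.map_id)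
  show "act NR (g \<otimes>\<^bsub>sym_group r\<^esub> h) x = act NR g (act NR h x)"
    by (simp add: nonassoc_simps sym_group_mult pm_map_pm_map monomial.map_comp)
qed

lemma act_mult: "pm_map (map_monomial g) (monomial_mult a b)
    = monomial_mult (pm_map (map_monomial g) a) (pm_map (map_monomial g) b)"
  by (simp add: monomial_mult_lin_ext lin_ext_lin_ext)

text \<open>Relabelling respects products, so the elements that \<open>g\<close> moves into the
  ideal form a two-sided ideal containing the defining relations.\<close>

lemma act_lie_ideal:
  assumes g: "g \<in> carrier (sym_group r)" and n: "n \<in> lie_ideal {1..r}"
  shows "act NR g n \<in> lie_ideal {1..r}"
proof -
  let ?J = "{n \<in> carrier NR. act NR g n \<in> lie_ideal {1..r}}"
  note D = is_gmoduleD(9)[OF is_gmodule_NR g, unfolded nonassoc_simps(6)]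
  have "submodule ?J type_ring NR"
  proof (rule module_submoduleI[OF module_nonassoc])
    fix a b :: "nat monomial \<Rightarrow>\<^sub>0 'k" and c :: 'k assume a: "a \<in> ?J"
    show "c \<odot>\<^bsub>NR\<^esub> a \<in> ?J"
      using a nonassoc_closed(4) lie_ideal_closed(3) unfolding nonassoc_simps(3,4,5,6) by (auto simp: lin_ext_scale)
    show "a \<oplus>\<^bsub>NR\<^esub> b \<in> ?J" if "b \<in> ?J"
      using a that nonassoc_closed(2) lie_ideal_closed(2) unfolding nonassoc_simps(3,4,5,6) by (auto simp: lin_ext_add)
  qed (use lie_ideal_closed(1) in \<open>auto simp: nonassoc_simps\<close>)
  moreover have "monomial_mult a j \<in> ?J \<and> monomial_mult j a \<in> ?J" if "a \<in> carrier NR" "j \<in> ?J" for a j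
  proof -
    have j: "j \<in> carrier NR" "pm_map (map_monomial g) j \<in> lie_ideal {1..r}"
      using that(2) unfolding nonassoc_simps(6) mem_Collect_eq by simp_all
    show ?thesis
      unfolding nonassoc_simps(6) mem_Collect_eq act_mult
      by (intro conjI monomial_mult_closed lie_ideal_mult D that(1) j)
  qed
  ultimately have "two_sided_ideal NR ?J" unfolding two_sided_ideal_nonassoc_iff by blast
  moreover have "monomial_mult a a \<in> ?J" if "a \<in> carrier NR" for a
    unfolding nonassoc_simps(6) mem_Collect_eq act_mult
    by (intro conjI monomial_mult_closed lie_ideal_relations(1) D that)
  moreover have "monomial_mult a (monomial_mult b c) + monomial_mult b (monomial_mult c a) + monomial_mult c (monomial_mult a b) \<in> ?J"
    if "a \<in> carrier NR" "b \<in> carrier NR" "c \<in> carrier NR" for a b c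
    unfolding nonassoc_simps(6) mem_Collect_eq act_mult lin_ext_add
    by (intro conjI monomial_mult_closed nonassoc_closed(2) lie_ideal_relations(2) D that)
  ultimately have "lie_ideal {1..r} \<subseteq> ?J" by (rule lie_ideal_least)
  then show ?thesis using n by blast
qed

lemmas lie_coset_eq_iff = coset_eq_iff[OF formal_module_nonassoc submodule_lie_ideal]

lemma free_lie_simps:
  "carrier LA = lc ` carrier NR"
  "\<zero>\<^bsub>LA\<^esub> = lc 0"
  "lc a \<oplus>\<^bsub>LA\<^esub> lc b = lc (a + b)"
  "c \<odot>\<^bsub>LA\<^esub> lc a = lc (pm_scale c a)"
  "g \<in> carrier (sym_group r) \<Longrightarrow> a \<in> carrier NR \<Longrightarrow> act LA g (lc a) = lc (pm_map (map_monomial g) a)"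
  unfolding free_lie_algebra_def coset_zero[OF formal_module_nonassoc submodule_lie_ideal]
  by (rule quotient_simps[OF formal_module_nonassoc submodule_lie_ideal] coset_smult[OF formal_module_nonassoc submodule_lie_ideal]
    coset_act[OF formal_module_nonassoc submodule_lie_ideal is_gmodule_NR _ _ act_lie_ideal, unfolded nonassoc_simps(6)];
    assumption)+

lemma is_gmodule_free_lie: "is_gmodule (type_ring :: 'k ring) (sym_group r) LA"
  unfolding free_lie_algebra_def
  by (rule is_gmodule_quotient[OF formal_module_nonassoc submodule_lie_ideal is_gmodule_NR act_lie_ideal])

lemma Lie_operad_eq: "LO = LA\<lparr>carrier := submodule_span LA {lc (Poly_Mapping.single t 1) | t. multilinear t}\<rparr>"
  by (simp add: Lie_operad_def lie_monomial_def Let_def)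

lemma lie_generators_carrier: "{lc (Poly_Mapping.single t 1) | t. multilinear t} \<subseteq> carrier LA"
  unfolding free_lie_simps using single_nonassoc by auto

lemma submodule_Lie_operad: "submodule (carrier LO) type_ring LA"
  unfolding Lie_operad_eq
  using submodule_submodule_span[OF is_gmoduleD(1)[OF is_gmodule_free_lie] lie_generators_carrier] by simp

lemma lie_generator_in: "multilinear t \<Longrightarrow> lc (Poly_Mapping.single t 1) \<in> carrier LO"
  unfolding Lie_operad_eq using submodule_span_superset[of "{lc (Poly_Mapping.single t 1) | t. multilinear t}" LA] by auto

lemma act_Lie_operad:
  assumes g: "g \<in> carrier (sym_group r)" and x: "x \<in> carrier LO"
  shows "act LA g x \<in> carrier LO"
proof -
  let ?S = "{lc (Poly_Mapping.single t 1) | t. multilinear t}"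
  have p: "g permutes {1..r}" using g by (simp add: sym_group_carrier)
  have "act LA g y \<in> submodule_span LA ?S" if "y \<in> ?S" for y
  proof -
    obtain t where t: "y = lc (Poly_Mapping.single t 1)" "multilinear t" using \<open>y \<in> ?S\<close> by blast
    have "act LA g y = lc (Poly_Mapping.single (map_monomial g t) 1)"
      unfolding t(1) free_lie_simps(5)[OF g single_nonassoc[OF conjunct1[OF t(2)]]] by simp
    moreover have "multilinear (map_monomial g t)"
    proof
      show "set_monomial (map_monomial g t) \<subseteq> {1..r}"
        using t(2) permutes_image[OF p] by (auto simp: monomial.set_map)
      show "\<forall>i\<in>{1..r}. degree_in i (map_monomial g t) = 1"
      proof
        fix i assume "i \<in> {1..r}"
        then obtain j where "j \<in> {1..r}" "i = g j" using permutes_image[OF p] by blast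
        then show "degree_in i (map_monomial g t) = 1" using t(2) degree_in_map[OF permutes_inj[OF p]] by simp
      qed
    qed
    ultimately show ?thesis using submodule_span_superset[of ?S LA] by blast
  qed
  from act_submodule_span[OF is_gmodule_free_lie lie_generators_carrier this g]
  show ?thesis using x unfolding Lie_operad_eq by simp
qed

lemma is_gmodule_Lie_operad: "is_gmodule (type_ring :: 'k ring) (sym_group r) LO"
  using is_gmodule_submodule[OF is_gmodule_free_lie submodule_Lie_operad act_Lie_operad]
  by (simp add: Lie_operad_eq)

lemma Lie_operad_simps:
  "\<zero>\<^bsub>LO\<^esub> = \<zero>\<^bsub>LA\<^esub>" "add LO = add LA" "smult LO = smult LA" "act LO = act LA"
  by (simp_all add: Lie_operad_eq)

lemma Lie_operad_elem:
  assumes "A \<in> carrier LO"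
  obtains a where "a \<in> carrier NR" "A = lc a"
  using assms submoduleD(4)[OF submodule_Lie_operad] unfolding free_lie_simps by blast

lemma multilinear_comb:
  assumes "1 \<le> r" "distinct cs" "set cs = {2..r}"
  shows "multilinear (comb 1 cs)"
proof -
  have "set_monomial (comb x cs) = insert x (set cs)" for x and cs :: "nat list"
    by (induction cs rule: rev_induct) auto
  moreover have "degree_in i (comb x cs) = (if i = x then 1 else 0) + (if i \<in> set cs then 1 else 0)"
    if "distinct cs" for i x and cs :: "nat list"
    using that by (induction cs rule: rev_induct) auto
  ultimately show ?thesis using assms by auto
qed

text \<open>The elements where \<open>f\<close> and \<open>f'\<close> agree form a submodule. It
  contains the combs starting with \<open>1\<close>, hence by \<open>monomial_in_comb_class\<close>
  all multilinear monomials, which span.\<close>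

lemma dual_Lie_operad_eqI:
  assumes r: "1 \<le> r"
    and f: "f \<in> carrier (dual_gmodule (sym_group r) LO)" and f': "f' \<in> carrier (dual_gmodule (sym_group r) LO)"
    and eq: "\<And>cs. distinct cs \<Longrightarrow> set cs = {2..r} \<Longrightarrow>
      f (lc (Poly_Mapping.single (comb 1 cs) 1)) = f' (lc (Poly_Mapping.single (comb 1 cs) 1))"
  shows "f = f'"
proof -
  let ?E = "{A \<in> carrier LO. f A = f' A}"
  have lin: "h (x \<oplus>\<^bsub>LA\<^esub> y) = h x + h y" "h (c \<odot>\<^bsub>LA\<^esub> x) = c * h x"
    if "h \<in> carrier (dual_gmodule (sym_group r) LO)" "x \<in> carrier LO" "y \<in> carrier LO" for h x y c
    using that unfolding dual_gmodule_def by (simp_all add: Lie_operad_simps)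
  note sub = submoduleD[OF submodule_Lie_operad]
  have zero: "h \<zero>\<^bsub>LA\<^esub> = 0" if "h \<in> carrier (dual_gmodule (sym_group r) LO)" for h
  proof -
    have "\<zero>\<^bsub>LA\<^esub> \<oplus>\<^bsub>LA\<^esub> \<zero>\<^bsub>LA\<^esub> = \<zero>\<^bsub>LA\<^esub>" unfolding free_lie_simps by (simp only: add_0_left)
    then show ?thesis using lin(1)[OF that sub(1) sub(1)] by (simp del: One_nat_def)
  qed
  have E: "submodule ?E type_ring LA"
    by (rule module_submoduleI[OF is_gmoduleD(1)[OF is_gmodule_free_lie]])
      (use sub lin[OF f] lin[OF f'] zero[OF f] zero[OF f'] in auto)
  note ED = submoduleD[OF E]
  have combs: "lc (pm_map (comb 1) g) \<in> ?E" if "Poly_Mapping.keys g \<subseteq> {cs. distinct cs \<and> set cs = {2..r}}" for g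
    using that
  proof (induction rule: pm_linear_induct)
    case zero
    then show ?case using ED(1) by (simp only: free_lie_simps lin_ext_zero)
  next
    case (single c cs)
    then have "lc (Poly_Mapping.single (comb 1 cs) 1) \<in> ?E"
      using eq lie_generator_in multilinear_comb[OF r] by auto
    from ED(3)[OF this, of c] show ?case by (simp only: free_lie_simps lin_ext_single pm_scale_simps mult_1_right)
  next
    case (add g h)
    from ED(2)[OF add] show ?case by (simp only: free_lie_simps lin_ext_add)
  qed
  have "lc (Poly_Mapping.single t 1) \<in> ?E" if t: "multilinear t" for t
  proof -
    have st: "set_monomial t = {1..r}" using t by (force simp: degree_in_pos)
    have "degree_in x t \<le> 1" for x
      using t degree_in_pos[of x t] by (cases "x \<in> {1..r}") auto
    then have "distinct_leaves t" by (rule degree_in_distinct_leaves)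
    then have "(Poly_Mapping.single t 1 :: nat monomial \<Rightarrow>\<^sub>0 'k) \<in> comb_class {1..r} 1 (set_monomial t - {1})"
      using st r by (intro monomial_in_comb_class) auto
    moreover have "set_monomial t - {1} = {2..r}" unfolding st by auto
    ultimately obtain g where g: "Poly_Mapping.keys g \<subseteq> {cs. distinct cs \<and> set cs = {2..r}}"
      "Poly_Mapping.single t (1::'k) - pm_map (comb 1) g \<in> lie_ideal {1..r}"
      unfolding comb_class_def by (simp del: One_nat_def) blast
    from lie_coset_eq_iff[THEN iffD2, OF g(2)] show ?thesis using combs[OF g(1)] by simp
  qed
  then have "submodule_span LA {lc (Poly_Mapping.single t 1) | t. multilinear t} \<subseteq> ?E"
    by (intro submodule_span_least[OF E]) blast
  then have "f A = f' A" if "A \<in> carrier LO" for A using that unfolding Lie_operad_eq by auto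
  moreover have "f \<in> carrier LO \<rightarrow>\<^sub>E UNIV" "f' \<in> carrier LO \<rightarrow>\<^sub>E UNIV" using f f' by (auto simp: dual_gmodule_def)
  ultimately show ?thesis by (intro PiE_ext) auto
qed

text \<open>A coset has no preferred representative, so one is chosen;
  \<open>expansion_lie_ideal\<close> makes the value independent of the choice.\<close>

definition word_value :: "nat list \<Rightarrow> (nat monomial \<Rightarrow>\<^sub>0 'k) set \<Rightarrow> 'k" where
  "word_value w A = pm_eval (\<lambda>t. expansion t w) (SOME a. a \<in> A)"

lemma word_value_coset: "word_value w (lc a) = pm_eval (\<lambda>t. expansion t w) a"
proof -
  have lc: "lc a = (\<lambda>n. n + a) ` lie_ideal {1..r}" by (rule formal_coset[OF formal_module_nonassoc])
  have "a \<in> lc a" unfolding lc by (rule image_eqI[OF _ lie_ideal_closed(1)]) simp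
  then have "(SOME b. b \<in> lc a) \<in> lc a" by (rule someI)
  then obtain n where "n \<in> lie_ideal {1..r}" "(SOME b. b \<in> lc a) = n + a" unfolding lc by blast
  then show ?thesis by (simp add: word_value_def pm_eval_add expansion_lie_ideal)
qed

text \<open>The factor \<open>word_sign r s\<close> makes the values at combs agree with the
  coefficients of bar cycles up to a sign depending only on the comb. The price is the signature in
  \<open>act_word_functional\<close>.\<close>

definition word_functional :: "(nat list \<Rightarrow>\<^sub>0 'k) \<Rightarrow> (nat monomial \<Rightarrow>\<^sub>0 'k) set \<Rightarrow> 'k" where
  "word_functional f = (\<lambda>A\<in>carrier LO. pm_eval (\<lambda>s. word_sign r s * word_value s A) f)"

lemma word_functional_coset:
  "lc a \<in> carrier LO \<Longrightarrow> word_functional f (lc a) = pm_eval (\<lambda>s. word_sign r s * pm_eval (\<lambda>t. expansion t s) a) f"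
  by (simp only: word_functional_def restrict_apply' word_value_coset)

lemma pm_eval_add_fun: "pm_eval (\<lambda>x. g x + h x) f = pm_eval g f + pm_eval h f"
  and pm_eval_scale_fun: "pm_eval (\<lambda>x. c * g x) f = c * pm_eval g (f :: 'x \<Rightarrow>\<^sub>0 'k)"
  by (simp_all add: pm_eval_def sum.distrib sum_distrib_left algebra_simps)

lemma word_functional_dual: "word_functional f \<in> carrier (dual_gmodule (sym_group r) LO)"
proof -
  have 1: "word_functional f (A \<oplus>\<^bsub>LO\<^esub> B) = word_functional f A + word_functional f B"
    if AB: "A \<in> carrier LO" "B \<in> carrier LO" for A B
  proof -
    obtain a b where ab: "A = lc a" "B = lc b" using AB Lie_operad_elem by metis
    have "A \<oplus>\<^bsub>LO\<^esub> B \<in> carrier LO" using submoduleD(2)[OF submodule_Lie_operad AB] by (simp only: Lie_operad_simps)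
    then show ?thesis
      using AB unfolding ab Lie_operad_simps free_lie_simps
      by (simp only: word_functional_coset pm_eval_add distrib_left pm_eval_add_fun)
  qed
  have 2: "word_functional f (c \<odot>\<^bsub>LO\<^esub> A) = c * word_functional f A" if A: "A \<in> carrier LO" for c A
  proof -
    obtain a where a: "A = lc a" using A Lie_operad_elem by metis
    have "c \<odot>\<^bsub>LO\<^esub> A \<in> carrier LO" using submoduleD(3)[OF submodule_Lie_operad A] by (simp only: Lie_operad_simps)
    then show ?thesis
      using A unfolding a Lie_operad_simps free_lie_simps
      by (simp only: word_functional_coset pm_eval_scale mult.left_commute[of _ c] pm_eval_scale_fun)
  qed
  have "word_functional f \<in> carrier LO \<rightarrow>\<^sub>E UNIV" unfolding word_functional_def by (rule restrict_PiE_iff[THEN iffD2]) simp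
  then show ?thesis using 1 2 by (simp add: dual_gmodule_def del: One_nat_def)
qed

lemma word_functional_add: "word_functional (f + f') = word_functional f \<oplus>\<^bsub>dual_gmodule (sym_group r) LO\<^esub> word_functional f'"
  by (simp add: dual_gmodule_simps word_functional_def pm_eval_add fun_eq_iff restrict_def)

lemma word_functional_scale: "word_functional (pm_scale c f) = c \<odot>\<^bsub>dual_gmodule (sym_group r) LO\<^esub> word_functional f"
  by (simp add: dual_gmodule_simps word_functional_def pm_eval_scale fun_eq_iff restrict_def)

text \<open>Relabelling a monomial by the inverse of \<open>g\<close> gives \<open>s\<close> the
  coefficient that \<open>map g s\<close> had before. This is the dual action; relabelling inside
  \<open>word_sign\<close> produces the signature.\<close>

lemma act_word_functional:
  assumes g: "g \<in> carrier (sym_group r)" and f: "Poly_Mapping.keys f \<subseteq> words r"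
  shows "word_functional (pm_map (map g) f)
    = of_int (sign g) \<odot>\<^bsub>dual_gmodule (sym_group r) LO\<^esub> act (dual_gmodule (sym_group r) LO) g (word_functional f)"
proof
  fix A
  let ?h = "inv\<^bsub>sym_group r\<^esub> g"
  interpret group "sym_group r" by (rule sym_group_is_group)
  have h: "?h \<in> carrier (sym_group r)" using g by (rule inv_closed)
  have p: "g permutes {1..r}" using g by (simp add: sym_group_carrier)
  have gh: "g (?h x) = x" for x using permutes_inverses(1)[OF p] g by simp
  show "word_functional (pm_map (map g) f) A =
    (of_int (sign g) \<odot>\<^bsub>dual_gmodule (sym_group r) LO\<^esub> act (dual_gmodule (sym_group r) LO) g (word_functional f)) A"
  proof (cases "A \<in> carrier LO")
    case True
    then obtain a where a: "a \<in> carrier NR" "A = lc a" by (rule Lie_operad_elem)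
    have act: "act LO ?h A = lc (pm_map (map_monomial ?h) a)"
      unfolding a(2) Lie_operad_simps(4) by (rule free_lie_simps(5)[OF h a(1)])
    have hA: "lc (pm_map (map_monomial ?h) a) \<in> carrier LO"
      using is_gmoduleD(9)[OF is_gmodule_Lie_operad h True] unfolding act .
    have exp: "expansion (map_monomial ?h t) s = (expansion t (map g s) :: 'k)" for t and s :: "nat list"
    proof -
      have "map_monomial g (map_monomial ?h t) = t"
        unfolding monomial.map_comp comp_def gh monomial.map_id0[unfolded id_def] by (rule refl)
      moreover have "expansion (map_monomial ?h t) s = (expansion (map_monomial g (map_monomial ?h t)) (map g s) :: 'k)"
        by (rule expansion_map[OF permutes_inj[OF p], symmetric])
      ultimately show ?thesis by simp
    qed
    have "word_functional (pm_map (map g) f) A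
        = pm_eval (\<lambda>s. word_sign r (map g s) * pm_eval (\<lambda>t. expansion t (map g s)) a) f"
      using True unfolding a(2) by (simp only: word_functional_coset pm_eval_lin_ext pm_eval_single mult_1)
    also have "\<dots> = pm_eval (\<lambda>s. of_int (sign g) * (word_sign r s * pm_eval (\<lambda>t. expansion t (map g s)) a)) f"
    proof (intro pm_eval_cong refl)
      fix s assume "s \<in> Poly_Mapping.keys f"
      then have ws: "word_sign r (map g s) = of_int (sign g) * (word_sign r s :: 'k)"
        using f by (intro word_sign_map[OF p]) auto
      show "word_sign r (map g s) * pm_eval (\<lambda>t. expansion t (map g s)) a
        = of_int (sign g) * (word_sign r s * pm_eval (\<lambda>t. expansion t (map g s)) a)"
        unfolding ws by (rule mult.assoc)
    qed
    also have "\<dots> = of_int (sign g) * word_functional f (act LO ?h A)"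
      unfolding act word_functional_coset[OF hA] pm_eval_scale_fun pm_eval_lin_ext by (simp only: pm_eval_single mult_1 exp)
    also have "\<dots> = (of_int (sign g) \<odot>\<^bsub>dual_gmodule (sym_group r) LO\<^esub> act (dual_gmodule (sym_group r) LO) g (word_functional f)) A"
      unfolding dual_gmodule_simps using True by (simp only: restrict_apply')
    finally show ?thesis .
  next
    case False
    then show ?thesis unfolding dual_gmodule_simps word_functional_def by (simp only: restrict_apply if_False)
  qed
qed

lemma word_functional_comb:
  assumes r: "1 \<le> r" and cs: "distinct cs" "set cs = {2..r}"
  shows "word_functional f (lc (Poly_Mapping.single (comb 1 cs) 1))
     = pm_eval (\<lambda>s. word_sign r s * expansion (comb 1 cs) s) f"
  using word_functional_coset[OF lie_generator_in[OF multilinear_comb[OF r cs]]] by simp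

lemma comb_word: "1 \<le> r \<Longrightarrow> distinct cs \<Longrightarrow> set cs = {2..r} \<Longrightarrow> 1 # cs \<in> words r"
  unfolding words_def using atLeastAtMost_insertL[of 1 r] by (simp add: numeral_2_eq_2)

text \<open>The values of \<open>h\<close> at the combs are placed on the dual words
  \<open>1 # cs\<close>. The word sign is included so that it meets itself and squares to
  one.\<close>

lemma word_functional_surj:
  assumes r: "1 \<le> r" and h: "h \<in> carrier (dual_gmodule (sym_group r) LO)"
  shows "\<exists>f. Poly_Mapping.keys f \<subseteq> words r \<and> word_functional f = h"
proof -
  let ?C = "{cs. distinct cs \<and> set cs = {2..r}}"
  let ?v = "\<lambda>cs. h (lc (Poly_Mapping.single (comb 1 cs) 1))"
  define f where "f = (\<Sum>cs\<in>?C. Poly_Mapping.single (1 # cs) (word_sign r (1 # cs) * ?v cs))"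
  have fin: "finite ?C" by (rule finite_words) simp
  have "Poly_Mapping.keys f \<subseteq> (\<Union>cs\<in>?C. Poly_Mapping.keys (Poly_Mapping.single (1 # cs) (word_sign r (1 # cs) * ?v cs)))"
    unfolding f_def by (rule keys_sum)
  then have "Poly_Mapping.keys f \<subseteq> words r" using comb_word[OF r] by (fastforce split: if_splits)
  moreover have "word_functional f = h"
  proof (rule dual_Lie_operad_eqI[OF r word_functional_dual h])
    fix cs assume cs: "distinct cs" "set cs = {2..r}"
    have "word_functional f (lc (Poly_Mapping.single (comb 1 cs) 1))
        = (\<Sum>ds\<in>?C. (word_sign r (1 # ds) * word_sign r (1 # ds)) * ?v ds * expansion (comb 1 cs) (1 # ds))"
      unfolding word_functional_comb[OF r cs] f_def pm_eval_sum pm_eval_single by (intro sum.cong refl) (simp only: mult_ac)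
    also have "\<dots> = (\<Sum>ds\<in>?C. if ds = cs then ?v cs else 0)"
    proof (intro sum.cong refl)
      fix ds assume "ds \<in> ?C"
      then have "word_sign r (1 # ds) * word_sign r (1 # ds) = (1 :: 'k)"
        using comb_word[OF r] by (intro word_sign_square) auto
      moreover have "expansion (comb 1 cs) (1 # ds) = (if ds = cs then 1 else (0 :: 'k))"
        using expansion_comb[of 1 cs "[]" ds] cs by (simp add: comb_coeff_Nil)
      ultimately show "(word_sign r (1 # ds) * word_sign r (1 # ds)) * ?v ds * expansion (comb 1 cs) (1 # ds)
         = (if ds = cs then ?v cs else 0)" by simp
    qed
    also have "\<dots> = ?v cs" using fin cs by simp
    finally show "word_functional f (lc (Poly_Mapping.single (comb 1 cs) 1)) = ?v cs" .
  qed
  ultimately show ?thesis by blast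
qed

lemma word_functional_eq_iff:
  assumes r: "1 \<le> r"
  shows "word_functional f = word_functional f' \<longleftrightarrow> (\<forall>cs. distinct cs \<and> set cs = {2..r} \<longrightarrow>
     pm_eval (\<lambda>s. word_sign r s * expansion (comb 1 cs) s) f = pm_eval (\<lambda>s. word_sign r s * expansion (comb 1 cs) s) f')"
proof
  assume "word_functional f = word_functional f'"
  then show "\<forall>cs. distinct cs \<and> set cs = {2..r} \<longrightarrow>
     pm_eval (\<lambda>s. word_sign r s * expansion (comb 1 cs) s) f = pm_eval (\<lambda>s. word_sign r s * expansion (comb 1 cs) s) f'"
    by (intro allI impI, elim conjE) (simp only: word_functional_comb[OF r, symmetric])
next
  assume *: "\<forall>cs. distinct cs \<and> set cs = {2..r} \<longrightarrow>
     pm_eval (\<lambda>s. word_sign r s * expansion (comb 1 cs) s) f = pm_eval (\<lambda>s. word_sign r s * expansion (comb 1 cs) s) f'"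
  show "word_functional f = word_functional f'"
    by (rule dual_Lie_operad_eqI[OF r word_functional_dual word_functional_dual])
      (use * in \<open>simp only: word_functional_comb[OF r]; blast\<close>)
qed

end

section \<open>The homology of the complex of partitions\<close>

lemma pm_map_Some_inject: "pm_map Some f = pm_map Some f' \<longleftrightarrow> f = f'"
proof
  assume "pm_map Some f = pm_map Some f'"
  then have "pm_map the (pm_map Some f) = pm_map the (pm_map Some f')" by simp
  then show "f = f'" by (simp add: pm_map_pm_map)
qed simp

lemma pm_map_Some_ex:
  fixes f :: "'x option \<Rightarrow>\<^sub>0 'k::comm_ring_1"
  assumes "Poly_Mapping.keys f \<subseteq> Some ` S"
  obtains f' where "f = pm_map Some f'" "Poly_Mapping.keys f' \<subseteq> S"
proof
  have "pm_map Some (pm_map the f) = lin_ext (\<lambda>x. Poly_Mapping.single x 1) f"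
    unfolding pm_map_pm_map using assms by (intro lin_ext_cong) auto
  then show "f = pm_map Some (pm_map the f)" by simp
  show "Poly_Mapping.keys (pm_map the f) \<subseteq> S"
    using assms by (intro order_trans[OF keys_pm_map]) auto
qed

text \<open>The variable \<open>ty\<close> only serves to fix the coefficient ring \<open>'k\<close> in the following context.\<close>

context
  fixes r :: nat and ty :: "'k::comm_ring_1 itself"
  assumes r: "1 \<le> r"
begin

abbreviation (input) "UU \<equiv> {1..r} :: nat set"
abbreviation (input) "PP \<equiv> all_singletons r"
abbreviation (input) "full \<equiv> spans {UU} PP"
abbreviation (input) "full_chains n \<equiv> {xs \<in> chain_lists (coarser UU) {X. refines UU PP X} (Suc n). full xs}"
abbreviation (input) "dd f \<equiv> pm_filter full (lin_ext list_boundary f)"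

lemma UU: "finite UU" "UU \<noteq> {}"
  using r by auto

lemma partition_PP: "partition_on UU PP"
  unfolding all_singletons_def by (rule partition_on_singletons)

lemma card_PP: "card PP = r"
  unfolding all_singletons_def by (simp add: card_image)

lemma refines_PP: "refines UU PP X \<longleftrightarrow> partition_on UU X"
  using partition_PP unfolding refines_def by (auto simp: all_singletons_def partition_on_def)

lemma full_chain_eq: "full_chain r = full"
  by (simp add: fun_eq_iff full_chain_def spans_def one_block_def)

lemma simplices_eq: "simplices (Kbar r) n - {basept (Kbar r) n} = Some ` full_chains n"
proof -
  have "partition_le r = coarser UU" by (simp add: fun_eq_iff partition_le_def coarser_def)
  then show ?thesis
    unfolding refines_PP Kbar_def by (auto simp: full_chain_eq chain_lists_def)
qed

abbreviation (input) "CH n \<equiv> reduced_chains (Kbar r) perm_simplex n ::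
  ('k, nat set set list option \<Rightarrow>\<^sub>0 'k, nat \<Rightarrow> nat) gmodule"

lemma reduced_chains_eq: "CH n = free_gmodule (Some ` full_chains n) perm_simplex"
  by (simp only: reduced_chains_def simplices_eq)

text \<open>The faces equal to the base point are exactly the lists that lose an end point. In
  dimension zero the only face is the empty list, which is not full, in accordance with the boundary
  being zero there.\<close>

lemma reduced_boundary_lift:
  assumes "Poly_Mapping.keys f \<subseteq> full_chains n"
  shows "reduced_boundary (Kbar r) n (pm_map Some f) = pm_map Some (dd f :: _ \<Rightarrow>\<^sub>0 'k)"
proof (cases n)
  case 0
  have "dd f = 0"
  proof (rule pm_filter_none)
    fix ys assume "ys \<in> Poly_Mapping.keys (lin_ext list_boundary f)"
    then have "length ys = 0"
      using lin_ext_list_boundary_chain_lists[of f "coarser UU" "{X. refines UU PP X}" 0] assms 0 by (auto simp: chain_lists_def)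
    then show "\<not> full ys" by (simp add: spans_def)
  qed
  then show ?thesis using 0 by (simp add: reduced_boundary_def)
next
  case (Suc k)
  show ?thesis
  proof (rule pm_linear_eqI[where f = f and L = "\<lambda>f. reduced_boundary (Kbar r) n (pm_map Some f)" and L' = "\<lambda>f. pm_map Some (dd f)"])
    show "pm_linear (\<lambda>f. reduced_boundary (Kbar r) n (pm_map Some f :: _ \<Rightarrow>\<^sub>0 'k))"
      using Suc by (simp add: reduced_boundary_def) (intro pm_linear_intros)
    show "pm_linear (\<lambda>f. pm_map Some (dd f :: _ \<Rightarrow>\<^sub>0 'k))" by (intro pm_linear_intros pm_linear_pm_filter_comp)
    fix xs assume "xs \<in> Poly_Mapping.keys f"
    then have len: "{..<length xs} = {..n}" using assms by (auto simp: chain_lists_def)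
    have "dd (Poly_Mapping.single xs (1::'k)) = (\<Sum>i\<le>n. if full (omit i xs) then Poly_Mapping.single (omit i xs) ((- 1) ^ i) else 0)"
      by (simp add: list_boundary_omit len pm_filter_simps pm_filter_single del: One_nat_def)
    then have "pm_map Some (dd (Poly_Mapping.single xs (1::'k)))
        = (\<Sum>i\<le>n. if full (omit i xs) then Poly_Mapping.single (Some (omit i xs)) ((- 1) ^ i) else 0)"
      by (simp add: lin_ext_sum if_distrib[of "lin_ext _"] cong: if_cong del: One_nat_def)
    moreover have "reduced_boundary (Kbar r) n (pm_map Some (Poly_Mapping.single xs (1::'k)))
        = (\<Sum>i\<le>n. if full (omit i xs) then Poly_Mapping.single (Some (omit i xs)) ((- 1) ^ i) else 0)"
      using Suc by (auto simp: reduced_boundary_def face_Kbar basept_Kbar full_chain_eq simp del: One_nat_def intro!: sum.cong)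
    ultimately show "reduced_boundary (Kbar r) n (pm_map Some (Poly_Mapping.single xs (1::'k))) = pm_map Some (dd (Poly_Mapping.single xs (1::'k)))"
      by simp
  qed
qed

lemma dd_full_chains:
  assumes "Poly_Mapping.keys f \<subseteq> full_chains (Suc n)"
  shows "Poly_Mapping.keys (dd f) \<subseteq> full_chains n"
  using lin_ext_list_boundary_chain_lists[of f "coarser UU" "{X. refines UU PP X}" "Suc n"] assms
  by (auto simp: keys_pm_filter)

lemma dd_dd:
  assumes "Poly_Mapping.keys f \<subseteq> full_chains (Suc n)"
  shows "dd (dd f) = 0"
proof (rule spans_boundary_boundary[of f "coarser UU" "{X. refines UU PP X}" "Suc n"])
  show "Poly_Mapping.keys f \<subseteq> chain_lists (coarser UU) {X. refines UU PP X} (Suc (Suc n))" using assms by auto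
  show "x = PP" if "x \<in> {X. refines UU PP X}" "coarser UU PP x" for x
    using that refines_asym[of UU PP x] by (auto simp: coarser_def)
  show "x = {UU}" if "x \<in> {X. refines UU PP X}" "coarser UU x {UU}" for x
    using that refines_one_block[of UU x] UU refines_asym[of UU x "{UU}"] unfolding refines_PP coarser_def by blast
qed

section \<open>Cycles, boundaries and homology as modules over the symmetric group\<close>

abbreviation (input) "cycles n \<equiv> {z \<in> carrier (CH n). reduced_boundary (Kbar r) n z = 0}"
abbreviation (input) "bounds n \<equiv> reduced_boundary (Kbar r) (Suc n) ` carrier (CH (Suc n))"
abbreviation (input) "ZM n \<equiv> CH n\<lparr>carrier := cycles n\<rparr>"

lemma homology_eq: "reduced_homology (Kbar r) perm_simplex n = quotient_gmodule (ZM n) (bounds n)"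
  by (simp add: reduced_homology_def Let_def)

lemma cycles_eq: "cycles n = pm_map Some ` {z. Poly_Mapping.keys z \<subseteq> full_chains n \<and> dd z = 0}"
proof (intro equalityI subsetI)
  fix z assume z: "z \<in> cycles n"
  then have "Poly_Mapping.keys z \<subseteq> Some ` full_chains n" unfolding reduced_chains_eq carrier_free by blast
  then obtain z' where z': "z = pm_map Some z'" "Poly_Mapping.keys z' \<subseteq> full_chains n" by (rule pm_map_Some_ex)
  have "pm_map Some (dd z') = pm_map Some 0" using z reduced_boundary_lift[OF z'(2)] z'(1) by simp
  then have "dd z' = 0" unfolding pm_map_Some_inject .
  then show "z \<in> pm_map Some ` {z. Poly_Mapping.keys z \<subseteq> full_chains n \<and> dd z = 0}" using z' by blast
next
  fix z :: "nat set set list option \<Rightarrow>\<^sub>0 'k" assume "z \<in> pm_map Some ` {z. Poly_Mapping.keys z \<subseteq> full_chains n \<and> dd z = 0}"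
  then obtain z' where z': "z = pm_map Some z'" "Poly_Mapping.keys z' \<subseteq> full_chains n" "dd z' = 0" by blast
  have "Poly_Mapping.keys z \<subseteq> Some ` full_chains n"
    unfolding z'(1) using z'(2) by (intro order_trans[OF keys_pm_map] image_mono)
  moreover have "reduced_boundary (Kbar r) n z = 0" unfolding z'(1) reduced_boundary_lift[OF z'(2)] z'(3) by simp
  ultimately show "z \<in> cycles n" unfolding reduced_chains_eq carrier_free by blast
qed

lemma bounds_eq: "bounds n = pm_map Some ` dd ` {y. Poly_Mapping.keys y \<subseteq> full_chains (Suc n)}"
proof (intro equalityI subsetI)
  fix z assume "z \<in> bounds n"
  then obtain y where y: "Poly_Mapping.keys y \<subseteq> Some ` full_chains (Suc n)" "z = reduced_boundary (Kbar r) (Suc n) y"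
    unfolding reduced_chains_eq carrier_free by blast
  from y(1) obtain y' where y': "y = pm_map Some y'" "Poly_Mapping.keys y' \<subseteq> full_chains (Suc n)" by (rule pm_map_Some_ex)
  then show "z \<in> pm_map Some ` dd ` {y. Poly_Mapping.keys y \<subseteq> full_chains (Suc n)}"
    unfolding y(2) y'(1) reduced_boundary_lift[OF y'(2)] by blast
next
  fix z :: "nat set set list option \<Rightarrow>\<^sub>0 'k" assume "z \<in> pm_map Some ` dd ` {y. Poly_Mapping.keys y \<subseteq> full_chains (Suc n)}"
  then obtain y where y: "Poly_Mapping.keys y \<subseteq> full_chains (Suc n)" "z = pm_map Some (dd y)" by blast
  have "Poly_Mapping.keys (pm_map Some y) \<subseteq> Some ` full_chains (Suc n)"
    using y(1) by (intro order_trans[OF keys_pm_map] image_mono)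
  then show "z \<in> bounds n"
    unfolding y(2) reduced_boundary_lift[OF y(1), symmetric] reduced_chains_eq carrier_free by blast
qed

definition relabel :: "(nat \<Rightarrow> nat) \<Rightarrow> nat set set list \<Rightarrow> nat set set list" where
  "relabel w = map ((`) ((`) w))"

lemma perm_simplex_Some: "perm_simplex w (Some xs) = Some (relabel w xs)"
  by (simp add: perm_simplex_def relabel_def)

lemma relabel_full_chains:
  assumes w: "w permutes {1..r}"
  shows "full (relabel w xs) = full xs" "xs \<in> full_chains n \<Longrightarrow> relabel w xs \<in> full_chains n"
proof -
  let ?w = "(`) ((`) w) :: nat set set \<Rightarrow> _"
  have inj: "inj w" by (rule permutes_inj[OF w])
  then have "inj ((`) w)" by (intro injI) (simp only: inj_image_eq_iff)
  then have injw: "inj ?w" by (intro injI) (simp only: inj_image_eq_iff)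
  have UUw: "w ` UU = UU" by (rule permutes_image[OF w])
  have e: "?w {UU} = {UU}" using UUw by simp
  have P: "?w PP = PP"
  proof -
    have "?w PP = (\<lambda>i. {i}) ` w ` UU" unfolding all_singletons_def by (simp add: image_image)
    then show ?thesis unfolding UUw all_singletons_def .
  qed
  show full: "full (relabel w xs) = full xs" for xs
  proof (cases "xs = []")
    case False
    have "hd (relabel w xs) = {UU} \<longleftrightarrow> ?w (hd xs) = ?w {UU}" "last (relabel w xs) = PP \<longleftrightarrow> ?w (last xs) = ?w PP"
      unfolding e P relabel_def using False by (simp_all add: hd_map last_map del: One_nat_def)
    then show ?thesis unfolding spans_def inj_eq[OF injw] by (simp add: relabel_def del: One_nat_def)
  qed (simp add: relabel_def)
  have part: "partition_on UU (?w X)" if "partition_on UU X" for X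
  proof -
    have "inj_on w UU" by (rule inj_on_subset[OF inj subset_UNIV])
    then have "partition_on (w ` UU) ((`) w ` X - {{}})" by (rule partition_on_inj_image[OF that])
    moreover have "{} \<notin> (`) w ` X" using partition_onD3[OF that] by blast
    ultimately show ?thesis unfolding UUw by (simp del: One_nat_def)
  qed
  have ref: "coarser UU (?w X) (?w Y)" if XY: "coarser UU X Y" for X Y
    unfolding coarser_def refines_def
  proof (intro conjI ballI)
    show "partition_on UU (?w Y)" "partition_on UU (?w X)" using XY part by (auto simp only: coarser_def refines_def)
    fix B assume "B \<in> ?w Y"
    then obtain B' where B': "B' \<in> Y" "B = w ` B'" by blast
    then obtain C where "C \<in> X" "B' \<subseteq> C" using XY unfolding coarser_def refines_def by blast
    then show "\<exists>C\<in>?w X. B \<subseteq> C" unfolding B'(2) by (intro bexI[of _ "w ` C"] image_mono imageI)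
  qed
  assume "xs \<in> full_chains n"
  then have xs: "length xs = Suc n" "sorted_wrt (coarser UU) xs" "\<And>X. X \<in> set xs \<Longrightarrow> partition_on UU X" "full xs"
    unfolding refines_PP chain_lists_def by auto
  have "sorted_wrt (coarser UU) (relabel w xs)"
    unfolding relabel_def sorted_wrt_map by (rule sorted_wrt_mono_rel[OF _ xs(2)]) (rule ref)
  then show "relabel w xs \<in> full_chains n"
    using xs part full unfolding refines_PP chain_lists_def by (auto simp: relabel_def)
qed

lemma dd_relabel:
  assumes w: "w permutes {1..r}"
  shows "dd (pm_map (relabel w) f) = pm_map (relabel w) (dd (f :: _ \<Rightarrow>\<^sub>0 'k))"
proof -
  have "lin_ext list_boundary (pm_map (relabel w) f) = pm_map (relabel w) (lin_ext list_boundary f)"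
    by (simp add: lin_ext_lin_ext relabel_def list_boundary_map)
  then show ?thesis by (simp only: pm_filter_pm_map relabel_full_chains(1)[OF w])
qed

lemma act_chains: "act (CH n) w (pm_map Some f) = pm_map Some (pm_map (relabel w) f)"
  unfolding reduced_chains_eq act_free by (simp add: pm_map_pm_map perm_simplex_Some)

lemma keys_relabel: "w permutes {1..r} \<Longrightarrow> Poly_Mapping.keys f \<subseteq> full_chains n \<Longrightarrow>
    Poly_Mapping.keys (pm_map (relabel w) (f :: _ \<Rightarrow>\<^sub>0 'k)) \<subseteq> full_chains n"
  by (rule order_trans[OF keys_pm_map]) (use relabel_full_chains(2) in blast)

lemma is_gmodule_chains: "is_gmodule (type_ring :: 'k ring) (sym_group r) (CH n)"
  unfolding reduced_chains_eq
proof (rule is_gmodule_free[OF sym_group_is_group])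
  show "perm_simplex g x \<in> Some ` full_chains n" if "g \<in> carrier (sym_group r)" "x \<in> Some ` full_chains n" for g x
    using that(2) by (elim imageE)
      (simp only: perm_simplex_Some, intro imageI relabel_full_chains(2) that(1)[unfolded sym_group_carrier])
  show "perm_simplex \<one>\<^bsub>sym_group r\<^esub> x = x" for x
    by (cases x) (simp_all add: perm_simplex_def sym_group_one)
  show "perm_simplex (g \<otimes>\<^bsub>sym_group r\<^esub> h) x = perm_simplex g (perm_simplex h x)" for g h x
    by (cases x) (simp_all add: perm_simplex_def sym_group_mult image_comp image_image)
qed

lemma formal_cycles: "formal_module (ZM n)"
  using formal_module_free[of "Some ` full_chains n" perm_simplex] unfolding reduced_chains_eq formal_module_def by simp

lemma dd_linear: "dd (f + f') = dd f + dd f'" "dd (pm_scale c f) = pm_scale c (dd f)" "dd (f - f') = dd f - dd f'" "dd 0 = 0"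
  by (simp_all only: lin_ext_simps pm_filter_simps lin_ext_zero pm_filter_zero)

lemma submodule_cycles: "submodule (cycles n) (type_ring :: 'k ring) (CH n)"
proof (rule module_submoduleI[OF is_gmoduleD(1)[OF is_gmodule_chains]])
  have ops: "\<zero>\<^bsub>CH n\<^esub> = 0" "x \<oplus>\<^bsub>CH n\<^esub> y = x + y" "c \<odot>\<^bsub>CH n\<^esub> x = pm_scale c x" for x y c
    unfolding reduced_chains_eq by (simp_all add: free_gmodule_def)
  show "\<zero>\<^bsub>CH n\<^esub> \<in> cycles n" unfolding ops cycles_eq by (rule image_eqI[of _ _ 0]) (auto simp: dd_linear simp del: One_nat_def)
  fix x c assume "x \<in> cycles n"
  then obtain x' where x': "x = pm_map Some x'" "Poly_Mapping.keys x' \<subseteq> full_chains n" "dd x' = 0" unfolding cycles_eq by blast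
  show "x \<oplus>\<^bsub>CH n\<^esub> y \<in> cycles n" if "y \<in> cycles n" for y
  proof -
    obtain y' where y': "y = pm_map Some y'" "Poly_Mapping.keys y' \<subseteq> full_chains n" "dd y' = 0" using \<open>y \<in> cycles n\<close> unfolding cycles_eq by blast
    have "Poly_Mapping.keys (x' + y') \<subseteq> full_chains n" using x'(2) y'(2) keys_add[of x' y'] by blast
    moreover have "dd (x' + y') = 0" unfolding dd_linear x'(3) y'(3) by simp
    ultimately show ?thesis unfolding ops cycles_eq x'(1) y'(1) lin_ext_add[symmetric] by blast
  qed
  have "Poly_Mapping.keys (pm_scale c x') \<subseteq> full_chains n" by (rule order_trans[OF keys_pm_scale x'(2)])
  moreover have "dd (pm_scale c x') = 0" unfolding dd_linear x'(3) by simp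
  ultimately show "c \<odot>\<^bsub>CH n\<^esub> x \<in> cycles n" unfolding ops cycles_eq x'(1) lin_ext_scale[symmetric] by blast
qed blast

lemma is_gmodule_cycles: "is_gmodule (type_ring :: 'k ring) (sym_group r) (ZM n)"
proof (rule is_gmodule_submodule[OF is_gmodule_chains submodule_cycles])
  fix g x assume g: "g \<in> carrier (sym_group r)" and "x \<in> cycles n"
  then obtain x' where x': "x = pm_map Some x'" "Poly_Mapping.keys x' \<subseteq> full_chains n" "dd x' = 0" unfolding cycles_eq by blast
  have p: "g permutes {1..r}" using g by (simp only: sym_group_carrier)
  have "dd (pm_map (relabel g) x') = 0" unfolding dd_relabel[OF p] x'(3) by simp
  then show "act (CH n) g x \<in> cycles n"
    unfolding x'(1) act_chains cycles_eq using keys_relabel[OF p x'(2)] by blast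
qed

lemma submodule_bounds: "submodule (bounds n) (type_ring :: 'k ring) (ZM n)"
proof (rule module_submoduleI[OF is_gmoduleD(1)[OF is_gmodule_cycles]])
  have ops: "\<zero>\<^bsub>ZM n\<^esub> = 0" "x \<oplus>\<^bsub>ZM n\<^esub> y = x + y" "c \<odot>\<^bsub>ZM n\<^esub> x = pm_scale c x" for x y c
    using formal_cycles[of n] unfolding formal_module_def by simp_all
  have "pm_map Some (dd y) \<in> cycles n" if "Poly_Mapping.keys y \<subseteq> full_chains (Suc n)" for y
    unfolding cycles_eq using dd_full_chains[OF that] dd_dd[OF that] by blast
  then show "bounds n \<subseteq> carrier (ZM n)" unfolding bounds_eq by auto
  show "\<zero>\<^bsub>ZM n\<^esub> \<in> bounds n" unfolding ops bounds_eq image_image by (rule image_eqI[of _ _ 0]) (auto simp: dd_linear simp del: One_nat_def)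
  fix x c assume "x \<in> bounds n"
  then obtain x' where x': "x = pm_map Some (dd x')" "Poly_Mapping.keys x' \<subseteq> full_chains (Suc n)" unfolding bounds_eq by blast
  show "x \<oplus>\<^bsub>ZM n\<^esub> y \<in> bounds n" if "y \<in> bounds n" for y
  proof -
    obtain y' where y': "y = pm_map Some (dd y')" "Poly_Mapping.keys y' \<subseteq> full_chains (Suc n)" using \<open>y \<in> bounds n\<close> unfolding bounds_eq by blast
    have "Poly_Mapping.keys (x' + y') \<subseteq> full_chains (Suc n)" using x'(2) y'(2) keys_add[of x' y'] by blast
    then show ?thesis unfolding ops bounds_eq x'(1) y'(1) lin_ext_add[symmetric] dd_linear[symmetric] by blast
  qed
  have "Poly_Mapping.keys (pm_scale c x') \<subseteq> full_chains (Suc n)" by (rule order_trans[OF keys_pm_scale x'(2)])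
  then show "c \<odot>\<^bsub>ZM n\<^esub> x \<in> bounds n" unfolding ops bounds_eq x'(1) lin_ext_scale[symmetric] dd_linear[symmetric] by blast
qed

lemma act_bounds:
  assumes "g \<in> carrier (sym_group r)" "x \<in> bounds n"
  shows "act (ZM n) g x \<in> bounds n"
proof -
  obtain x' where x': "x = pm_map Some (dd x')" "Poly_Mapping.keys x' \<subseteq> full_chains (Suc n)" using assms(2) unfolding bounds_eq by blast
  have p: "g permutes {1..r}" using assms(1) by (simp only: sym_group_carrier)
  have "act (ZM n) g x = pm_map Some (dd (pm_map (relabel g) x'))"
  proof -
    have "act (ZM n) = act (CH n)" by simp
    then show ?thesis unfolding dd_relabel[OF p] x'(1) by (simp only: act_chains)
  qed
  then show ?thesis unfolding bounds_eq using keys_relabel[OF p x'(2)] by blast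
qed

abbreviation (input) "hc n z \<equiv> bounds n +>\<^bsub>ZM n\<^esub> z"

lemmas homology_quotient = quotient_simps[OF formal_cycles submodule_bounds] coset_smult[OF formal_cycles submodule_bounds]
  coset_zero[OF formal_cycles submodule_bounds]

text \<open>Comb chains have \<open>r\<close> entries, so outside degree \<open>r - 1\<close> they
  impose no condition and every cycle bounds.\<close>

lemma homology_trivial:
  assumes "n \<noteq> r - 1"
  shows "gmodule_iso (type_ring :: 'k ring) (sym_group r)
    (reduced_homology (Kbar r) perm_simplex n) (zero_gmodule :: ('k, 'z, nat \<Rightarrow> nat) gmodule)"
proof -
  let ?H = "reduced_homology (Kbar r) perm_simplex n :: ('k, _, nat \<Rightarrow> nat) gmodule"
  \<comment> \<open>A trivial module over \<open>unit\<close> is the common source of the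
    surjections onto the homology and onto the zero module of arbitrary type.\<close>
  let ?Z = "zero_gmodule :: ('k, unit, nat \<Rightarrow> nat) gmodule"
  have r1: "{1} \<in> PP" using r by (auto simp: all_singletons_def)
  have "cycles n \<subseteq> bounds n"
  proof
    fix z assume "z \<in> cycles n"
    then obtain z' where z': "z = pm_map Some z'" "Poly_Mapping.keys z' \<subseteq> full_chains n" "dd z' = 0" unfolding cycles_eq by blast
    have "\<exists>y. Poly_Mapping.keys y \<subseteq> full_chains (Suc n) \<and> dd y = z'"
      using assms card_PP r
      by (intro partition_chains_acyclic[OF UU partition_PP r1 z'(2,3)]) simp
    then show "z \<in> bounds n" unfolding bounds_eq z'(1) by blast
  qed
  then have coset: "hc n z = bounds n" if "z \<in> carrier (ZM n)" for z
  proof -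
    have "z - 0 \<in> bounds n" using \<open>cycles n \<subseteq> bounds n\<close> that by auto
    then have "hc n z = hc n 0" by (rule coset_eq_iff[OF formal_cycles submodule_bounds, THEN iffD2])
    then show ?thesis unfolding homology_quotient(5) .
  qed
  have zero_in: "0 \<in> carrier (ZM n)"
    using formal_submodule(1,6)[OF formal_cycles submodule_bounds] by blast
  have carrier: "carrier ?H = {bounds n}"
    unfolding homology_eq homology_quotient(1) using coset zero_in by blast
  have H: "is_gmodule (type_ring :: 'k ring) (sym_group r) ?H"
    unfolding homology_eq by (rule is_gmodule_quotient[OF formal_cycles submodule_bounds is_gmodule_cycles act_bounds])
  have zero: "\<zero>\<^bsub>?H\<^esub> = bounds n" unfolding homology_eq homology_quotient(2) ..
  have hom: "(\<lambda>_. bounds n) \<in> gmodule_hom (type_ring :: 'k ring) (sym_group r) ?Z ?H"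
    using is_gmoduleD(4,9)[OF H] abelian_groupE(1)[OF is_gmoduleD(2)[OF H]]
    unfolding gmodule_hom_def carrier by auto
  show ?thesis
    by (rule gmodule_iso_of_surjections[OF is_gmodule_zero[OF sym_group_is_group] hom, of "\<lambda>_. undefined"])
      (auto simp: carrier zero zero_gmodule_def gmodule_hom_def)
qed

text \<open>A word of \<open>r\<close> letters admits \<open>r - 1\<close> merges, which puts its
  cycle into degree \<open>r - 1\<close>.\<close>

definition chain_of_words :: "(nat list \<Rightarrow>\<^sub>0 'k) \<Rightarrow> (nat set set list \<Rightarrow>\<^sub>0 'k)" where
  "chain_of_words f = lin_ext (\<lambda>s. bar_chains (r - 1) (map (\<lambda>x. {x}) s)) f"

lemma word_blocks:
  assumes "s \<in> words r"
  shows "map (\<lambda>x. {x}) s \<in> block_lists UU (Suc (r - 1))" "set (map (\<lambda>x. {x}) s) = PP"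
proof -
  have s: "distinct s" "set s = UU" "length s = r" using assms words_length by (auto simp: words_def)
  show P: "set (map (\<lambda>x. {x}) s) = PP" using s(2) by (simp add: all_singletons_def)
  then show "map (\<lambda>x. {x}) s \<in> block_lists UU (Suc (r - 1))"
    using s r partition_PP unfolding block_lists_def mem_Collect_eq P by (simp add: distinct_map inj_on_def)
qed

lemma chain_of_words_cycle:
  assumes f: "Poly_Mapping.keys f \<subseteq> words r"
  shows "Poly_Mapping.keys (chain_of_words f) \<subseteq> full_chains (r - 1)" "dd (chain_of_words f) = 0"
proof -
  show "Poly_Mapping.keys (chain_of_words f) \<subseteq> full_chains (r - 1)"
    unfolding chain_of_words_def
  proof (rule keys_lin_ext_subset[OF f])
    fix s assume s: "s \<in> words r"
    show "Poly_Mapping.keys (bar_chains (r - 1) (map (\<lambda>x. {x}) s) :: _ \<Rightarrow>\<^sub>0 'k) \<subseteq> full_chains (r - 1)"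
      by (rule bar_chains_in[OF word_blocks(1)[OF s], unfolded word_blocks(2)[OF s]])
  qed
  have "dd (chain_of_words f) = lin_ext (\<lambda>s. dd (bar_chains (r - 1) (map (\<lambda>x. {x}) s))) f"
    unfolding chain_of_words_def by (simp only: lin_ext_lin_ext pm_linear_apply_lin_ext[OF pm_linear_pm_filter])
  also have "\<dots> = lin_ext (\<lambda>_. 0) f"
  proof (rule lin_ext_cong[OF refl])
    fix s assume "s \<in> Poly_Mapping.keys f"
    then have s: "s \<in> words r" using f by blast
    show "dd (bar_chains (r - 1) (map (\<lambda>x. {x}) s) :: _ \<Rightarrow>\<^sub>0 'k) = 0"
      using spans_boundary_bar_chains[OF word_blocks(1)[OF s]] unfolding word_blocks(2)[OF s] .
  qed
  finally show "dd (chain_of_words f) = 0" by simp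
qed

lemma chain_of_words_relabel: "chain_of_words (pm_map (map w) f) = pm_map (relabel w) (chain_of_words f)"
proof -
  have "map (\<lambda>x. {x}) (map w s) = map ((`) w) (map (\<lambda>x. {x}) s)" for s :: "nat list" by simp
  then have "bar_chains (r - 1) (map (\<lambda>x. {x}) (map w s)) = pm_map (relabel w) (bar_chains (r - 1) (map (\<lambda>x. {x}) s) :: _ \<Rightarrow>\<^sub>0 'k)" for s
    unfolding relabel_def by (simp only: bar_chains_map_image)
  then show ?thesis unfolding chain_of_words_def by (simp only: lin_ext_lin_ext lin_ext_single pm_scale_simps)
qed

text \<open>The link between the two maps: for \<open>bs = [1]\<close> the exponent in
  \<open>lookup_bar_chains_comb_chain\<close> is even, and \<open>expansion_comb\<close> identifies
  the remaining factor.\<close>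

lemma lookup_chain_of_words:
  assumes f: "Poly_Mapping.keys f \<subseteq> words r" and cs: "distinct cs" "set cs = {2..r}"
  shows "Poly_Mapping.lookup (chain_of_words f) (comb_chain {1} (map (\<lambda>x. {x}) cs))
     = word_sign r (1 # cs) * pm_eval (\<lambda>s. word_sign r s * expansion (comb 1 cs) s) f"
proof -
  have len: "length cs = r - 1" using distinct_card[OF cs(1)] cs(2) by simp
  have "Poly_Mapping.lookup (bar_chains (r - 1) (map (\<lambda>x. {x}) s)) (comb_chain {1} (map (\<lambda>x. {x}) cs))
     = word_sign r (1 # cs) * (word_sign r s * expansion (comb 1 cs) s :: 'k)" if s: "s \<in> words r" for s
  proof -
    have sd: "distinct s" "set s = UU" using s by (auto simp: words_def)
    have "1 \<in> set s" using sd(2) r by simp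
    then obtain ps vs where "s = ps @ 1 # vs" using split_list by fast
    \<comment> \<open>The letters to the left of \<open>1\<close> are listed backwards, the order in
      which \<open>comb_coeff\<close> removes them.\<close>
    then obtain us where us: "s = rev us @ 1 # vs" by (metis rev_rev_ident)
    have "insert 1 (set us \<union> set vs) = insert 1 (set cs)"
      using sd(2) us cs(2) atLeastAtMost_insertL[of 1 r] r by (simp add: numeral_2_eq_2)
    moreover have "1 \<notin> set us \<union> set vs" "1 \<notin> set cs" using sd(1) us cs(2) by auto
    ultimately have csuv: "set cs = set us \<union> set vs" by (metis insert_ident)
    have "Poly_Mapping.lookup (bar_chains (length cs) (map (\<lambda>x. {x}) (rev us) @ set [1] # map (\<lambda>x. {x}) vs))
      (comb_chain (set [1]) (map (\<lambda>x. {x}) cs))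
      = word_sign r (rev us @ [1] @ vs) * word_sign r ([1] @ cs) * (- 1) ^ (length us * Suc (length [1::nat])) * (comb_coeff us vs cs :: 'k)"
    proof (rule lookup_bar_chains_comb_chain[where A = UU])
      show "word_sign r (u @ a # b # v) = - (word_sign r (u @ b # a # v) :: 'k)"
        if "distinct (u @ a # b # v)" "set (u @ a # b # v) = UU" for u a b v
        using that by (intro word_sign_swap) (simp add: words_def)
      show "word_sign r u * word_sign r u = (1 :: 'k)" if "distinct u" "set u = UU" for u
        using that by (intro word_sign_square) (simp add: words_def)
    qed (use sd us cs csuv in \<open>auto simp del: One_nat_def\<close>)
    moreover have "expansion (comb 1 cs) s = (comb_coeff us vs cs :: 'k)"
      unfolding us using cs(2) by (intro expansion_comb) simp
    ultimately show ?thesis by (simp add: us len power_mult[symmetric] mult.commute[of "length us"] power_mult mult_ac)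
  qed
  then show ?thesis
    unfolding chain_of_words_def lookup_lin_ext_eval pm_eval_scale_fun[symmetric]
    using f by (intro pm_eval_cong refl) blast
qed

text \<open>In the top degree the coefficients at comb chains of the block \<open>{1}\<close> are a
  complete set of invariants: boundaries have none by repetition, and
  \<open>partition_chains_acyclic\<close> gives the converse.\<close>

lemma cycle_bounds_iff:
  assumes z: "Poly_Mapping.keys z \<subseteq> full_chains (r - 1)" "dd z = 0"
  shows "pm_map Some z \<in> bounds (r - 1) \<longleftrightarrow>
    (\<forall>cs. distinct cs \<and> set cs = {2..r} \<longrightarrow> Poly_Mapping.lookup z (comb_chain {1} (map (\<lambda>x. {x}) cs)) = (0 :: 'k))"
    (is "_ \<longleftrightarrow> ?R")
proof
  have r1: "{1} \<in> PP" using r by (auto simp: all_singletons_def)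
  have rr: "Suc (r - 1) = r" using r by simp
  have P1: "PP - {{1}} = (\<lambda>x. {x}) ` {2..r}" unfolding all_singletons_def by auto
  {
    assume "pm_map Some z \<in> bounds (r - 1)"
    then obtain y where y: "z = dd y" "Poly_Mapping.keys y \<subseteq> full_chains (Suc (r - 1))"
      unfolding bounds_eq image_iff pm_map_Some_inject by blast
    show ?R
    proof (intro allI impI, elim conjE)
      fix cs :: "nat list" assume cs: "distinct cs" "set cs = {2..r}"
      have "Poly_Mapping.lookup (lin_ext list_boundary y) (comb_chain {1} (map (\<lambda>x. {x}) cs)) = 0"
      proof (rule boundary_vanishes_on_comb_chain[OF UU partition_PP r1])
        show "distinct (map (\<lambda>x. {x}) cs)" using cs by (simp add: distinct_map inj_on_def)
        show "set (map (\<lambda>x. {x}) cs) = PP - {{1}}" unfolding P1 using cs by simp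
        show "Poly_Mapping.keys y \<subseteq> chain_lists (coarser UU) {X. refines UU PP X} (Suc (card PP))"
          using y(2) unfolding rr card_PP by blast
      qed
      then show "Poly_Mapping.lookup z (comb_chain {1} (map (\<lambda>x. {x}) cs)) = 0" unfolding y(1) by simp
    qed
  next
    assume R: ?R
    have "\<exists>y. Poly_Mapping.keys y \<subseteq> full_chains (Suc (r - 1)) \<and> dd y = z"
    proof (rule partition_chains_acyclic[OF UU partition_PP r1 z])
      fix Cs :: "nat set list" assume Cs: "distinct Cs" "set Cs = PP - {{1}}"
      define cs where "cs = map the_elem Cs"
      have "\<And>C. C \<in> set Cs \<Longrightarrow> {the_elem C} = C" using Cs(2) unfolding P1 by auto
      then have Cs_eq: "Cs = map (\<lambda>x. {x}) cs" unfolding cs_def by (simp add: map_idI comp_def)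
      have "distinct cs" using Cs(1) unfolding Cs_eq by (simp add: distinct_map)
      moreover have "(\<lambda>x. {x}) ` set cs = (\<lambda>x. {x}) ` {2..r}" using Cs(2) unfolding Cs_eq P1 by simp
      then have "set cs = {2..r}" by (simp add: inj_image_eq_iff)
      ultimately show "Poly_Mapping.lookup z (comb_chain {1} Cs) = 0" using R Cs_eq by blast
    qed
    then show "pm_map Some z \<in> bounds (r - 1)" unfolding bounds_eq by blast
  }
qed

abbreviation (input) "WF \<equiv> free_gmodule (words r) map :: ('k, nat list \<Rightarrow>\<^sub>0 'k, nat \<Rightarrow> nat) gmodule"

lemma is_gmodule_words: "is_gmodule (type_ring :: 'k ring) (sym_group r) WF"
proof (rule is_gmodule_free[OF sym_group_is_group])
  fix g x assume g: "g \<in> carrier (sym_group r)" and x: "x \<in> words r"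
  then have p: "g permutes {1..r}" by (simp only: sym_group_carrier)
  show "map g x \<in> words r"
    using x permutes_image[OF p] inj_on_subset[OF permutes_inj[OF p] subset_UNIV]
    unfolding words_def by (simp add: distinct_map)
qed (simp_all add: sym_group_one sym_group_mult)

text \<open>Equality under either map is decided by the numbers attached to the combs; the two
  families differ by the units \<open>word_sign r (1 # cs)\<close>, so the kernels coincide.\<close>

lemma top_homology:
  "gmodule_iso (type_ring :: 'k ring) (sym_group r)
    (reduced_homology (Kbar r) perm_simplex (r - 1))
    (tensor_gmodule (dual_gmodule (sym_group r) (Lie_operad r)) sgn_gmodule)"
proof -
  let ?G = "sym_group r"
  let ?R = "type_ring :: 'k ring"
  let ?D = "dual_gmodule ?G (Lie_operad r) :: ('k, _, nat \<Rightarrow> nat) gmodule"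
  let ?H = "reduced_homology (Kbar r) perm_simplex (r - 1) :: ('k, _, nat \<Rightarrow> nat) gmodule"
  let ?wf = "word_functional r :: (nat list \<Rightarrow>\<^sub>0 'k) \<Rightarrow> _"
  define \<phi> where "\<phi> f = hc (r - 1) (pm_map Some (chain_of_words f))" for f
  define \<psi> where "\<psi> = (\<lambda>f. sgn_tensor ?D (?wf f))"
  note D = is_gmodule_dual[OF is_gmodule_Lie_operad[of r, where 'k = 'k]]
  have WF: "carrier WF = {f. Poly_Mapping.keys f \<subseteq> words r}" "\<zero>\<^bsub>WF\<^esub> = 0" "f \<oplus>\<^bsub>WF\<^esub> f' = f + f'"
    "c \<odot>\<^bsub>WF\<^esub> f = pm_scale c f" "act WF g f = pm_map (map g) f" for f f' c g
    by (simp_all add: free_gmodule_def)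
  have in_cycles: "pm_map Some (chain_of_words f) \<in> carrier (ZM (r - 1))" if "Poly_Mapping.keys f \<subseteq> words r" for f
  proof -
    have "pm_map Some (chain_of_words f) \<in> cycles (r - 1)"
      unfolding cycles_eq using chain_of_words_cycle[OF that] by blast
    then show ?thesis by simp
  qed
  have lin: "chain_of_words (f + f') = chain_of_words f + chain_of_words f'"
    "chain_of_words (f - f') = chain_of_words f - chain_of_words f'"
    "chain_of_words (pm_scale c f) = pm_scale c (chain_of_words f)" "chain_of_words 0 = 0" for f f' c
    by (simp_all add: chain_of_words_def lin_ext_simps)
  have \<phi>_hom: "\<phi> \<in> gmodule_hom ?R ?G WF ?H"
    unfolding gmodule_hom_def homology_eq
  proof (intro CollectI conjI ballI)
    show "\<phi> \<in> carrier WF \<rightarrow> carrier (quotient_gmodule (ZM (r - 1)) (bounds (r - 1)))"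
      unfolding homology_quotient(1) \<phi>_def WF(1) using in_cycles by blast
    fix f assume "f \<in> carrier WF"
    then have f: "Poly_Mapping.keys f \<subseteq> words r" unfolding WF by blast
    show "\<phi> (f \<oplus>\<^bsub>WF\<^esub> f') = \<phi> f \<oplus>\<^bsub>quotient_gmodule (ZM (r - 1)) (bounds (r - 1))\<^esub> \<phi> f'" for f'
      unfolding \<phi>_def WF lin lin_ext_add homology_quotient(3) ..
    show "\<phi> (c \<odot>\<^bsub>WF\<^esub> f) = c \<odot>\<^bsub>quotient_gmodule (ZM (r - 1)) (bounds (r - 1))\<^esub> \<phi> f" for c
      unfolding \<phi>_def WF lin lin_ext_scale homology_quotient(4) ..
    fix g assume g: "g \<in> carrier ?G"
    have "act (quotient_gmodule (ZM (r - 1)) (bounds (r - 1))) g (\<phi> f) = hc (r - 1) (act (ZM (r - 1)) g (pm_map Some (chain_of_words f)))"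
      unfolding \<phi>_def
      by (rule coset_act[OF formal_cycles submodule_bounds is_gmodule_cycles g in_cycles[OF f] act_bounds])
    also have "act (ZM (r - 1)) g (pm_map Some (chain_of_words f)) = pm_map Some (pm_map (relabel g) (chain_of_words f))"
    proof -
      have "act (ZM (r - 1)) = act (CH (r - 1))" by simp
      then show ?thesis by (simp only: act_chains)
    qed
    finally show "\<phi> (act WF g f) = act (quotient_gmodule (ZM (r - 1)) (bounds (r - 1))) g (\<phi> f)"
      unfolding \<phi>_def WF chain_of_words_relabel by (rule sym)
  qed
  have ker: "\<phi> f = \<phi> f' \<longleftrightarrow> ?wf f = ?wf f'" if f: "Poly_Mapping.keys f \<subseteq> words r" "Poly_Mapping.keys f' \<subseteq> words r" for f f'
  proof -
    have d: "Poly_Mapping.keys (f - f') \<subseteq> words r" by (rule keys_diff_subset[OF f])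
    have "\<phi> f = \<phi> f' \<longleftrightarrow> pm_map Some (chain_of_words (f - f')) \<in> bounds (r - 1)"
      unfolding \<phi>_def coset_eq_iff[OF formal_cycles submodule_bounds] lin lin_ext_diff ..
    also have "\<dots> \<longleftrightarrow> (\<forall>cs. distinct cs \<and> set cs = {2..r} \<longrightarrow>
        Poly_Mapping.lookup (chain_of_words (f - f')) (comb_chain {1} (map (\<lambda>x. {x}) cs)) = 0)"
      by (rule cycle_bounds_iff[OF chain_of_words_cycle[OF d]])
    also have "\<dots> \<longleftrightarrow> (\<forall>cs. distinct cs \<and> set cs = {2..r} \<longrightarrow>
        pm_eval (\<lambda>s. word_sign r s * expansion (comb 1 cs) s) f = pm_eval (\<lambda>s. word_sign r s * expansion (comb 1 cs) s) f')"
    proof (intro all_cong1 imp_cong refl)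
      fix cs :: "nat list" assume cs: "distinct cs \<and> set cs = {2..r}"
      let ?e = "\<lambda>f. pm_eval (\<lambda>s. word_sign r s * expansion (comb 1 cs) s) f :: 'k"
      have sq: "word_sign r (1 # cs) * word_sign r (1 # cs) = (1 :: 'k)"
        using cs by (intro word_sign_square comb_word[OF r]) auto
      have "x = 0" if "word_sign r (1 # cs) * x = 0" for x :: 'k
      proof -
        have "word_sign r (1 # cs) * (word_sign r (1 # cs) * x) = 0" using that by simp
        then show "x = 0" by (simp only: mult.assoc[symmetric] sq mult_1)
      qed
      then have "word_sign r (1 # cs) * ?e (f - f') = 0 \<longleftrightarrow> ?e (f - f') = 0" by (auto simp only: mult_zero_right)
      then show "Poly_Mapping.lookup (chain_of_words (f - f')) (comb_chain {1} (map (\<lambda>x. {x}) cs)) = 0 \<longleftrightarrow> ?e f = ?e f'"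
        using lookup_chain_of_words[OF d] cs by (simp add: pm_eval_diff)
    qed
    also have "\<dots> \<longleftrightarrow> ?wf f = ?wf f'" by (rule word_functional_eq_iff[OF r, symmetric])
    finally show ?thesis .
  qed
  have \<phi>_surj: "\<phi> ` carrier WF = carrier ?H"
  proof
    show "\<phi> ` carrier WF \<subseteq> carrier ?H" using \<phi>_hom by (auto simp: gmodule_hom_def)
    show "carrier ?H \<subseteq> \<phi> ` carrier WF"
    proof
      fix h assume "h \<in> carrier ?H"
      then obtain z0 where z0: "z0 \<in> carrier (ZM (r - 1))" "h = hc (r - 1) z0"
        unfolding homology_eq homology_quotient(1) by blast
      then have "z0 \<in> cycles (r - 1)" by simp
      then obtain z where z: "z0 = pm_map Some z" "Poly_Mapping.keys z \<subseteq> full_chains (r - 1)" "dd z = 0"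
        unfolding cycles_eq by blast
      let ?C = "{cs. distinct cs \<and> set cs = {2..r}}"
      let ?v = "\<lambda>cs. Poly_Mapping.lookup z (comb_chain {1} (map (\<lambda>x. {x}) cs))"
      \<comment> \<open>The cycle of \<open>1 # cs\<close> has coefficient one at its own comb
        chain, because two equal word signs meet, and zero at the other combs. So the prescribed
        coefficients enter without a sign.\<close>
      define f where "f = (\<Sum>cs\<in>?C. Poly_Mapping.single (1 # cs) (?v cs))"
      have fin: "finite ?C" by (rule finite_words) simp
      have "Poly_Mapping.keys f \<subseteq> (\<Union>cs\<in>?C. Poly_Mapping.keys (Poly_Mapping.single (1 # cs) (?v cs)))"
        unfolding f_def by (rule keys_sum)
      then have f: "Poly_Mapping.keys f \<subseteq> words r" using comb_word[OF r] by (fastforce split: if_splits)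
      have look: "Poly_Mapping.lookup (chain_of_words f) (comb_chain {1} (map (\<lambda>x. {x}) cs)) = ?v cs"
        if cs: "distinct cs" "set cs = {2..r}" for cs
      proof -
        have "pm_eval (\<lambda>s. word_sign r s * expansion (comb 1 cs) s) f
            = (\<Sum>ds\<in>?C. ?v ds * (word_sign r (1 # ds) * expansion (comb 1 cs) (1 # ds)))"
          unfolding f_def pm_eval_sum pm_eval_single ..
        also have "(\<Sum>ds\<in>?C. ?v ds * (word_sign r (1 # ds) * expansion (comb 1 cs) (1 # ds)))
            = (\<Sum>ds\<in>?C. if ds = cs then ?v cs * word_sign r (1 # cs) else 0)"
        proof (intro sum.cong refl)
          fix ds
          have "expansion (comb 1 cs) (1 # ds) = (if ds = cs then 1 else (0 :: 'k))"
            using expansion_comb[of 1 cs "[]" ds] cs by (simp add: comb_coeff_Nil)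
          then show "?v ds * (word_sign r (1 # ds) * expansion (comb 1 cs) (1 # ds))
            = (if ds = cs then ?v cs * word_sign r (1 # cs) else 0)" by simp
        qed
        also have "\<dots> = ?v cs * word_sign r (1 # cs)" using fin cs by simp
        finally have "Poly_Mapping.lookup (chain_of_words f) (comb_chain {1} (map (\<lambda>x. {x}) cs))
            = word_sign r (1 # cs) * word_sign r (1 # cs) * ?v cs"
          unfolding lookup_chain_of_words[OF f cs] by (simp only: mult_ac)
        then show ?thesis unfolding word_sign_square[OF comb_word[OF r cs]] mult_1 .
      qed
      note c = chain_of_words_cycle[OF f]
      have keys_d: "Poly_Mapping.keys (z - chain_of_words f) \<subseteq> full_chains (r - 1)" by (rule keys_diff_subset[OF z(2) c(1)])
      have dd_d: "dd (z - chain_of_words f) = 0" unfolding dd_linear z(3) c(2) by simp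
      have "pm_map Some (z - chain_of_words f) \<in> bounds (r - 1)"
        unfolding cycle_bounds_iff[OF keys_d dd_d] lookup_minus using look by simp
      then have "h = \<phi> f"
        unfolding z0(2) z(1) \<phi>_def coset_eq_iff[OF formal_cycles submodule_bounds] lin_ext_diff .
      then show "h \<in> \<phi> ` carrier WF" using f unfolding WF by blast
    qed
  qed
  have \<phi>_zero: "\<phi> \<zero>\<^bsub>WF\<^esub> = \<zero>\<^bsub>?H\<^esub>"
    unfolding \<phi>_def WF lin homology_eq homology_quotient(2) lin_ext_zero homology_quotient(5) ..
  have \<psi>_hom: "\<psi> \<in> gmodule_hom ?R ?G WF (tensor_gmodule ?D sgn_gmodule)"
    unfolding \<psi>_def
  proof (rule sgn_tensor_hom[OF D])
    fix g f assume "g \<in> carrier ?G" "f \<in> carrier WF"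
    then show "?wf (act WF g f) = of_int (sign g) \<odot>\<^bsub>?D\<^esub> act ?D g (?wf f)"
      unfolding WF mem_Collect_eq by (rule act_word_functional)
  qed (simp_all only: WF word_functional_dual word_functional_add word_functional_scale)
  have wf_surj: "?wf ` carrier WF = carrier ?D"
    using word_functional_surj[OF r] word_functional_dual unfolding WF by blast
  have \<psi>_surj: "\<psi> ` carrier WF = carrier (tensor_gmodule ?D sgn_gmodule)"
  proof -
    have "\<psi> ` carrier WF = sgn_tensor ?D ` ?wf ` carrier WF" by (simp only: \<psi>_def image_image)
    then show ?thesis unfolding wf_surj sgn_tensor_surj[OF D] .
  qed
  have \<psi>_zero: "\<psi> \<zero>\<^bsub>WF\<^esub> = \<zero>\<^bsub>tensor_gmodule ?D sgn_gmodule\<^esub>"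
  proof -
    have "?wf 0 = \<zero>\<^bsub>?D\<^esub>" by (simp add: word_functional_def dual_gmodule_simps)
    then show ?thesis unfolding \<psi>_def WF by (simp only: sgn_tensor_zero[OF D])
  qed
  have "\<phi> f = \<phi> f' \<longleftrightarrow> \<psi> f = \<psi> f'" if "f \<in> carrier WF" "f' \<in> carrier WF" for f f'
  proof -
    have "\<psi> f = \<psi> f' \<longleftrightarrow> ?wf f = ?wf f'"
    proof
      assume "\<psi> f = \<psi> f'"
      then show "?wf f = ?wf f'" unfolding \<psi>_def
        by (rule sgn_tensor_dual_inj[OF is_gmodule_Lie_operad word_functional_dual word_functional_dual])
    qed (simp only: \<psi>_def)
    then show ?thesis using ker that unfolding WF by blast
  qed
  then show ?thesis
    by (rule gmodule_iso_of_surjections[OF is_gmodule_words \<phi>_hom \<phi>_surj \<phi>_zero \<psi>_hom \<psi>_surj \<psi>_zero])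
qed

end

text \<open>Stated for all commutative coefficient rings, of which the three cases of the theorem
  are instances.\<close>

lemma reduced_homology_Kbar_iso:
  assumes "r \<ge> 1"
  shows "graded_gmodule_iso (type_ring :: 'k::comm_ring_1 ring) (sym_group r)
       (reduced_homology (Kbar r) perm_simplex)
       (\<lambda>n. if n = r - 1 then tensor_gmodule (dual_gmodule (sym_group r) (Lie_operad r)) sgn_gmodule
             else zero_gmodule)"
  unfolding graded_gmodule_iso_def
proof
  fix n
  show "gmodule_iso (type_ring :: 'k ring) (sym_group r) (reduced_homology (Kbar r) perm_simplex n)
     (if n = r - 1 then tensor_gmodule (dual_gmodule (sym_group r) (Lie_operad r)) sgn_gmodule else zero_gmodule)"
  proof (cases "n = r - 1")
    case True
    show ?thesis unfolding True if_P[OF refl] by (rule top_homology[OF assms])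
  next
    case False
    show ?thesis unfolding if_not_P[OF False] by (rule homology_trivial[OF assms False])
  qed
qed

theorem mainTheorem1:
  fixes r :: nat
  assumes "r \<ge> 1"
  shows
    "graded_gmodule_iso (type_ring :: int ring) (sym_group r)
       (reduced_homology (Kbar r) perm_simplex)
       (\<lambda>n. if n = r - 1 then tensor_gmodule (dual_gmodule (sym_group r) (Lie_operad r)) sgn_gmodule
             else zero_gmodule)
     \<and> graded_gmodule_iso (type_ring :: rat ring) (sym_group r)
       (reduced_homology (Kbar r) perm_simplex)
       (\<lambda>n. if n = r - 1 then tensor_gmodule (dual_gmodule (sym_group r) (Lie_operad r)) sgn_gmodule
             else zero_gmodule)
     \<and> graded_gmodule_iso (type_ring :: 'p::prime_card mod_ring ring) (sym_group r)
       (reduced_homology (Kbar r) perm_simplex)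
       (\<lambda>n. if n = r - 1 then tensor_gmodule (dual_gmodule (sym_group r) (Lie_operad r)) sgn_gmodule
             else zero_gmodule)"
  by (intro conjI reduced_homology_Kbar_iso[OF assms])

end
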